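(* Let $g\ge 2$ be an integer. Consider the Diophantine equation $$F_k=d_1\frac{g^\ell-1}{g-1}\cdot d_2\frac{g^m-1}{g-1}\cdot d_3\frac{g^n-1}{g-1}$$ in positive integers $k,d_1,d_2,d_3,\ell,m,n$ with $1\le d_1,d_2,d_3\le g-1$, $n\ge 1$ and $\ell\le m\le n$. This equation has only finitely many solutions. Namely, every solution satisfies $$\ell\le m\le n<1.08\times 10^{48}\log^9 g\quad\text{and}\quad k<1.08\times 10^{49}\log^{10} g.$$
   Context: $(F_n)_{n\ge 0}$ is the Fibonacci sequence: $F_0=0$, $F_1=1$, $F_{n+2}=F_{n+1}+F_n$. $\log$ denotes the natural logarithm. A repdigit in base $g$ is a number of the form $d\,\frac{g^m-1}{g-1}$ with $m\ge1$ and $1\le d\le g-1$. *)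

theory Defs
  imports Complex_Main "HOL-Number_Theory.Fib"
begin

text \<open>The base-g repunit (g^m - 1)/(g - 1) = 1 + g + ... + g^(m-1) (exact division for g \<ge> 2).\<close>
definition repunit :: "nat \<Rightarrow> nat \<Rightarrow> nat" where
  "repunit g m = (g ^ m - 1) div (g - 1)"

end

theory Submission
  imports Defs "Subresultants.Subresultant_Gcd" "HOL-Computational_Algebra.Field_as_Ring"
    "HOL-Computational_Algebra.Primes" "HOL-Library.FuncSet" "HOL-Library.Product_Plus"
begin

text \<open>By Binet's formula, \<open>golden ^ k\<close> is within a factor \<open>1 + O(g ^ (- l))\<close> of a number
  \<open>eta * g ^ (l + m + n)\<close> with \<open>eta\<close> of bounded height. A lower bound for the linear form
  \<open>ln eta + N ln g - k ln golden\<close> therefore bounds \<open>l\<close>; moving the factor \<open>g ^ l - 1\<close> into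
  \<open>eta\<close> then bounds \<open>m\<close>, and moving \<open>g ^ m - 1\<close> there as well bounds \<open>n\<close>, up to powers of \<open>ln n\<close>.

  The lower bound comes from Schneider's method. At the integer points \<open>(u, v, w)\<close> consider
  \<open>z1 = u + k w\<close>, \<open>z2 = v - N w\<close> and \<open>y = golden ^ u * g ^ v * eta ^ w\<close>. If the form is tiny then \<open>y\<close> is
  almost \<open>exp (z1 ln golden + z2 ln g)\<close>, so that few Taylor coefficients control all the monomials
  \<open>z1 ^ i * z2 ^ j * y ^ e\<close>: the pigeonhole principle yields an integer combination that is small at
  all points of a box, hence zero there by Liouville's inequality in the integers of the field of \<open>sqrt 5\<close>.
  Eliminating \<open>y\<close> between translates leaves a nonzero polynomial in \<open>z1, z2\<close> that vanishes on a sumset.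
  By resultants this is impossible unless many points lie on one line, and on that line the same
  argument with a single coordinate and polynomials of twice the degree gives the contradiction.\<close>

section \<open>Zeros of bivariate polynomials on sumsets\<close>

text \<open>The sizes of the parameters are forced. Monomials in \<open>z1, z2\<close> are as large
  as \<open>exp (b * K)\<close>, while truncating Taylor series gains only about
  \<open>exp (- 4 * q * K)\<close>; so \<open>q\<close> must be a multiple of \<open>b\<close>, and
  \<open>2.5 * b\<close> is enough. The zero estimate needs more than
  \<open>2 * (8 * q * K) ^ 2\<close> points, and a box that Liouville's inequality can afford has of
  the order of \<open>K ^ 3 / (lam * h)\<close>; so \<open>K\<close> is of order
  \<open>b ^ 2 * lam * h\<close>. The resulting bound \<open>exp (- c * q * K)\<close> is
  \<open>exp (- c' * b ^ 3 * lam * h)\<close>, linear in the height \<open>h\<close> of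
  \<open>eta\<close>. Three applications bound \<open>n\<close> by a multiple of
  \<open>b ^ 9 * lam ^ 3\<close> with \<open>b\<close> of order \<open>ln n\<close>. The obstacle is
  that \<open>eta\<close> may be multiplicatively dependent on \<open>golden\<close> and
  \<open>g\<close>, and that the points may crowd on a line of the plane. Only the independence of
  \<open>golden\<close> and \<open>g\<close> is available. It provides distinct values of
  \<open>y\<close> for the elimination, both in the plane and on a crowded line, and it makes the
  bound cover \<open>Lam = 0\<close> as well.\<close>

definition ev2 :: "real poly poly \<Rightarrow> real \<Rightarrow> real \<Rightarrow> real" where
  "ev2 p a b = poly (poly p [:a:]) b"

lemma ev2_0 [simp]: "ev2 0 a b = 0"
  and ev2_1 [simp]: "ev2 1 a b = 1"
  and ev2_add [simp]: "ev2 (p + q) a b = ev2 p a b + ev2 q a b"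
  and ev2_mult [simp]: "ev2 (p * q) a b = ev2 p a b * ev2 q a b"
  and ev2_power [simp]: "ev2 (p ^ n) a b = ev2 p a b ^ n"
  and ev2_monom: "ev2 (monom c i) a b = poly c b * a ^ i"
  by (simp_all add: ev2_def poly_monom poly_power)

lemma ev2_sum: "ev2 (sum f A) a b = (\<Sum>x\<in>A. ev2 (f x) a b)"
  by (induction A rule: infinite_finite_induct) auto

lemma ev2_nonzero:
  assumes "p \<noteq> 0" obtains a b where "ev2 p a b \<noteq> 0"
proof -
  have fin: "finite {x. poly p x = 0}" using assms by (rule poly_roots_finite)
  have "infinite (range (\<lambda>a::real. [:a:]))"
    using finite_imageD[of "\<lambda>a::real. [:a:]" UNIV] infinite_UNIV_char_0[where 'a = real] by (auto simp: inj_on_def)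
  then obtain a :: real where a: "poly p [:a:] \<noteq> 0"
    using fin finite_subset[of "range (\<lambda>a::real. [:a:])" "{x. poly p x = 0}"] by blast
  have "finite {x. poly (poly p [:a:]) x = 0}" using a by (rule poly_roots_finite)
  then obtain b where "poly (poly p [:a:]) b \<noteq> 0"
    using infinite_UNIV_char_0[where 'a = real] finite_subset[of UNIV "{x. poly (poly p [:a:]) x = 0}"]
    by blast
  then show ?thesis using that by (simp add: ev2_def)
qed

text \<open>Identities between translated or swapped polynomials are proved by comparing values,
  where both operations are mere substitutions.\<close>

lemma ev2_eqI: assumes "\<And>a b. ev2 p a b = ev2 q a b" shows "p = q"
proof (rule ccontr)
  assume "p \<noteq> q"
  then have "p - q \<noteq> 0" by simp
  then obtain a b where "ev2 (p - q) a b \<noteq> 0" by (rule ev2_nonzero)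
  then show False using assms by (simp add: ev2_def)
qed

text \<open>In \<open>real poly poly\<close> the outer variable is the first coordinate, so the two
  shifts sit at different levels: by \<open>snd e\<close> inside the coefficients, by
  \<open>fst e\<close> in the outer polynomial.\<close>

definition translate :: "real \<times> real \<Rightarrow> real poly poly \<Rightarrow> real poly poly" where
  "translate e p = pcompose (map_poly (\<lambda>c. pcompose c [:snd e, 1:]) p) [:[:fst e:], 1:]"

lemma poly_map_pcompose:
  "poly (poly (map_poly (\<lambda>c. pcompose c r) p) s) t = poly (map_poly (\<lambda>c. poly c (poly r t)) p) (poly s t)"
  by (induction p) (auto simp: map_poly_pCons poly_pcompose)

lemma ev2_altdef: "ev2 p a b = poly (map_poly (\<lambda>c. poly c b) p) a"
  by (induction p) (auto simp: ev2_def map_poly_pCons)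

lemma ev2_translate [simp]: "ev2 (translate e p) a b = ev2 p (a + fst e) (b + snd e)"
proof -
  have "ev2 (translate e p) a b = poly (map_poly (\<lambda>c. poly c (poly [:snd e, 1:] b)) p) (poly ([:fst e:] + [:a:]) b)"
    unfolding ev2_def translate_def poly_pcompose by (simp add: poly_map_pcompose)
  then show ?thesis by (simp add: ev2_altdef[of p] algebra_simps)
qed

lemma ev2_on_line:
  obtains r :: "real poly" where "\<And>t. poly r t = ev2 p (A + t * \<alpha>) (B + t * \<beta>)"
proof
  show "poly (poly (map_poly (\<lambda>c. pcompose c [:B, \<beta>:]) p) [:A, \<alpha>:]) t = ev2 p (A + t * \<alpha>) (B + t * \<beta>)" for t
    by (simp add: poly_map_pcompose ev2_altdef algebra_simps)
qed

lemma translate_translate: "translate e (translate f p) = translate (fst e + fst f, snd e + snd f) p"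
  by (rule ev2_eqI) (simp add: algebra_simps)

lemma translate_0 [simp]: "translate (0, 0) p = p" "translate e 0 = 0"
  by (rule ev2_eqI, simp)+

lemma translate_mult: "translate e (p * q) = translate e p * translate e q"
  by (rule ev2_eqI) simp

lemma translate_minus: "translate (- fst e, - snd e) (translate e p) = p"
  "translate e (translate (- fst e, - snd e) p) = p"
  by (rule ev2_eqI, simp)+

lemma translate_dvd_iff: "translate e p dvd translate e q \<longleftrightarrow> p dvd q"
proof
  show "p dvd q \<Longrightarrow> translate e p dvd translate e q" by (auto simp: dvd_def translate_mult)
  assume "translate e p dvd translate e q"
  then obtain k where "translate e q = translate e p * k" by (auto simp: dvd_def)
  then have "translate (- fst e, - snd e) (translate e q) = translate (- fst e, - snd e) (translate e p) * translate (- fst e, - snd e) k"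
    by (simp add: translate_mult)
  then show "p dvd q" by (simp add: translate_minus)
qed

lemma translate_eq_0_iff [simp]: "translate e p = 0 \<longleftrightarrow> p = 0"
  by (metis translate_0(2) translate_minus(1))

lemma degree_translate [simp]: "degree (translate e p) = degree p"
proof -
  have "degree (map_poly (\<lambda>c. pcompose c [:snd e, 1:]) p) = degree p"
  proof (cases "p = 0")
    case False
    then have "pcompose (lead_coeff p) [:snd e, 1:] \<noteq> 0" using pcompose_eq_0 by fastforce
    then show ?thesis by (rule map_poly_degree_eq)
  qed simp
  then show ?thesis by (simp add: translate_def)
qed

text \<open>\<open>degree\<close> measures the outer variable only. Exchanging the variables makes
  the degree in the inner one an instance of \<open>degree\<close>, so that its behaviour under
  products and determinants is inherited.\<close>

definition swap_vars :: "real poly poly \<Rightarrow> real poly poly" where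
  "swap_vars p = (\<Sum>i\<le>degree p. \<Sum>j\<le>degree (coeff p i). monom (monom (coeff (coeff p i) j) i) j)"

abbreviation ideg :: "real poly poly \<Rightarrow> nat" where "ideg p \<equiv> degree (swap_vars p)"

lemma ev2_swap_vars [simp]: "ev2 (swap_vars p) b a = ev2 p a b"
proof -
  have "ev2 (swap_vars p) b a = (\<Sum>i\<le>degree p. \<Sum>j\<le>degree (coeff p i). coeff (coeff p i) j * a ^ i * b ^ j)"
    by (simp add: swap_vars_def ev2_sum ev2_monom poly_monom)
  also have "\<dots> = (\<Sum>i\<le>degree p. poly (coeff p i) b * a ^ i)"
    by (rule sum.cong) (simp_all add: poly_altdef sum_distrib_left mult_ac)
  also have "\<dots> = ev2 p a b"
    by (simp add: ev2_def poly_altdef[of p] poly_sum poly_power)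
  finally show ?thesis .
qed

lemma swap_vars_swap_vars [simp]: "swap_vars (swap_vars p) = p"
  and swap_vars_mult: "swap_vars (p * q) = swap_vars p * swap_vars q"
  and swap_vars_0 [simp]: "swap_vars 0 = 0"
  and swap_vars_translate: "swap_vars (translate e p) = translate (snd e, fst e) (swap_vars p)"
  by (rule ev2_eqI, simp)+

lemma swap_vars_eq_0_iff [simp]: "swap_vars p = 0 \<longleftrightarrow> p = 0"
  by (metis swap_vars_0 swap_vars_swap_vars)

lemma ideg_translate [simp]: "ideg (translate e p) = ideg p"
  by (simp add: swap_vars_translate)

lemma ideg_mult: "p \<noteq> 0 \<Longrightarrow> q \<noteq> 0 \<Longrightarrow> ideg (p * q) = ideg p + ideg q"
  by (simp add: swap_vars_mult degree_mult_eq)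

lemma ideg_prod: "(\<And>x. x \<in> A \<Longrightarrow> f x \<noteq> 0) \<Longrightarrow> ideg (prod f A) = (\<Sum>x\<in>A. ideg (f x))"
proof (induction A rule: infinite_finite_induct)
  have "swap_vars 1 = 1" by (rule ev2_eqI) simp
  then show "ideg (prod f {}) = (\<Sum>x\<in>{}. ideg (f x))" by simp
  then show "infinite A \<Longrightarrow> ideg (prod f A) = (\<Sum>x\<in>A. ideg (f x))" for A by simp
qed (auto simp: ideg_mult)

lemma coeff_swap_vars: "coeff (coeff (swap_vars p) j) i = coeff (coeff p i) j"
proof -
  have *: "coeff (coeff (\<Sum>j'\<le>degree (coeff p i'). monom (monom (coeff (coeff p i') j') i') j') j) i
     = (if i' = i then coeff (coeff p i) j else 0)" for i'
  proof -
    have "coeff (coeff (\<Sum>j'\<le>degree (coeff p i'). monom (monom (coeff (coeff p i') j') i') j') j) i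
       = (\<Sum>j'\<le>degree (coeff p i'). if j' = j then (if i' = i then coeff (coeff p i') j else 0) else 0)"
      unfolding coeff_sum by (rule sum.cong) auto
    also have "\<dots> = (if i' = i then coeff (coeff p i) j else 0)"
      by (auto simp: coeff_eq_0)
    finally show ?thesis .
  qed
  have "coeff (coeff (swap_vars p) j) i = (\<Sum>i'\<le>degree p. if i' = i then coeff (coeff p i) j else 0)"
    unfolding swap_vars_def coeff_sum by (rule sum.cong) (use * in \<open>simp_all only: coeff_sum\<close>)
  also have "\<dots> = coeff (coeff p i) j" by (auto simp: coeff_eq_0)
  finally show ?thesis .
qed

lemma ideg_le_iff: "ideg p \<le> d \<longleftrightarrow> (\<forall>i. degree (coeff p i) \<le> d)"
proof
  assume l: "ideg p \<le> d"
  show "\<forall>i. degree (coeff p i) \<le> d"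
  proof (intro allI degree_le impI)
    fix i j assume "d < j"
    then have "coeff (swap_vars p) j = 0" using l by (intro coeff_eq_0) auto
    then show "coeff (coeff p i) j = 0" using coeff_swap_vars[of p j i] by simp
  qed
next
  assume r: "\<forall>i. degree (coeff p i) \<le> d"
  show "ideg p \<le> d"
  proof (intro degree_le allI impI poly_eqI)
    fix i j assume "d < j"
    then have "degree (coeff p i) < j" using r le_less_trans by blast
    then show "coeff (coeff (swap_vars p) j) i = coeff 0 i"
      by (simp add: coeff_swap_vars coeff_eq_0)
  qed
qed

section \<open>Determinants and resultants\<close>

lemma degree_det_le_rows:
  fixes A :: "'a :: comm_ring_1 poly mat"
  assumes A: "A \<in> carrier_mat n n" and deg: "\<And>i j. i < n \<Longrightarrow> j < n \<Longrightarrow> degree (A $$ (i,j)) \<le> k i"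
  shows "degree (det A) \<le> (\<Sum>i<n. k i)"
proof -
  have "degree (of_int (sign p) * (\<Prod>i = 0..<n. A $$ (i, p i))) \<le> (\<Sum>i<n. k i)"
    if "p permutes {0..<n}" for p
  proof -
    have "degree (of_int (sign p) * (\<Prod>i = 0..<n. A $$ (i, p i))) \<le> degree (\<Prod>i = 0..<n. A $$ (i, p i))"
      by (rule order.trans[OF degree_mult_le]) simp
    also have "\<dots> \<le> (\<Sum>i = 0..<n. degree (A $$ (i, p i)))"
      using degree_prod_sum_le[of "{0..<n}" "\<lambda>i. A $$ (i, p i)"] by (simp add: o_def)
    also have "\<dots> \<le> (\<Sum>i = 0..<n. k i)"
      using that by (intro sum_mono deg) (auto simp: permutes_in_image[OF that, of i for i, simplified])
    finally show ?thesis by (simp add: lessThan_atLeast0)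
  qed
  then show ?thesis unfolding det_def'[OF A]
    by (intro degree_sum_le) (auto simp: finite_permutations)
qed

text \<open>The powers of \<open>a\<close> form a nonzero vector in the kernel of the Sylvester
  matrix evaluated at \<open>b\<close>. Arguing with the kernel avoids a comparison with the
  resultant of the evaluated polynomials, whose degrees may drop at \<open>b\<close>.\<close>

lemma resultant_root:
  fixes p q :: "real poly poly"
  assumes "degree p > 0" "ev2 p a b = 0" "ev2 q a b = 0"
  shows "poly (resultant p q) b = 0"
proof -
  define m n where "m = degree p" and "n = degree q"
  have h: "comm_ring_hom (\<lambda>c::real poly. poly c b)" by unfold_locales auto
  define S where "S = map_mat (\<lambda>c. poly c b) (sylvester_mat p q)"
  define v where "v = vec (m + n) (\<lambda>j. a ^ (m + n - 1 - j))"
  have S: "S \<in> carrier_mat (m + n) (m + n)"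
    by (simp add: S_def m_def n_def sylvester_carrier_mat)
  have v: "v \<in> carrier_vec (m + n)" by (simp add: v_def)
  have v0: "v \<noteq> 0\<^sub>v (m + n)"
  proof
    assume "v = 0\<^sub>v (m + n)"
    then have "v $ (m + n - 1) = 0" using assms(1) by (simp add: m_def)
    then show False using assms(1) by (simp add: v_def m_def)
  qed
  \<comment> \<open>The Sylvester rows are read as coefficients of \<open>x ^ (s + 1) * f\<close> at
    \<open>m + n - j\<close>; the surplus factor \<open>x\<close> compensates for the index being
    \<open>m + n - j\<close> and not \<open>m + n - 1 - j\<close>.\<close>
  have row: "(\<Sum>j<m+n. coeff (monom 1 (Suc s) * f) (m + n - j) * a ^ (m + n - 1 - j)) = a ^ s * poly f a"
    if "degree f + s < m + n" for f :: "real poly" and s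
  proof -
    have "(\<Sum>j<m+n. coeff (monom 1 (Suc s) * f) (m + n - j) * a ^ (m + n - 1 - j))
       = (\<Sum>t<m+n. coeff (monom 1 s * f) t * a ^ t)"
      by (rule sum.reindex_bij_witness[of _ "\<lambda>t. m + n - 1 - t" "\<lambda>t. m + n - 1 - t"])
         (auto simp: coeff_monom_mult)
    also have "\<dots> = (\<Sum>t\<le>degree (monom 1 s * f). coeff (monom 1 s * f) t * a ^ t)"
    proof (rule sum.mono_neutral_right)
      have "degree (monom 1 s * f) < m + n"
        by (rule le_less_trans[OF degree_mult_le]) (use that in \<open>simp add: degree_monom_eq\<close>)
      then show "{..degree (monom 1 s * f)} \<subseteq> {..<m+n}" by auto
    qed (auto simp: coeff_eq_0)
    also have "\<dots> = a ^ s * poly f a" by (simp flip: poly_altdef add: poly_monom)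
    finally show ?thesis .
  qed
  have "S *\<^sub>v v = 0\<^sub>v (m + n)"
  proof (rule eq_vecI)
    fix i assume "i < dim_vec (0\<^sub>v (m + n) :: real vec)"
    then have i: "i < m + n" by simp
    have eq: "(S *\<^sub>v v) $ i = (\<Sum>j<m+n. S $$ (i,j) * a ^ (m + n - 1 - j))"
      using i S by (simp add: v_def scalar_prod_def lessThan_atLeast0 mult_mat_vec_def)
    let ?P = "map_poly (\<lambda>c. poly c b) p" and ?Q = "map_poly (\<lambda>c. poly c b) q"
    have dP: "degree ?P \<le> m" and dQ: "degree ?Q \<le> n" unfolding m_def n_def by (rule degree_map_poly_le)+
    have cm: "coeff (monom 1 s * map_poly (\<lambda>c. poly c b) f) t = poly (coeff (monom 1 s * f) t) b" for s t f
      by (simp add: coeff_monom_mult coeff_map_poly)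
    show "(S *\<^sub>v v) $ i = 0\<^sub>v (m + n) $ i"
    proof (cases "i < n")
      case True
      have "(S *\<^sub>v v) $ i = (\<Sum>j<m+n. coeff (monom 1 (Suc (n - i - 1)) * ?P) (m + n - j) * a ^ (m + n - 1 - j))"
        unfolding eq using i True
        by (intro sum.cong) (auto simp: S_def cm m_def n_def sylvester_index_mat2 Suc_diff_Suc)
      also have "\<dots> = 0"
        using row[of ?P "n - i - 1"] assms(2) dP True by (simp add: ev2_altdef)
      finally show ?thesis using i by simp
    next
      case False
      have "(S *\<^sub>v v) $ i = (\<Sum>j<m+n. coeff (monom 1 (Suc (m + n - i - 1)) * ?Q) (m + n - j) * a ^ (m + n - 1 - j))"
        unfolding eq using i False
        by (intro sum.cong) (auto simp: S_def cm m_def n_def sylvester_index_mat2 Suc_diff_Suc)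
      also have "\<dots> = 0"
        using row[of ?Q "m + n - i - 1"] assms(3) dQ False i by (simp add: ev2_altdef)
      finally show ?thesis using i by simp
    qed
  qed (use S in simp)
  then have "det S = 0" using det_0_iff_vec_prod_zero[OF S] v v0 by blast
  then show ?thesis by (simp add: S_def resultant_def comm_ring_hom.hom_det[OF h])
qed

text \<open>\<open>degree q\<close> rows of the Sylvester matrix hold coefficients of
  \<open>p\<close>, and \<open>degree p\<close> rows those of \<open>q\<close>. The row bounds add
  up to the Bezout number of two curves of given bidegrees.\<close>

lemma degree_resultant_le:
  "degree (resultant p q) \<le> degree q * ideg p + degree p * ideg q" for p q :: "real poly poly"
proof -
  define m n where "m = degree p" and "n = degree q"
  have dp: "degree (coeff p i) \<le> ideg p" and dq: "degree (coeff q i) \<le> ideg q" for i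
    using ideg_le_iff[of p "ideg p"] ideg_le_iff[of q "ideg q"] by auto
  have "degree (resultant p q) \<le> (\<Sum>i<m+n. if i < n then ideg p else ideg q)"
    unfolding resultant_def
    by (rule degree_det_le_rows) (auto simp: m_def n_def sylvester_index_mat dp dq)
  also have "\<dots> = n * ideg p + m * ideg q"
  proof -
    have "(\<Sum>i<m+n. if i < n then ideg p else ideg q) = (\<Sum>i\<in>{..<n}. ideg p) + (\<Sum>i\<in>{n..<m+n}. ideg q)"
    proof -
      have "{..<m+n} \<inter> {i. i < n} = {..<n}" "{..<m+n} \<inter> - {i. i < n} = {n..<m+n}" by auto
      then show ?thesis by (simp add: sum.If_cases)
    qed
    then show ?thesis by simp
  qed
  finally show ?thesis by (simp add: m_def n_def)
qed

section \<open>Counting zeros of curves on finite point sets\<close>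

lemma card_le_card_image_mult:
  assumes "finite S" "\<And>x. x \<in> S \<Longrightarrow> card {y \<in> S. f y = f x} \<le> F"
  shows "card S \<le> card (f ` S) * F"
proof -
  have "S = (\<Union>v\<in>f ` S. {y \<in> S. f y = v})" by auto
  then have "card S \<le> (\<Sum>v\<in>f ` S. card {y \<in> S. f y = v})"
    using card_UN_le[of "f ` S" "\<lambda>v. {y \<in> S. f y = v}"] assms(1) by simp
  also have "\<dots> \<le> (\<Sum>v\<in>f ` S. F)" using assms(2) by (intro sum_mono) auto
  finally show ?thesis by simp
qed

lemma prod_prime_elems_dvd:
  fixes f :: "'b \<Rightarrow> 'a :: factorial_ring_gcd"
  assumes "finite A" "\<And>x. x \<in> A \<Longrightarrow> prime_elem (f x)" "\<And>x. x \<in> A \<Longrightarrow> f x dvd c"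
    "\<And>x y. x \<in> A \<Longrightarrow> y \<in> A \<Longrightarrow> x \<noteq> y \<Longrightarrow> \<not> f x dvd f y"
  shows "prod f A dvd c"
  using assms
proof (induction A rule: finite_induct)
  case (insert a A)
  have "coprime (f a) (prod f A)"
    by (rule prod_coprime_right) (use insert in \<open>auto intro!: prime_elem_imp_coprime\<close>)
  then show ?case using insert by (auto intro!: divides_mult)
qed auto

text \<open>The resultant eliminates the first variable, so it bounds the number of second
  coordinates; \<open>inj_on snd S\<close> turns this into a bound for points and is the reason for
  the later shear. A \<open>p\<close> of outer degree 0 is its own eliminant.\<close>

lemma card_common_zeros_le:
  fixes p q :: "real poly poly"
  assumes p: "prime_elem p" and npq: "\<not> p dvd q" and dq: "degree q \<le> d" "ideg q \<le> d" and d: "d \<ge> 1"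
    and fin: "finite S" and S: "\<And>\<sigma>. \<sigma> \<in> S \<Longrightarrow> ev2 p (fst \<sigma>) (snd \<sigma>) = 0 \<and> ev2 q (fst \<sigma>) (snd \<sigma>) = 0"
    and inj: "inj_on snd S"
  shows "card S \<le> (degree p + ideg p) * d"
proof (cases "degree p = 0")
  case True
  then obtain c where c: "p = [:c:]" by (rule degree_eq_zeroE)
  then have "c \<noteq> 0" using p by auto
  have "card S = card (snd ` S)" by (simp add: card_image inj)
  also have "\<dots> \<le> card {x. poly c x = 0}"
    by (rule card_mono) (use \<open>c \<noteq> 0\<close> S in \<open>auto simp: poly_roots_finite c ev2_def\<close>)
  also have "\<dots> \<le> degree c" using \<open>c \<noteq> 0\<close> by (rule card_poly_roots_bound)
  also have "\<dots> \<le> ideg p" using ideg_le_iff[of p "ideg p"] c by (metis coeff_pCons_0 order_refl)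
  also have "\<dots> \<le> (degree p + ideg p) * d" using d by (simp add: True)
  finally show ?thesis .
next
  case False
  let ?r = "resultant p q"
  have "coprime p q" using p npq by (rule prime_elem_imp_coprime)
  then have "degree (gcd p q) = 0" by simp
  then have r: "?r \<noteq> 0" using resultant_0_gcd[of p q] by auto
  have "card S = card (snd ` S)" by (simp add: card_image inj)
  also have "\<dots> \<le> card {x. poly ?r x = 0}"
    by (rule card_mono) (use r S False in \<open>auto simp: poly_roots_finite intro!: resultant_root[of p]\<close>)
  also have "\<dots> \<le> degree ?r" using r by (rule card_poly_roots_bound)
  also have "\<dots> \<le> degree q * ideg p + degree p * ideg q" by (rule degree_resultant_le)
  also have "\<dots> \<le> d * ideg p + degree p * d" using dq by (intro add_mono mult_mono) auto
  finally show ?thesis by (simp add: algebra_simps)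
qed

lemma prime_elem_translate: "prime_elem (translate e p) \<longleftrightarrow> prime_elem p"
proof -
  have *: "prime_elem (translate e p)" if "prime_elem p" for e p
  proof (rule prime_elemI)
    show "translate e p \<noteq> 0" using that by auto
    show "\<not> translate e p dvd 1"
      using translate_dvd_iff[of e p 1] that by (metis ev2_1 ev2_eqI ev2_translate prime_elem_def)
    fix a b assume "translate e p dvd a * b"
    then have "p dvd translate (- fst e, - snd e) a * translate (- fst e, - snd e) b"
      by (metis translate_dvd_iff translate_minus(2) translate_mult)
    then show "translate e p dvd a \<or> translate e p dvd b"
      using that by (metis prime_elem_dvd_mult_iff translate_dvd_iff translate_minus(2))
  qed
  show ?thesis using *[of p e] *[of "translate e p" "(- fst e, - snd e)"] by (auto simp: translate_minus)
qed

lemma poly_eq_0_if_nat_roots: "(\<And>n::nat. poly r (of_nat n) = 0) \<Longrightarrow> r = 0" for r :: "real poly"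
proof (rule ccontr)
  assume *: "\<And>n::nat. poly r (of_nat n) = 0" and "r \<noteq> 0"
  then have "finite {x. poly r x = 0}" by (intro poly_roots_finite)
  moreover have "range (of_nat :: nat \<Rightarrow> real) \<subseteq> {x. poly r x = 0}" using * by auto
  moreover have "infinite (range (of_nat :: nat \<Rightarrow> real))"
    using finite_imageD[of "of_nat :: nat \<Rightarrow> real" UNIV] by (auto simp: inj_on_def)
  ultimately show False using finite_subset by blast
qed

text \<open>Invariance up to a factor carries a zero along all multiples of \<open>\<delta>\<close>,
  hence along the whole line, since the restriction to a line is a polynomial in one variable. The
  curve is thus a union of parallel lines; an axis transversal to \<open>\<delta>\<close> meets at
  most \<open>degree p\<close> or \<open>ideg p\<close> of them, and each contains at most
  \<open>F\<close> points.\<close>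

lemma card_zeros_of_invariant_le:
  fixes p :: "real poly poly"
  assumes "p \<noteq> 0" and c: "translate \<delta> p = smult [:c:] p" and \<delta>: "\<delta> \<noteq> (0, 0)" and fin: "finite S"
    and S: "\<And>\<sigma>. \<sigma> \<in> S \<Longrightarrow> ev2 p (fst \<sigma>) (snd \<sigma>) = 0"
    and F: "\<And>s. card {\<sigma> \<in> S. \<exists>t. \<sigma> = (fst s + t * fst \<delta>, snd s + t * snd \<delta>)} \<le> F"
  shows "card S \<le> (degree p + ideg p) * F"
proof -
  have step: "ev2 p (A + fst \<delta>) (B + snd \<delta>) = c * ev2 p A B" for A B
    using arg_cong[OF c, of "\<lambda>q. ev2 q A B"] unfolding ev2_translate by (simp add: ev2_def)
  have multi: "ev2 p (A + of_nat n * fst \<delta>) (B + of_nat n * snd \<delta>) = c ^ n * ev2 p A B" for A B n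
  proof (induction n)
    case (Suc n)
    then show ?case using step[of "A + of_nat n * fst \<delta>" "B + of_nat n * snd \<delta>"] by (simp add: algebra_simps)
  qed simp
  have line: "ev2 p (A + t * fst \<delta>) (B + t * snd \<delta>) = 0" if "ev2 p A B = 0" for A B t
  proof -
    obtain r :: "real poly" where r: "\<And>t. poly r t = ev2 p (A + t * fst \<delta>) (B + t * snd \<delta>)"
      using ev2_on_line[of p A "fst \<delta>" B "snd \<delta>"] by blast
    have "r = 0" by (rule poly_eq_0_if_nat_roots) (simp add: r multi that)
    then show ?thesis using r[of t] by simp
  qed
  show ?thesis
  proof (cases "snd \<delta> = 0")
    case False
    \<comment> \<open>The projection along \<open>\<delta>\<close> to the axis where the second
      coordinate vanishes; its fibres are the lines in question.\<close>
    define f where "f = (\<lambda>\<sigma>. fst \<sigma> - snd \<sigma> / snd \<delta> * fst \<delta>)"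
    define q where "q = map_poly (\<lambda>c. poly c 0) p"
    have q: "poly q a = ev2 p a 0" for a by (simp add: q_def ev2_altdef)
    have "q \<noteq> 0"
    proof
      assume "q = 0"
      have "ev2 p A B = 0" for A B
        using line[of "A - B / snd \<delta> * fst \<delta>" 0 "B / snd \<delta>"] q[of "A - B / snd \<delta> * fst \<delta>"] \<open>q = 0\<close> False by simp
      then show False using ev2_nonzero[OF \<open>p \<noteq> 0\<close>] by metis
    qed
    have "f ` S \<subseteq> {x. poly q x = 0}"
      using S line[of "fst \<sigma>" "snd \<sigma>" "- snd \<sigma> / snd \<delta>" for \<sigma>] False by (auto simp: q f_def)
    then have "card (f ` S) \<le> card {x. poly q x = 0}" by (intro card_mono poly_roots_finite \<open>q \<noteq> 0\<close>)
    also have "\<dots> \<le> degree q" using \<open>q \<noteq> 0\<close> by (rule card_poly_roots_bound)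
    also have "\<dots> \<le> degree p" unfolding q_def by (rule degree_map_poly_le)
    finally have "card (f ` S) \<le> degree p" .
    have "card S \<le> card (f ` S) * F"
    proof (rule card_le_card_image_mult[OF fin])
      fix x assume "x \<in> S"
      have "{y \<in> S. f y = f x} \<subseteq> {\<sigma> \<in> S. \<exists>t. \<sigma> = (fst x + t * fst \<delta>, snd x + t * snd \<delta>)}"
      proof safe
        fix a b :: real assume ab: "f (a, b) = f x"
        have "b = snd x + (b - snd x) / snd \<delta> * snd \<delta>" using False by simp
        moreover have "a = fst x + (b - snd x) / snd \<delta> * fst \<delta>"
          using ab by (simp add: f_def diff_divide_distrib algebra_simps)
        ultimately show "\<exists>t. (a, b) = (fst x + t * fst \<delta>, snd x + t * snd \<delta>)" by blast
      qed
      then show "card {y \<in> S. f y = f x} \<le> F" using F[of x] fin card_mono[of "{\<sigma> \<in> S. \<exists>t. \<sigma> = (fst x + t * fst \<delta>, snd x + t * snd \<delta>)}" "{y \<in> S. f y = f x}"] by (simp add: finite_subset)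
    qed
    also have "\<dots> \<le> (degree p + ideg p) * F" using \<open>card (f ` S) \<le> degree p\<close> by (intro mult_mono) auto
    finally show ?thesis .
  next
    case True
    then have d1: "fst \<delta> \<noteq> 0" using \<delta> by (cases \<delta>) auto
    define q where "q = poly p [:0:]"
    have q: "poly q b = ev2 p 0 b" for b by (simp add: q_def ev2_def)
    have "q \<noteq> 0"
    proof
      assume "q = 0"
      have "ev2 p A B = 0" for A B
        using line[of 0 B "A / fst \<delta>"] q[of B] \<open>q = 0\<close> d1 True by simp
      then show False using ev2_nonzero[OF \<open>p \<noteq> 0\<close>] by metis
    qed
    have "snd ` S \<subseteq> {x. poly q x = 0}"
      using S line[of "fst \<sigma>" "snd \<sigma>" "- fst \<sigma> / fst \<delta>" for \<sigma>] d1 True by (auto simp: q)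
    then have "card (snd ` S) \<le> card {x. poly q x = 0}" by (intro card_mono poly_roots_finite \<open>q \<noteq> 0\<close>)
    also have "\<dots> \<le> degree q" using \<open>q \<noteq> 0\<close> by (rule card_poly_roots_bound)
    also have "\<dots> \<le> ideg p" using ideg_le_iff[of p "ideg p"] by (simp add: q_def poly_0_coeff_0)
    finally have "card (snd ` S) \<le> ideg p" .
    have "card S \<le> card (snd ` S) * F"
    proof (rule card_le_card_image_mult[OF fin])
      fix x assume "x \<in> S"
      have "{y \<in> S. snd y = snd x} \<subseteq> {\<sigma> \<in> S. \<exists>t. \<sigma> = (fst x + t * fst \<delta>, snd x + t * snd \<delta>)}"
      proof safe
        fix a b :: real assume "snd (a, b) = snd x"
        then have "(a, b) = (fst x + (a - fst x) / fst \<delta> * fst \<delta>, snd x + (a - fst x) / fst \<delta> * snd \<delta>)"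
          using d1 True by simp
        then show "\<exists>t. (a, b) = (fst x + t * fst \<delta>, snd x + t * snd \<delta>)" by blast
      qed
      then show "card {y \<in> S. snd y = snd x} \<le> F" using F[of x] fin card_mono[of "{\<sigma> \<in> S. \<exists>t. \<sigma> = (fst x + t * fst \<delta>, snd x + t * snd \<delta>)}" "{y \<in> S. snd y = snd x}"] by (simp add: finite_subset)
    qed
    also have "\<dots> \<le> (degree p + ideg p) * F" using \<open>card (snd ` S) \<le> ideg p\<close> by (intro mult_mono) auto
    finally show ?thesis .
  qed
qed

text \<open>A curve vanishing on a sumset: each prime factor either meets some translate of the curve
  properly, so that the resultant bounds its zeros, or has too many translates dividing the curve and is
  therefore a union of parallel lines.\<close>

lemma card_zeros_of_sumset_le:
  fixes D :: "real poly poly"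
  assumes D: "D \<noteq> 0" "degree D \<le> d" "ideg D \<le> d" and d: "d \<ge> 1"
    and fin: "finite S1" "finite S2" and S10: "(0, 0) \<in> S1" and S1: "card S1 > d" and inj: "inj_on snd S2"
    and zero: "\<And>\<sigma> \<tau>. \<sigma> \<in> S1 \<Longrightarrow> \<tau> \<in> S2 \<Longrightarrow> ev2 D (fst \<tau> + fst \<sigma>) (snd \<tau> + snd \<sigma>) = 0"
    and F: "\<And>s \<delta>. \<delta> \<noteq> (0, 0) \<Longrightarrow> card {\<sigma> \<in> S2. \<exists>t. \<sigma> = (fst s + t * fst \<delta>, snd s + t * snd \<delta>)} \<le> F"
  shows "card S2 \<le> 2 * d * max d F"
proof -
  define Z where "Z = (\<lambda>p. {\<sigma> \<in> S2. ev2 p (fst \<sigma>) (snd \<sigma>) = 0})"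
  have finZ: "finite (Z p)" for p using fin by (simp add: Z_def)
  have prime_case: "card (Z p) \<le> (degree p + ideg p) * max d F" if p: "prime_elem p" and pD: "p dvd D" for p
  proof (cases "\<exists>e\<in>S1. \<not> p dvd translate e D")
    case True
    then obtain e where e: "e \<in> S1" "\<not> p dvd translate e D" by blast
    have "card (Z p) \<le> (degree p + ideg p) * d"
      by (rule card_common_zeros_le[OF p e(2)])
         (use D d e zero finZ inj in \<open>auto simp: Z_def intro: inj_on_subset\<close>)
    also have "\<dots> \<le> (degree p + ideg p) * max d F" by (intro mult_mono) auto
    finally show ?thesis .
  next
    case False
    \<comment> \<open>\<open>p\<close> divides every translate of \<open>D\<close> by an element of
      \<open>S1\<close>, so each \<open>f e\<close> divides \<open>D\<close> itself.\<close>
    define f where "f = (\<lambda>e. translate (- fst e, - snd e) p)"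
    have f: "prime_elem (f e)" for e using p by (simp add: f_def prime_elem_translate)
    have fD: "f e dvd D" if "e \<in> S1" for e
      using False that translate_dvd_iff[of "(- fst e, - snd e)" p "translate e D"] by (auto simp: f_def translate_minus)
    \<comment> \<open>Otherwise more than \<open>d\<close> primes, none dividing another, multiply
      to a divisor of \<open>D\<close>, and the degree bounds leave only a constant
      \<open>p\<close>.\<close>
    have "\<exists>e\<in>S1. \<exists>e'\<in>S1. e \<noteq> e' \<and> f e dvd f e'"
    proof (rule ccontr)
      assume "\<not> ?thesis"
      then have dvd: "prod f S1 dvd D" by (intro prod_prime_elems_dvd fin f fD) auto
      then obtain k where k: "D = prod f S1 * k" by (auto simp: dvd_def)
      have nz: "prod f S1 \<noteq> 0" "k \<noteq> 0" using k D by auto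
      have f0: "f e \<noteq> 0" for e using f[of e] by auto
      have "card S1 * degree p = degree (prod f S1)"
        by (subst degree_prod_eq_sum_degree) (use f0 in \<open>auto simp: f_def\<close>)
      also have "\<dots> \<le> d" using D k nz by (simp add: degree_mult_eq)
      finally have 1: "card S1 * degree p \<le> d" .
      have "card S1 * ideg p = ideg (prod f S1)"
        by (subst ideg_prod) (use f0 in \<open>auto simp: f_def\<close>)
      also have "\<dots> \<le> d" using D k nz by (simp add: ideg_mult)
      finally have 2: "card S1 * ideg p \<le> d" .
      have "degree p = 0" "ideg p = 0" using 1 2 S1
        by (metis leD le_trans mult.commute mult_le_mono1 nat_mult_1 not_less_eq_eq One_nat_def neq0_conv Suc_leI)+
      then obtain c where c: "p = [:c:]" by (metis degree_eq_zeroE)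
      have "degree c = 0" using \<open>ideg p = 0\<close> ideg_le_iff[of p 0] c by (metis coeff_pCons_0 le_zero_eq)
      then obtain c' where "c = [:c':]" by (metis degree_eq_zeroE)
      then have "p dvd 1" using p c by (auto simp: is_unit_const_poly_iff)
      then show False using p by simp
    qed
    then obtain e e' where e: "e \<in> S1" "e' \<in> S1" "e \<noteq> e'" "f e dvd f e'" by blast
    define \<delta> where "\<delta> = (fst e - fst e', snd e - snd e')"
    have \<delta>0: "\<delta> \<noteq> (0, 0)" using e(3) by (cases e; cases e') (auto simp: \<delta>_def)
    \<comment> \<open>Since translation keeps both degrees, the quotient is a constant:
      \<open>p\<close> is invariant up to a factor.\<close>
    have "p dvd translate \<delta> p"
      using e(4) translate_dvd_iff[of e "f e" "f e'"] by (simp add: f_def \<delta>_def translate_translate)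
    then obtain k where k: "translate \<delta> p = p * k" by (auto simp: dvd_def)
    have p0: "p \<noteq> 0" using p by auto
    then have k0: "k \<noteq> 0" using k by (metis mult_zero_right translate_eq_0_iff)
    have "degree p = degree p + degree k" using arg_cong[OF k, of degree] p0 k0 by (simp add: degree_mult_eq)
    then obtain c where c: "k = [:c:]" by (metis add_cancel_right_right degree_eq_zeroE)
    have "ideg p = ideg p + ideg k" using arg_cong[OF k, of ideg] p0 k0 by (simp add: ideg_mult)
    then have "degree c = 0" using ideg_le_iff[of k 0] c by (metis add_cancel_right_right coeff_pCons_0 le_zero_eq)
    then obtain c' where c': "c = [:c':]" by (metis degree_eq_zeroE)
    have "card (Z p) \<le> (degree p + ideg p) * F"
    proof (rule card_zeros_of_invariant_le[OF p0 _ \<delta>0 finZ])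
      show "translate \<delta> p = smult [:c':] p" using k c c' by simp
      fix s
      have "card {\<sigma> \<in> Z p. \<exists>t. \<sigma> = (fst s + t * fst \<delta>, snd s + t * snd \<delta>)} \<le>
        card {\<sigma> \<in> S2. \<exists>t. \<sigma> = (fst s + t * fst \<delta>, snd s + t * snd \<delta>)}"
        by (rule card_mono) (use fin in \<open>auto simp: Z_def\<close>)
      then show "card {\<sigma> \<in> Z p. \<exists>t. \<sigma> = (fst s + t * fst \<delta>, snd s + t * snd \<delta>)} \<le> F"
        using F[OF \<delta>0, of s] by linarith
    qed (auto simp: Z_def)
    also have "\<dots> \<le> (degree p + ideg p) * max d F" by (intro mult_mono) auto
    finally show ?thesis .
  qed
  \<comment> \<open>Zeros are subadditive and both degrees additive over the prime factorization, so
    the bounds for primes add up.\<close>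
  have "E \<noteq> 0 \<longrightarrow> E dvd D \<longrightarrow> card (Z E) \<le> (degree E + ideg E) * max d F" for E
  proof (induction E rule: prime_divisors_induct)
    case (unit x)
    then obtain y where y: "1 = x * y" by (auto simp: dvd_def)
    have "Z x = {}"
    proof -
      have "ev2 x a b * ev2 y a b = 1" for a b using arg_cong[OF y, of "\<lambda>q. ev2 q a b"] by simp
      then have "ev2 x a b \<noteq> 0" for a b by (metis mult_zero_left zero_neq_one)
      then show ?thesis by (simp add: Z_def)
    qed
    then show ?case by simp
  next
    case (factor p x)
    show ?case
    proof (intro impI)
      assume nz: "p * x \<noteq> 0" and dvd: "p * x dvd D"
      have "Z (p * x) \<subseteq> Z p \<union> Z x" by (auto simp: Z_def)
      then have "card (Z (p * x)) \<le> card (Z p) + card (Z x)"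
        by (meson card_Un_le card_mono finZ finite_UnI le_trans)
      also have "\<dots> \<le> (degree p + ideg p) * max d F + (degree x + ideg x) * max d F"
        using factor nz dvd prime_case[of p] by (auto dest: dvd_mult_left dvd_mult_right)
      also have "\<dots> = (degree (p * x) + ideg (p * x)) * max d F"
        using nz by (simp add: degree_mult_eq ideg_mult algebra_simps)
      finally show "card (Z (p * x)) \<le> (degree (p * x) + ideg (p * x)) * max d F" .
    qed
  qed simp
  then have "card (Z D) \<le> (degree D + ideg D) * max d F" using D by simp
  also have "\<dots> \<le> (2 * d) * max d F" using D by (intro mult_mono) auto
  finally have *: "card (Z D) \<le> 2 * d * max d F" .
  have "Z D = S2" using zero[OF S10] by (auto simp: Z_def)
  then show ?thesis using * by simp
qed

text \<open>The weak form of Descartes' rule: after division by the lowest power, Rolle's theorem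
  removes one term and at most one zero. It makes generalized Vandermonde matrices at distinct
  positive nodes invertible, whatever the gaps between the exponents.\<close>

lemma sparse_poly_positive_roots:
  fixes c :: "nat \<Rightarrow> real"
  assumes "finite I" "finite S" "card S \<ge> card I" "I \<noteq> {}"
    and "\<And>x. x \<in> S \<Longrightarrow> x > 0 \<and> (\<Sum>i\<in>I. c i * x ^ i) = 0"
  shows "\<forall>i\<in>I. c i = 0"
  using assms
proof (induction "card I" arbitrary: I S c rule: less_induct)
  case less
  define m where "m = Min I"
  have mI: "m \<in> I" using less.prems by (simp add: m_def)
  have mle: "m \<le> i" if "i \<in> I" for i using less.prems that by (simp add: m_def)
  define q where "q = (\<lambda>x. \<Sum>i\<in>I. c i * x ^ (i - m))"
  have q0: "q x = 0" if "x \<in> S" for x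
  proof -
    have "(\<Sum>i\<in>I. c i * x ^ i) = x ^ m * q x"
      unfolding q_def sum_distrib_left by (rule sum.cong) (auto simp: mle power_add[symmetric] simp del: power_add)
    then show ?thesis using less.prems(5)[OF that] by simp
  qed
  define I' where "I' = (\<lambda>i. i - m - 1) ` (I - {m})"
  have injI: "inj_on (\<lambda>i. i - m - 1) (I - {m})"
  proof (rule inj_onI)
    fix x y assume "x \<in> I - {m}" "y \<in> I - {m}" "x - m - 1 = y - m - 1"
    moreover have "m < x" "m < y" using calculation mle by (metis DiffE insertI1 le_neq_implies_less)+
    ultimately show "x = y" by linarith
  qed
  have cardI': "card I' = card I - 1" unfolding I'_def card_image[OF injI] using mI less.prems by simp
  have *: "c i = 0" if "i \<in> I - {m}" for i
  proof -
    define c' where "c' = (\<lambda>j. c (j + m + 1) * real (j + 1))"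
    define q' where "q' = (\<lambda>x. \<Sum>j\<in>I'. c' j * x ^ j)"
    have deriv: "(q has_real_derivative q' x) (at x)" for x
    proof -
      have "(q has_real_derivative (\<Sum>i\<in>I. c i * (real (i - m) * x ^ (i - m - 1)))) (at x)"
        unfolding q_def by (auto intro!: derivative_eq_intros sum.cong)
      also have "(\<Sum>i\<in>I. c i * (real (i - m) * x ^ (i - m - 1))) = (\<Sum>i\<in>I-{m}. c i * (real (i - m) * x ^ (i - m - 1)))"
        by (rule sum.mono_neutral_right) (use less.prems in auto)
      also have "\<dots> = q' x"
        unfolding q'_def I'_def sum.reindex[OF injI] o_def
      proof (rule sum.cong)
        fix i assume "i \<in> I - {m}"
        then have "m < i" using mle by (metis DiffE insertI1 le_neq_implies_less)
        then show "c i * (real (i - m) * x ^ (i - m - 1)) = c' (i - m - 1) * x ^ (i - m - 1)"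
          by (simp add: c'_def)
      qed simp
      finally show ?thesis .
    qed
    have S_ge: "card S \<ge> 1" using less.prems by (metis card_gt_0_iff le_trans less_eq_Suc_le One_nat_def)
    define xs where "xs = sorted_list_of_set S"
    have xs: "sorted_wrt (<) xs" "set xs = S" "length xs = card S"
      using less.prems by (auto simp: xs_def strict_sorted_list_of_set)
    have ex: "\<exists>z. xs ! k < z \<and> z < xs ! Suc k \<and> q' z = 0" if "Suc k < card S" for k
    proof -
      have lt: "xs ! k < xs ! Suc k" using xs that by (simp add: sorted_wrt_nth_less)
      have "q (xs ! k) = q (xs ! Suc k)" using q0 xs that by (metis Suc_lessD nth_mem)
      moreover have "continuous_on {xs ! k..xs ! Suc k} q"
        using deriv by (meson DERIV_isCont continuous_at_imp_continuous_on)
      ultimately obtain z where "xs ! k < z" "z < xs ! Suc k" "(\<lambda>v. q' z * v) = (\<lambda>v. 0)"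
        using Rolle_deriv[OF lt, of q "\<lambda>x v. q' x * v"] deriv by (auto simp: has_field_derivative_def)
      then show ?thesis by (metis mult_1_right)
    qed
    then obtain z where z: "\<And>k. Suc k < card S \<Longrightarrow> xs ! k < z k \<and> z k < xs ! Suc k \<and> q' (z k) = 0"
      by metis
    have mono: "z k < z k'" if "k < k'" "Suc k' < card S" for k k'
    proof -
      have "xs ! Suc k \<le> xs ! k'" using xs that
        by (metis Suc_leI Suc_lessD le_neq_implies_less less_eq_real_def sorted_wrt_nth_less)
      then show ?thesis using z[of k] z[of k'] that by (smt (verit) Suc_lessD Suc_lessI less_trans)
    qed
    define S' where "S' = z ` {..<card S - 1}"
    have "inj_on z {..<card S - 1}"
      by (rule linorder_inj_onI) (use mono in \<open>fastforce\<close>)+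
    then have cS': "card S' = card S - 1" by (simp add: S'_def card_image)
    have "\<forall>i\<in>I'. c' i = 0"
    proof (rule less.hyps)
      show "card I' < card I" using cardI' mI less.prems by (metis card_gt_0_iff diff_less less_numeral_extra(1))
      show "finite I'" "finite S'" using less.prems by (auto simp: I'_def S'_def)
      show "card I' \<le> card S'" using cardI' cS' less.prems by simp
      show "I' \<noteq> {}" using that by (auto simp: I'_def)
      fix x assume "x \<in> S'"
      then obtain k where k: "k < card S - 1" "x = z k" by (auto simp: S'_def)
      have "xs ! k \<in> S" using xs k by (metis diff_less less_trans nth_mem S_ge less_eq_Suc_le less_numeral_extra(1) One_nat_def less_le_trans)
      then show "0 < x \<and> (\<Sum>i\<in>I'. c' i * x ^ i) = 0"
        using z[of k] k less.prems(5)[of "xs ! k"] unfolding q'_def by force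
    qed
    then have "c' (i - m - 1) = 0" using that by (auto simp: I'_def)
    moreover have "m < i" using that mle by (metis DiffE insertI1 le_neq_implies_less)
    ultimately show ?thesis by (simp add: c'_def)
  qed
  have "S \<noteq> {}" using less.prems by (metis card_gt_0_iff card.empty leD)
  then obtain x where x: "x \<in> S" by blast
  have "q x = c m * x ^ (m - m) + (\<Sum>i\<in>I-{m}. c i * x ^ (i - m))"
    unfolding q_def by (rule sum.remove) (use less.prems mI in auto)
  then have "c m = 0" using q0[OF x] * by simp
  then show ?case using * by auto
qed

section \<open>Top coefficients of determinants of polynomials\<close>

lemma coeff_mult_top:
  fixes p q :: "'a :: comm_semiring_1 poly"
  assumes "degree p \<le> m" "degree q \<le> n"
  shows "coeff (p * q) (m + n) = coeff p m * coeff q n"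
proof -
  have "coeff (p * q) (m + n) = (\<Sum>i\<le>m+n. if i = m then coeff p m * coeff q n else 0)"
    unfolding coeff_mult
  proof (rule sum.cong)
    fix i assume "i \<in> {..m+n}"
    then show "coeff p i * coeff q (m + n - i) = (if i = m then coeff p m * coeff q n else 0)"
      using assms by (cases i m rule: linorder_cases) (auto simp: coeff_eq_0)
  qed simp
  then show ?thesis by simp
qed

lemma coeff_prod_top:
  fixes f :: "'b \<Rightarrow> 'a :: comm_semiring_1 poly"
  assumes "finite A" "\<And>x. x \<in> A \<Longrightarrow> degree (f x) \<le> k x"
  shows "coeff (prod f A) (sum k A) = (\<Prod>x\<in>A. coeff (f x) (k x)) \<and> degree (prod f A) \<le> sum k A"
  using assms
proof (induction A rule: finite_induct)
  case (insert a A)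
  then have IH: "coeff (prod f A) (sum k A) = (\<Prod>x\<in>A. coeff (f x) (k x))" "degree (prod f A) \<le> sum k A" by auto
  have "coeff (f a * prod f A) (k a + sum k A) = coeff (f a) (k a) * coeff (prod f A) (sum k A)"
    using insert.prems[of a] IH(2) by (intro coeff_mult_top) auto
  moreover have "degree (f a * prod f A) \<le> k a + sum k A"
    by (rule order.trans[OF degree_mult_le]) (use insert.prems IH in \<open>auto intro: add_mono\<close>)
  ultimately show ?case using insert IH by simp
qed simp

text \<open>Each Leibniz term uses every column once, so its coefficient at the sum of the column
  bounds is the product of top coefficients. Applied twice, once per variable, this extracts a real
  matrix from the matrix of translates.\<close>

lemma coeff_det_top:
  fixes M :: "'a :: comm_ring_1 poly mat"
  assumes M: "M \<in> carrier_mat n n" and "\<And>i j. i < n \<Longrightarrow> j < n \<Longrightarrow> degree (M $$ (i, j)) \<le> k j"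
  shows "coeff (det M) (\<Sum>j<n. k j) = det (mat n n (\<lambda>(i, j). coeff (M $$ (i, j)) (k j)))"
proof -
  have "coeff (of_int (sign p) * (\<Prod>j<n. M $$ (p j, j))) (\<Sum>j<n. k j) = of_int (sign p) * (\<Prod>j<n. coeff (M $$ (p j, j)) (k j))"
    if "p permutes {0..<n}" for p
  proof -
    have "coeff (\<Prod>j<n. M $$ (p j, j)) (\<Sum>j<n. k j) = (\<Prod>j<n. coeff (M $$ (p j, j)) (k j))"
      by (rule conjunct1[OF coeff_prod_top]) (use assms permutes_in_image[OF that] in auto)
    then show ?thesis by (simp add: sign_def)
  qed
  then show ?thesis
    unfolding det_col[OF M] coeff_sum
    by (subst det_col[where n = n]) (auto intro!: sum.cong prod.cong simp: permutes_in_image)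
qed

text \<open>Translation alters only lower terms. Hence the double leading coefficients agree for all
  translates of a polynomial, and in the matrix of translates the row enters only through the powers
  of \<open>y\<close>.\<close>

lemma coeff_translate_degree_coeff:
  "coeff (coeff (translate e p) (degree p)) (degree (lead_coeff p)) = lead_coeff (lead_coeff p)"
  and degree_coeff_translate_degree: "degree (coeff (translate e p) (degree p)) = degree (lead_coeff p)"
proof -
  define q where "q = map_poly (\<lambda>c. pcompose c [:snd e, 1:]) p"
  have cq: "coeff q i = pcompose (coeff p i) [:snd e, 1:]" for i by (simp add: q_def coeff_map_poly)
  have dq: "degree q = degree p"
  proof (cases "p = 0")
    case False
    then have "pcompose (lead_coeff p) [:snd e, 1:] \<noteq> 0" using pcompose_eq_0 by fastforce
    then show ?thesis unfolding q_def by (rule map_poly_degree_eq)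
  qed (simp add: q_def)
  have "lead_coeff (pcompose q [:[:fst e:], 1:]) = lead_coeff q"
    by (subst lead_coeff_comp) auto
  then have *: "coeff (translate e p) (degree p) = pcompose (lead_coeff p) [:snd e, 1:]"
    using dq cq unfolding translate_def q_def[symmetric] by simp
  then show "degree (coeff (translate e p) (degree p)) = degree (lead_coeff p)" by (simp)
  have "lead_coeff (pcompose (lead_coeff p) [:snd e, 1:]) = lead_coeff (lead_coeff p)"
    by (subst lead_coeff_comp) auto
  then show "coeff (coeff (translate e p) (degree p)) (degree (lead_coeff p)) = lead_coeff (lead_coeff p)"
    using * by simp
qed

text \<open>The matrix of translates annihilates the vector of powers of the exponential variable.\<close>

lemma eliminate_exponential:
  fixes P :: "nat \<Rightarrow> real poly poly" and e :: "nat \<Rightarrow> real \<times> real" and y :: "nat \<Rightarrow> real"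
  assumes nz: "l0 < L" "P l0 \<noteq> 0" and deg: "\<And>l. l < L \<Longrightarrow> degree (P l) \<le> d1" "\<And>l. l < L \<Longrightarrow> ideg (P l) \<le> d2"
    and y: "\<And>j. j < L \<Longrightarrow> y j > 0" "inj_on y {..<L}"
  obtains D where "D \<noteq> 0" "degree D \<le> L * d1" "ideg D \<le> L * d2"
    "\<And>a b Y. Y \<noteq> 0 \<Longrightarrow> (\<And>j. j < L \<Longrightarrow> (\<Sum>l<L. ev2 (P l) (a + fst (e j)) (b + snd (e j)) * (y j * Y) ^ l) = 0)
       \<Longrightarrow> ev2 D a b = 0"
proof -
  \<comment> \<open>Zero polynomials are dropped, as a zero column would kill the determinant;
    accordingly only the first \<open>s\<close> translates are used.\<close>
  define I where "I = {l. l < L \<and> P l \<noteq> 0}"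
  define s where "s = card I"
  have finI: "finite I" and neI: "I \<noteq> {}" using nz by (auto simp: I_def)
  have "s \<le> card {..<L}" unfolding s_def by (rule card_mono) (auto simp: I_def)
  then have sL: "s \<le> L" by simp
  define ix where "ix = (\<lambda>j. sorted_list_of_set I ! j)"
  have ix: "bij_betw ix {..<s} I"
    unfolding ix_def s_def using bij_betw_nth[of "sorted_list_of_set I" "{..<card I}" I] finI by simp
  have ixI: "ix j \<in> I" if "j < s" for j using ix that by (auto simp: bij_betw_def)
  define m where "m = (\<lambda>i j. translate (e i) (P (ix j)) * [:[:y i ^ ix j:]:])"
  define M where "M = mat s s (\<lambda>(i, j). m i j)"
  have M: "M \<in> carrier_mat s s" by (simp add: M_def)
  have nzP: "P (ix j) \<noteq> 0" "ix j < L" if "j < s" for j using ixI[OF that] by (auto simp: I_def)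
  define k1 where "k1 = (\<lambda>j. degree (P (ix j)))"
  define k2 where "k2 = (\<lambda>j. degree (lead_coeff (P (ix j))))"
  define D where "D = det M"
  have yi: "y i ^ l > 0" if "i < L" for i l using y(1)[OF that] by simp
  have m_smult: "m i j = smult [:y i ^ ix j:] (translate (e i) (P (ix j)))" for i j by (simp add: m_def)
  have degm: "degree (m i j) = k1 j" if "i < s" "j < s" for i j
    using y(1)[of i] that sL by (simp add: m_smult k1_def)
  have cm: "coeff (m i j) (k1 j) = smult (y i ^ ix j) (coeff (translate (e i) (P (ix j))) (k1 j))" for i j
    by (simp add: m_smult)
  have 1: "coeff D (\<Sum>j<s. k1 j) = det (mat s s (\<lambda>(i, j). coeff (m i j) (k1 j)))"
    unfolding D_def by (subst coeff_det_top[OF M]) (auto simp: M_def degm intro!: arg_cong[where f = det] eq_matI)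
  have 2: "coeff (coeff D (\<Sum>j<s. k1 j)) (\<Sum>j<s. k2 j) = det (mat s s (\<lambda>(i, j). lead_coeff (lead_coeff (P (ix j))) * y i ^ ix j))"
    unfolding 1 by (subst coeff_det_top[where n = s])
      (auto simp: cm[unfolded k1_def] k1_def k2_def degree_coeff_translate_degree coeff_translate_degree_coeff
        intro!: arg_cong[where f = det] eq_matI order.trans[OF degree_smult_le])
  define V where "V = mat s s (\<lambda>(i, j). lead_coeff (lead_coeff (P (ix j))) * y i ^ ix j)"
  have V: "V \<in> carrier_mat s s" by (simp add: V_def)
  \<comment> \<open>A kernel vector would be a polynomial supported on \<open>I\<close> with the
    \<open>s\<close> distinct positive zeros \<open>y i\<close>.\<close>
  have "det V \<noteq> 0"
  proof
    assume "det V = 0"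
    then obtain v where v: "v \<in> carrier_vec s" "v \<noteq> 0\<^sub>v s" "V *\<^sub>v v = 0\<^sub>v s"
      using det_0_iff_vec_prod_zero[OF V] by blast
    define c where "c = (\<lambda>l. let j = the_inv_into {..<s} ix l in lead_coeff (lead_coeff (P l)) * v $ j)"
    have cix: "c (ix j) = lead_coeff (lead_coeff (P (ix j))) * v $ j" if "j < s" for j
      using the_inv_into_f_f[OF bij_betw_imp_inj_on[OF ix]] that by (simp add: c_def)
    have "\<forall>i\<in>I. c i = 0"
    proof (rule sparse_poly_positive_roots[OF finI _ _ neI])
      have inj: "inj_on y {..<s}" using y(2) sL by (auto intro: inj_on_subset)
      then show "card I \<le> card (y ` {..<s})" by (simp add: card_image s_def)
      fix x assume "x \<in> y ` {..<s}"
      then obtain i where i: "i < s" "x = y i" by auto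
      have "(\<Sum>l\<in>I. c l * x ^ l) = (\<Sum>j<s. c (ix j) * x ^ ix j)"
        using sum.reindex_bij_betw[OF ix, of "\<lambda>l. c l * x ^ l"] by simp
      also have "\<dots> = (V *\<^sub>v v) $ i"
        using i v(1) by (auto simp: V_def cix scalar_prod_def lessThan_atLeast0 intro!: sum.cong)
      also have "\<dots> = 0" using v(3) i by simp
      finally show "0 < x \<and> (\<Sum>l\<in>I. c l * x ^ l) = 0" using y(1) i sL by auto
    qed simp
    then have "c (ix j) = 0" if "j < s" for j using ixI[OF that] by blast
    then have "v $ j = 0" if "j < s" for j using cix[OF that] that nzP[OF that] by simp
    then have "v = 0\<^sub>v s" using v(1) by (intro eq_vecI) auto
    then show False using v(2) by simp
  qed
  then have "D \<noteq> 0" using 2 unfolding V_def[symmetric] by auto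
  moreover have "degree D \<le> L * d1"
  proof -
    have "degree D \<le> d1 * s" unfolding D_def
      by (rule degree_det_le[OF _ M]) (use deg nzP in \<open>auto simp: M_def degm k1_def\<close>)
    also have "\<dots> \<le> d1 * L" using sL by simp
    finally show ?thesis by (simp add: mult.commute)
  qed
  moreover have "ideg D \<le> L * d2"
  proof -
    have h: "comm_ring_hom swap_vars" by unfold_locales (rule ev2_eqI, simp)+
    have "ideg (m i j) \<le> d2" if "i < s" "j < s" for i j
    proof -
      have "ideg [:[:y i ^ ix j:]:] \<le> 0" unfolding ideg_le_iff by (auto simp: coeff_pCons split: nat.split)
      then show ?thesis using nzP[OF that(2)] deg(2)[of "ix j"] y(1)[of i] that(1) sL
        unfolding m_def by (subst ideg_mult) auto
    qed
    then have "degree (det (map_mat swap_vars M)) \<le> d2 * s"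
      by (intro degree_det_le) (auto simp: M_def)
    also have "\<dots> \<le> d2 * L" using sL by simp
    finally show ?thesis by (simp add: D_def comm_ring_hom.hom_det[OF h] mult.commute)
  qed
  moreover have "ev2 D a b = 0"
    if "Y \<noteq> 0" and z: "\<And>j. j < L \<Longrightarrow> (\<Sum>l<L. ev2 (P l) (a + fst (e j)) (b + snd (e j)) * (y j * Y) ^ l) = 0" for a b Y
  proof -
    have h: "comm_ring_hom (\<lambda>p. ev2 p a b)" by unfold_locales auto
    define N where "N = map_mat (\<lambda>p. ev2 p a b) M"
    have N: "N \<in> carrier_mat s s" using M by (simp add: N_def)
    define v where "v = vec s (\<lambda>j. Y ^ ix j)"
    have s0: "0 < s" using finI neI by (simp add: s_def card_gt_0_iff)
    have "v $ 0 \<noteq> 0" using s0 \<open>Y \<noteq> 0\<close> by (simp add: v_def)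
    then have "v \<noteq> 0\<^sub>v s" using s0 by auto
    moreover have "N *\<^sub>v v = 0\<^sub>v s"
    proof (rule eq_vecI)
      fix i assume "i < dim_vec (0\<^sub>v s :: real vec)"
      then have i: "i < s" by simp
      have "(N *\<^sub>v v) $ i = (\<Sum>j<s. ev2 (m i j) a b * Y ^ ix j)"
        using i by (simp add: N_def M_def v_def scalar_prod_def lessThan_atLeast0)
      also have "\<dots> = (\<Sum>j<s. ev2 (P (ix j)) (a + fst (e i)) (b + snd (e i)) * (y i * Y) ^ ix j)"
        by (rule sum.cong) (simp_all add: m_smult ev2_def[of "smult _ _"] ev2_def[of "translate _ _", symmetric] power_mult_distrib)
      also have "\<dots> = (\<Sum>l\<in>I. ev2 (P l) (a + fst (e i)) (b + snd (e i)) * (y i * Y) ^ l)"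
        using sum.reindex_bij_betw[OF ix, of "\<lambda>l. ev2 (P l) (a + fst (e i)) (b + snd (e i)) * (y i * Y) ^ l"] by simp
      also have "\<dots> = (\<Sum>l<L. ev2 (P l) (a + fst (e i)) (b + snd (e i)) * (y i * Y) ^ l)"
        by (rule sum.mono_neutral_left) (auto simp: I_def)
      also have "\<dots> = 0" using z i sL by simp
      finally show "(N *\<^sub>v v) $ i = 0\<^sub>v s $ i" using i by simp
    qed (use N in simp)
    ultimately have "det N = 0" using det_0_iff_vec_prod_zero[OF N] vec_carrier[of s "\<lambda>j. Y ^ ix j"] unfolding v_def by blast
    then show ?thesis by (simp add: N_def D_def comm_ring_hom.hom_det[OF h])
  qed
  ultimately show ?thesis by (rule that)
qed

section \<open>Vanishing integer combinations\<close>

definition golden :: real where "golden = (1 + sqrt 5) / 2"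
definition golden' :: real where "golden' = (1 - sqrt 5) / 2"

lemma golden_square: "golden * golden = golden + 1" "golden' * golden' = golden' + 1"
  and golden_mult: "golden * golden' = - 1"
  and golden_add: "golden + golden' = 1"
  by (simp_all add: golden_def golden'_def field_simps)

lemma sqrt5_bounds: "2.236 < sqrt 5" "sqrt 5 < 2.2361"
  by (rule real_less_rsqrt, simp add: power2_eq_square, rule real_less_lsqrt, simp_all add: power2_eq_square)

lemma golden_bounds: "1.618 < golden" "golden < 1.61805" "golden' < 0" "-1 < golden'"
  using sqrt5_bounds by (simp_all add: golden_def golden'_def)

text \<open>An integer of the field generated by \<open>sqrt 5\<close> is carried along with its conjugate,
  so that the norm, and hence Liouville's inequality, is available for reals.\<close>
definition conj_int :: "real \<Rightarrow> real \<Rightarrow> bool" where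
  "conj_int x y \<longleftrightarrow> (\<exists>a b :: int. x = of_int a + of_int b * golden \<and> y = of_int a + of_int b * golden')"

lemma conj_int_of_int: "conj_int (of_int n) (of_int n)"
  unfolding conj_int_def by (intro exI[of _ n] exI[of _ 0]) simp

lemma conj_int_add: "conj_int x y \<Longrightarrow> conj_int u v \<Longrightarrow> conj_int (x + u) (y + v)"
  unfolding conj_int_def
proof (elim exE conjE)
  fix a b c d :: int
  assume "x = of_int a + of_int b * golden" "y = of_int a + of_int b * golden'"
    "u = of_int c + of_int d * golden" "v = of_int c + of_int d * golden'"
  then have "x + u = of_int (a + c) + of_int (b + d) * golden" "y + v = of_int (a + c) + of_int (b + d) * golden'"
    by (simp_all add: algebra_simps)
  then show "\<exists>a b. x + u = real_of_int a + real_of_int b * golden \<and> y + v = real_of_int a + real_of_int b * golden'" by blast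
qed

lemma conj_int_mult: "conj_int x y \<Longrightarrow> conj_int u v \<Longrightarrow> conj_int (x * u) (y * v)"
  unfolding conj_int_def
proof (elim exE conjE)
  fix a b c d :: int
  assume *: "x = of_int a + of_int b * golden" "y = of_int a + of_int b * golden'"
    "u = of_int c + of_int d * golden" "v = of_int c + of_int d * golden'"
  have "x * u = of_int a * of_int c + (of_int a * of_int d + of_int b * of_int c) * golden + of_int b * of_int d * (golden * golden)"
    "y * v = of_int a * of_int c + (of_int a * of_int d + of_int b * of_int c) * golden' + of_int b * of_int d * (golden' * golden')"
    unfolding * by (simp_all add: algebra_simps)
  then have "x * u = of_int (a * c + b * d) + of_int (a * d + b * c + b * d) * golden"
    "y * v = of_int (a * c + b * d) + of_int (a * d + b * c + b * d) * golden'"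
    unfolding golden_square by (simp_all add: algebra_simps)
  then show "\<exists>a b. x * u = real_of_int a + real_of_int b * golden \<and> y * v = real_of_int a + real_of_int b * golden'" by blast
qed

lemma conj_int_power: "conj_int x y \<Longrightarrow> conj_int (x ^ n) (y ^ n)"
  using conj_int_of_int[of 1] by (induction n) (auto intro: conj_int_mult)

lemma conj_int_sum: "(\<And>a. a \<in> A \<Longrightarrow> conj_int (f a) (h a)) \<Longrightarrow> conj_int (sum f A) (sum h A)"
  using conj_int_of_int[of 0] by (induction A rule: infinite_finite_induct) (auto intro: conj_int_add)

lemma conj_int_sqrt5: "conj_int (sqrt 5) (- sqrt 5)"
  unfolding conj_int_def by (intro exI[of _ "-1"] exI[of _ 2]) (simp add: golden_def golden'_def field_simps)

lemma conj_int_golden_powi: "conj_int (golden powi n) (golden' powi n)"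
proof -
  have g: "conj_int golden golden'" unfolding conj_int_def by (intro exI[of _ 0] exI[of _ 1]) simp
  have "inverse golden = -golden'" "inverse golden' = -golden"
    using golden_mult golden_bounds by (auto simp: field_simps)
  moreover have "conj_int (-golden') (-golden)"
    unfolding conj_int_def using golden_add by (intro exI[of _ "-1"] exI[of _ 1]) auto
  ultimately have "conj_int (inverse golden) (inverse golden')" by simp
  then show ?thesis using g by (cases "n \<ge> 0") (auto simp: power_int_def intro: conj_int_power)
qed

text \<open>The irrationality of \<open>sqrt 5\<close> in disguise: in
  \<open>(2 * a + b) ^ 2 = 5 * b ^ 2\<close> the exponent of 5 would be both even and odd.\<close>

lemma norm_form_eq_0: "a ^ 2 + a * b - b ^ 2 = 0 \<Longrightarrow> b = 0" for a b :: int
proof (rule ccontr)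
  assume eq: "a ^ 2 + a * b - b ^ 2 = 0" and b: "b \<noteq> 0"
  have *: "(2 * a + b) ^ 2 = 5 * b ^ 2" using eq by (simp add: power2_eq_square algebra_simps)
  have "prime (5 :: int)" by simp
  then have p: "prime_elem (5 :: int)" by (rule prime_imp_prime_elem)
  have "2 * a + b \<noteq> 0" using * b by auto
  then have "2 * multiplicity 5 (2 * a + b) = multiplicity 5 (5 * b ^ 2)"
    using p by (simp add: prime_elem_multiplicity_power_distrib flip: *)
  also have "\<dots> = 1 + 2 * multiplicity 5 b"
    using p b by (simp add: prime_elem_multiplicity_mult_distrib prime_elem_multiplicity_power_distrib)
  finally show False by presburger
qed

text \<open>The product with the conjugate is the integer \<open>a ^ 2 + a * b - b ^ 2\<close>,
  which vanishes only for \<open>x = 0\<close>.\<close>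

lemma conj_int_norm_ge_1:
  assumes "conj_int x y" "x \<noteq> 0"
  shows "\<bar>x\<bar> * \<bar>y\<bar> \<ge> 1"
proof -
  obtain a b :: int where ab: "x = of_int a + of_int b * golden" "y = of_int a + of_int b * golden'"
    using assms by (auto simp: conj_int_def)
  have "x * y = of_int a ^ 2 + of_int a * of_int b * (golden + golden') + of_int b ^ 2 * (golden * golden')"
    unfolding ab by (simp add: algebra_simps power2_eq_square)
  then have xy: "x * y = of_int (a ^ 2 + a * b - b ^ 2)"
    by (simp add: golden_mult golden_add)
  have "a ^ 2 + a * b - b ^ 2 \<noteq> 0"
  proof
    assume *: "a ^ 2 + a * b - b ^ 2 = 0"
    then have "b = 0" by (rule norm_form_eq_0)
    then show False using * assms(2) by (simp add: ab)
  qed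
  then have "1 \<le> \<bar>a ^ 2 + a * b - b ^ 2\<bar>" by linarith
  then have "1 \<le> \<bar>real_of_int (a ^ 2 + a * b - b ^ 2)\<bar>" by linarith
  then show ?thesis using xy by (simp flip: abs_mult)
qed

lemma fib_binet: "sqrt 5 * real (fib n) = golden ^ n - golden' ^ n"
proof (induction n rule: fib.induct)
  case 2 then show ?case by (simp add: golden_def golden'_def field_simps)
next
  case (3 n)
  have "golden ^ Suc (Suc n) = golden ^ n * (golden * golden)" "golden' ^ Suc (Suc n) = golden' ^ n * (golden' * golden')"
    by simp_all
  then show ?case using 3 unfolding golden_square by (simp add: algebra_simps)
qed simp

text \<open>Dirichlet's box principle: \<open>(H + 1) ^ card A\<close> vectors fall into at most
  \<open>(Q + 1) ^ card B\<close> cells of side \<open>\<epsilon>\<close>. With four unknowns per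
  form, \<open>(H + 1) ^ 4 > Q + 1\<close> is enough, so a moderate \<open>H\<close> already yields
  very small values.\<close>

lemma small_linear_forms:
  fixes c :: "'b \<Rightarrow> 'a \<Rightarrow> real" and G \<epsilon> :: real
  assumes fin: "finite A" "finite B" "B \<noteq> {}" and card: "card A \<ge> 4 * card B"
    and G: "\<And>a b. a \<in> A \<Longrightarrow> b \<in> B \<Longrightarrow> \<bar>c b a\<bar> \<le> G" and \<epsilon>: "\<epsilon> > 0"
    and H: "real (H + 1) ^ 4 > 2 * card A * G * H / \<epsilon> + 1"
  obtains p :: "'a \<Rightarrow> int" where "\<exists>a\<in>A. p a \<noteq> 0" "\<And>a. a \<in> A \<Longrightarrow> \<bar>p a\<bar> \<le> int H"
    "\<And>b. b \<in> B \<Longrightarrow> \<bar>\<Sum>a\<in>A. c b a * of_int (p a)\<bar> \<le> \<epsilon>"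
proof -
  define Q where "Q = nat \<lfloor>2 * card A * G * H / \<epsilon>\<rfloor>"
  have "card B > 0" using fin by (simp add: card_gt_0_iff)
  then have "A \<noteq> {}" using card by auto
  then obtain a0 b0 where "a0 \<in> A" "b0 \<in> B" using fin(3) by blast
  then have G0: "G \<ge> 0" using G[of a0 b0] by linarith
  define val where "val = (\<lambda>(f :: 'a \<Rightarrow> nat) b. \<Sum>a\<in>A. c b a * real (f a))"
  define cell where "cell = (\<lambda>f. \<lambda>b\<in>B. nat \<lfloor>(val f b + card A * G * H) / \<epsilon>\<rfloor>)"
  define X where "X = A \<rightarrow>\<^sub>E {..H}"
  have val: "\<bar>val f b\<bar> \<le> card A * G * H" if "f \<in> X" "b \<in> B" for f b
  proof -
    have "\<bar>val f b\<bar> \<le> (\<Sum>a\<in>A. \<bar>c b a * real (f a)\<bar>)" unfolding val_def by (rule sum_abs)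
    also have "\<dots> \<le> (\<Sum>a\<in>A. G * H)"
      by (rule sum_mono) (use that G G0 in \<open>auto simp: X_def abs_mult PiE_iff intro!: mult_mono\<close>)
    finally show ?thesis by (simp add: mult.assoc)
  qed
  have "cell ` X \<subseteq> B \<rightarrow>\<^sub>E {..Q}"
  proof (intro image_subsetI PiE_I)
    fix f b assume f: "f \<in> X" and b: "b \<in> B"
    have "(val f b + card A * G * H) / \<epsilon> \<le> 2 * card A * G * H / \<epsilon>"
      using val[OF f b] \<epsilon> by (intro divide_right_mono) (auto simp: algebra_simps)
    then show "cell f b \<in> {..Q}" using b by (auto simp: cell_def Q_def intro!: nat_mono floor_mono)
  qed (auto simp: cell_def)
  then have "card (cell ` X) \<le> card (B \<rightarrow>\<^sub>E {..Q})" using fin by (intro card_mono finite_PiE) auto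
  also have "\<dots> = (Q + 1) ^ card B" using fin by (simp add: card_PiE)
  also have "\<dots> < ((H + 1) ^ 4) ^ card B"
  proof (rule power_strict_mono)
    have "real Q \<le> 2 * card A * G * H / \<epsilon>" unfolding Q_def using G0 \<epsilon> by (simp add: of_nat_floor)
    then have "real (Q + 1) < real ((H + 1) ^ 4)" using H by simp
    then show "Q + 1 < (H + 1) ^ 4" by linarith
    show "0 < card B" using fin by (simp add: card_gt_0_iff)
  qed simp
  also have "\<dots> = (H + 1) ^ (4 * card B)" by (simp add: power_mult)
  also have "\<dots> \<le> (H + 1) ^ card A" using card by (intro power_increasing) auto
  also have "\<dots> = card X" using fin by (simp add: X_def card_PiE)
  finally have "\<not> inj_on cell X" by (rule pigeonhole)
  then obtain f h where fh: "f \<in> X" "h \<in> X" "f \<noteq> h" "cell f = cell h" by (auto simp: inj_on_def)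
  define p where "p = (\<lambda>a. int (f a) - int (h a))"
  show ?thesis
  proof
    show "\<exists>a\<in>A. p a \<noteq> 0"
    proof (rule ccontr)
      assume "\<not> ?thesis"
      then have "f a = h a" if "a \<in> A" for a using that by (auto simp: p_def)
      then show False using fh by (metis PiE_ext X_def)
    qed
    show "\<bar>p a\<bar> \<le> int H" if "a \<in> A" for a
    proof -
      have "f a \<le> H" "h a \<le> H" using fh(1,2) that by (auto simp: X_def PiE_iff)
      then show ?thesis by (auto simp: p_def)
    qed
    show "\<bar>\<Sum>a\<in>A. c b a * of_int (p a)\<bar> \<le> \<epsilon>" if b: "b \<in> B" for b
    proof -
      have eq: "(\<Sum>a\<in>A. c b a * of_int (p a)) = val f b - val h b"
        by (simp add: val_def p_def right_diff_distrib sum_subtractf)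
      let ?s = "\<lambda>f. (val f b + card A * G * H) / \<epsilon>"
      have nn: "?s f \<ge> 0" "?s h \<ge> 0" using val[OF fh(1) b] val[OF fh(2) b] \<epsilon> by auto
      have "nat \<lfloor>?s f\<rfloor> = nat \<lfloor>?s h\<rfloor>" using fun_cong[OF fh(4), of b] b by (simp add: cell_def)
      then have "\<lfloor>?s f\<rfloor> = \<lfloor>?s h\<rfloor>" using nn by (simp add: eq_nat_nat_iff)
      then have "\<bar>?s f - ?s h\<bar> \<le> 1" by linarith
      moreover have "?s f - ?s h = (val f b - val h b) / \<epsilon>" by (simp add: diff_divide_distrib add_divide_distrib)
      ultimately have "\<bar>val f b - val h b\<bar> / \<epsilon> \<le> 1" using \<epsilon> by (simp add: abs_divide)
      then show ?thesis using \<epsilon> by (simp add: eq)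
    qed
  qed
qed

text \<open>Numerator and denominator of \<open>eta\<close> are bounded separately because
  \<open>eta\<close> occurs with exponents of either sign, so that both can appear among the
  denominators cleared in Liouville's inequality. As a rational multiple of \<open>sqrt 5\<close>,
  \<open>eta\<close> has the conjugate \<open>- eta\<close>.\<close>

locale linear_form =
  fixes g N k n1 n2 :: nat and h :: real
  assumes g: "g \<ge> 2" and n1: "n1 \<ge> 1" and n2: "n2 \<ge> 1"
    and h1: "ln (sqrt 5 * n1) \<le> h" and h2: "ln n2 \<le> h"
begin

definition "eta = sqrt 5 * n1 / n2"
definition "lam = ln (real g)"
definition "gam = ln golden"

definition xx :: "int \<times> int \<times> int \<Rightarrow> real" where
  "xx = (\<lambda>(u, v, w). u * gam + v * lam + w * ln eta)"
definition yy :: "int \<times> int \<times> int \<Rightarrow> real" where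
  "yy = (\<lambda>(u, v, w). golden powi u * real g powi v * eta powi w)"

lemma eta_pos: "eta > 0" using n1 n2 by (simp add: eta_def)

lemma powi_eq_exp: "x > 0 \<Longrightarrow> x powi n = exp (of_int n * ln x)" for x :: real
  using exp_power_int[of "ln x" n] by simp

lemma pow_eq_exp: "x > 0 \<Longrightarrow> x ^ n = exp (real n * ln x)" for x :: real
  by (simp add: exp_of_nat_mult)

lemma exp_xx: "exp (xx \<sigma>) = yy \<sigma>"
proof -
  have "golden > 0" "real g > 0" using golden_bounds g by auto
  then show ?thesis
    using eta_pos by (cases \<sigma>) (simp add: xx_def yy_def powi_eq_exp gam_def lam_def exp_add)
qed

lemma lam_pos: "lam > 0" using g by (simp add: lam_def)

text \<open>After multiplication by \<open>Q ^ E\<close> the sum is an algebraic integer, so a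
  trivial estimate of its conjugate bounds it from below. Centring the exponents by
  \<open>E / 2\<close> halves the exponents seen by the Taylor expansion and charges
  \<open>xx\<close> with only half its weight.\<close>

lemma exponential_sum_lower_bound:
  fixes p :: "'a \<Rightarrow> int" and \<phi> :: "'a \<Rightarrow> int" and e :: "'a \<Rightarrow> nat" and H \<Phi> :: real and u v w :: int
  assumes A: "finite A" and p: "\<And>a. a \<in> A \<Longrightarrow> \<bar>of_int (p a)\<bar> \<le> H" and \<phi>: "\<And>a. a \<in> A \<Longrightarrow> \<bar>of_int (\<phi> a)\<bar> \<le> \<Phi>"
    and e: "\<And>a. a \<in> A \<Longrightarrow> e a \<le> E" and \<sigma>: "\<sigma> = (u, v, w)"
    and nz: "(\<Sum>a\<in>A. p a * \<phi> a * yy \<sigma> ^ e a) \<noteq> 0"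
  shows "1 \<le> \<bar>\<Sum>a\<in>A. p a * \<phi> a * exp ((e a - E / 2) * xx \<sigma>)\<bar> *
    (card A * H * \<Phi> * exp (2 * real E * (\<bar>v\<bar> * lam + \<bar>w\<bar> * h) + E * \<bar>xx \<sigma>\<bar> / 2))"
proof -
  define mu where "mu = sqrt 5 * n1"
  have mu: "mu > 0" and mu1: "mu \<ge> 1"
    using n1 sqrt5_bounds mult_mono[of 1 "sqrt 5" 1 "real n1"] by (auto simp: mu_def)
  have lnmu: "0 \<le> ln mu" "ln mu \<le> h" "0 \<le> ln (real n2)" "ln (real n2) \<le> h"
    using mu1 n2 h1 h2 by (auto simp: mu_def)
  have gg: "golden > 0" using golden_bounds by simp
  \<comment> \<open>\<open>Q\<close> clears the negative powers of \<open>g\<close> and the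
    denominator of \<open>eta powi w\<close>; \<open>golden\<close> is a unit and needs none. Primed
    quantities are the conjugates, with \<open>- mu\<close> in place of \<open>mu\<close>.\<close>
  define Q where "Q = real g ^ nat (- v) * real n2 ^ nat w * mu ^ nat (- w)"
  define Q' where "Q' = real g ^ nat (- v) * real n2 ^ nat w * (- mu) ^ nat (- w)"
  define R where "R = golden powi u * (real g ^ nat v * mu ^ nat w * real n2 ^ nat (- w))"
  define R' where "R' = golden' powi u * (real g ^ nat v * (- mu) ^ nat w * real n2 ^ nat (- w))"
  have cn: "conj_int (real n) (real n)" for n using conj_int_of_int[of "int n"] by simp
  have cmu: "conj_int mu (- mu)" using conj_int_mult[OF conj_int_sqrt5 cn[of n1]] by (simp add: mu_def)
  have cQ: "conj_int Q Q'" unfolding Q_def Q'_def by (intro conj_int_mult conj_int_power cn cmu)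
  have cR: "conj_int R R'" unfolding R_def R'_def
    by (intro conj_int_mult conj_int_power cn cmu conj_int_golden_powi)
  define q0 where "q0 = nat (- v) * lam + nat w * ln (real n2) + nat (- w) * ln mu"
  define r0 where "r0 = nat v * lam + nat w * ln mu + nat (- w) * ln (real n2)"
  have pos: "real g > 0" "real n2 > 0" using g n2 by auto
  have Q: "Q = exp q0" using pos mu by (simp add: Q_def q0_def pow_eq_exp exp_add lam_def)
  have Rexp: "R = exp (u * gam + r0)"
    using pos mu gg by (simp add: R_def r0_def pow_eq_exp exp_add lam_def powi_eq_exp gam_def)
  have Q'abs: "\<bar>Q'\<bar> = exp q0" using Q pos mu by (simp add: Q_def Q'_def abs_mult power_abs)
  have "\<bar>golden'\<bar> = inverse golden" using golden_mult golden_bounds gg by (simp add: field_simps abs_if)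
  then have "\<bar>golden' powi u\<bar> = exp (- (u * gam))"
    using gg by (simp add: power_int_abs powi_eq_exp ln_inverse gam_def)
  then have R'abs: "\<bar>R'\<bar> = exp (r0 - u * gam)"
    using pos mu by (simp add: R'_def r0_def abs_mult power_abs pow_eq_exp exp_add exp_diff exp_minus lam_def field_simps)
  have lneta: "ln eta = ln mu - ln (real n2)" using mu pos n1 by (simp add: eta_def mu_def ln_div)
  have vw: "of_int v = real (nat v) - real (nat (- v))" "of_int w = real (nat w) - real (nat (- w))" by auto
  have xq: "xx \<sigma> + q0 = u * gam + r0"
    unfolding \<sigma> xx_def q0_def r0_def split lneta vw by (simp add: algebra_simps)
  have yQ: "yy \<sigma> * Q = R" unfolding Rexp Q exp_xx[symmetric] exp_add[symmetric] xq ..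
  define S where "S = (\<Sum>a\<in>A. p a * \<phi> a * yy \<sigma> ^ e a)"
  define T where "T = (\<Sum>a\<in>A. of_int (p a * \<phi> a) * (R' ^ e a * Q' ^ (E - e a)))"
  define Sc where "Sc = (\<Sum>a\<in>A. p a * \<phi> a * exp ((e a - E / 2) * xx \<sigma>))"
  have SQ: "S * Q ^ E = (\<Sum>a\<in>A. of_int (p a * \<phi> a) * (R ^ e a * Q ^ (E - e a)))"
    unfolding S_def sum_distrib_right
  proof (rule sum.cong)
    fix a assume "a \<in> A"
    then have "Q ^ E = Q ^ e a * Q ^ (E - e a)" using e by (simp flip: power_add)
    then show "p a * \<phi> a * yy \<sigma> ^ e a * Q ^ E = of_int (p a * \<phi> a) * (R ^ e a * Q ^ (E - e a))"
      by (simp add: power_mult_distrib flip: yQ)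
  qed simp
  have "conj_int (S * Q ^ E) T" unfolding SQ T_def
    by (intro conj_int_sum conj_int_mult conj_int_of_int conj_int_power cQ cR)
  moreover have "S * Q ^ E \<noteq> 0" using nz Q by (simp add: S_def)
  ultimately have 1: "1 \<le> \<bar>S * Q ^ E\<bar> * \<bar>T\<bar>" by (rule conj_int_norm_ge_1)
  have T: "\<bar>T\<bar> \<le> card A * H * \<Phi> * exp (E * max (r0 - u * gam) q0)"
  proof -
    have "\<bar>T\<bar> \<le> (\<Sum>a\<in>A. \<bar>of_int (p a * \<phi> a) * (R' ^ e a * Q' ^ (E - e a))\<bar>)"
      unfolding T_def by (rule sum_abs)
    also have "\<dots> \<le> (\<Sum>a\<in>A. H * \<Phi> * exp (E * max (r0 - u * gam) q0))"
    proof (rule sum_mono)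
      fix a assume a: "a \<in> A"
      let ?m = "max (r0 - u * gam) q0"
      have "\<bar>R' ^ e a * Q' ^ (E - e a)\<bar> = exp (e a * (r0 - u * gam) + (E - e a) * q0)"
        using e[OF a] by (simp add: abs_mult power_abs R'abs Q'abs exp_add exp_of_nat_mult flip: of_nat_diff)
      also have "e a * (r0 - u * gam) + (E - e a) * q0 \<le> e a * ?m + (E - e a) * ?m"
        using e[OF a] by (intro add_mono mult_left_mono) auto
      also have "\<dots> = E * ?m" using e[OF a] by (simp add: algebra_simps)
      finally have *: "\<bar>R' ^ e a * Q' ^ (E - e a)\<bar> \<le> exp (E * ?m)" by simp
      have "\<bar>of_int (p a)\<bar> * \<bar>of_int (\<phi> a)\<bar> * \<bar>R' ^ e a * Q' ^ (E - e a)\<bar> \<le> H * \<Phi> * exp (E * ?m)"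
        by (intro mult_mono p \<phi> a *) (use p[OF a] \<phi>[OF a] in auto)
      then show "\<bar>of_int (p a * \<phi> a) * (R' ^ e a * Q' ^ (E - e a))\<bar> \<le> H * \<Phi> * exp (E * ?m)"
        by (simp add: abs_mult)
    qed
    finally show ?thesis by simp
  qed
  have "S = exp (E * xx \<sigma> / 2) * Sc" unfolding S_def Sc_def sum_distrib_left
    by (rule sum.cong) (simp_all add: exp_xx[symmetric] left_diff_distrib exp_diff flip: exp_of_nat_mult)
  then have SQabs: "\<bar>S * Q ^ E\<bar> = \<bar>Sc\<bar> * exp (E * xx \<sigma> / 2 + E * q0)"
    by (simp add: Q abs_mult exp_add exp_of_nat_mult)
  have vabs: "nat v * lam \<le> \<bar>v\<bar> * lam" "nat (- v) * lam \<le> \<bar>v\<bar> * lam" using lam_pos by (auto intro!: mult_right_mono)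
  have wabs: "nat w * ln mu + nat (- w) * ln (real n2) \<le> \<bar>w\<bar> * h" "nat w * ln (real n2) + nat (- w) * ln mu \<le> \<bar>w\<bar> * h"
    using lnmu by (cases "w \<ge> 0"; auto intro!: mult_mono)+
  have r0le: "r0 \<le> \<bar>v\<bar> * lam + \<bar>w\<bar> * h" and q0le: "q0 \<le> \<bar>v\<bar> * lam + \<bar>w\<bar> * h"
    using vabs wabs by (auto simp: r0_def q0_def)
  \<comment> \<open>If the maximum is \<open>r0 - u * gam\<close>, the relation \<open>xq\<close>
    turns the left side into \<open>2 * r0 - xx \<sigma> / 2\<close>; otherwise it is
    \<open>2 * q0 + xx \<sigma> / 2\<close>.\<close>
  have "xx \<sigma> / 2 + q0 + max (r0 - u * gam) q0 \<le> 2 * (\<bar>v\<bar> * lam + \<bar>w\<bar> * h) + \<bar>xx \<sigma>\<bar> / 2"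
  proof -
    have "x / 2 + q + max (r - t) q \<le> 2 * VW + \<bar>x\<bar> / 2"
      if "r \<le> VW" "q \<le> VW" "x + q = t + r" for x q r t VW :: real
      using that by (auto simp: max_def)
    then show ?thesis using r0le q0le xq by blast
  qed
  then have "E * (xx \<sigma> / 2 + q0 + max (r0 - u * gam) q0) \<le> E * (2 * (\<bar>v\<bar> * lam + \<bar>w\<bar> * h) + \<bar>xx \<sigma>\<bar> / 2)"
    by (intro mult_left_mono) auto
  then have expo: "E * xx \<sigma> / 2 + E * q0 + E * max (r0 - u * gam) q0 \<le> 2 * real E * (\<bar>v\<bar> * lam + \<bar>w\<bar> * h) + E * \<bar>xx \<sigma>\<bar> / 2"
    by (simp add: algebra_simps)
  have "A \<noteq> {}" using nz by auto
  then obtain a0 where a0: "a0 \<in> A" by blast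
  have HP: "H \<ge> 0" "\<Phi> \<ge> 0" using p[OF a0] \<phi>[OF a0] by auto
  have "1 \<le> (\<bar>Sc\<bar> * exp (E * xx \<sigma> / 2 + E * q0)) * (card A * H * \<Phi> * exp (E * max (r0 - u * gam) q0))"
    using 1 T unfolding SQabs by (meson mult_left_mono order_trans abs_ge_zero exp_ge_zero mult_nonneg_nonneg)
  also have "\<dots> = \<bar>Sc\<bar> * (card A * H * \<Phi> * exp (E * xx \<sigma> / 2 + E * q0 + E * max (r0 - u * gam) q0))"
    by (simp add: exp_add)
  also have "\<dots> \<le> \<bar>Sc\<bar> * (card A * H * \<Phi> * exp (2 * real E * (\<bar>v\<bar> * lam + \<bar>w\<bar> * h) + E * \<bar>xx \<sigma>\<bar> / 2))"
    using expo HP by (intro mult_left_mono) auto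
  finally show ?thesis unfolding Sc_def .
qed

text \<open>In the approximating sums the dependence on the point sits in the bounded factors
  \<open>s\<close>. Making the \<open>card B\<close> forms with coefficients \<open>c\<close> small
  therefore makes the combination small at all points of \<open>\<Sigma>\<close> at once, however
  many there are, and Liouville's inequality turns small into zero.\<close>

lemma vanishing_combination:
  fixes \<phi> :: "'a \<Rightarrow> int \<times> int \<times> int \<Rightarrow> int" and e :: "'a \<Rightarrow> nat" and \<Phi> G \<rho> \<kappa> Y :: real
    and c :: "'b \<Rightarrow> 'a \<Rightarrow> real" and s :: "'b \<Rightarrow> int \<times> int \<times> int \<Rightarrow> real"
  assumes fin: "finite A" "finite B" "B \<noteq> {}" and card: "card A \<ge> 4 * card B"
    and c: "\<And>a b. a \<in> A \<Longrightarrow> b \<in> B \<Longrightarrow> \<bar>c b a\<bar> \<le> G"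
    and s: "\<And>\<sigma> b. \<sigma> \<in> \<Sigma> \<Longrightarrow> b \<in> B \<Longrightarrow> \<bar>s b \<sigma>\<bar> \<le> 1"
    and \<phi>: "\<And>\<sigma> a. \<sigma> \<in> \<Sigma> \<Longrightarrow> a \<in> A \<Longrightarrow> \<bar>of_int (\<phi> a \<sigma>)\<bar> \<le> \<Phi>"
    and e: "\<And>a. a \<in> A \<Longrightarrow> e a \<le> E"
    and approx: "\<And>\<sigma> a. \<sigma> \<in> \<Sigma> \<Longrightarrow> a \<in> A \<Longrightarrow>
      \<bar>\<phi> a \<sigma> * exp ((e a - E / 2) * xx \<sigma>) - (\<Sum>b\<in>B. c b a * s b \<sigma>)\<bar> \<le> \<rho>"
    and cost: "\<And>u v w. (u, v, w) \<in> \<Sigma> \<Longrightarrow> 2 * real E * (\<bar>v\<bar> * lam + \<bar>w\<bar> * h) + E * \<bar>xx (u, v, w)\<bar> / 2 \<le> \<kappa>"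
    and G: "G \<ge> 1" and \<Phi>: "\<Phi> \<ge> 1" and \<kappa>: "\<kappa> \<ge> 0" and Y: "Y = card A * \<Phi> * exp \<kappa>"
    and cond: "64 * real (card B) * (real (card A))\<^sup>2 * G * Y\<^sup>2 * \<rho> \<le> 1"
  obtains p :: "'a \<Rightarrow> int" where "\<exists>a\<in>A. p a \<noteq> 0"
    "\<And>\<sigma>. \<sigma> \<in> \<Sigma> \<Longrightarrow> (\<Sum>a\<in>A. p a * \<phi> a \<sigma> * yy \<sigma> ^ e a) = 0"
proof -
  define m M where "m = card B" and "M = card A"
  have m: "m \<ge> 1" using fin by (simp add: m_def Suc_leI card_gt_0_iff)
  have M: "M \<ge> 1" using card m by (simp add: m_def M_def)
  have Y1: "Y \<ge> 1"
  proof -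
    have "1 * 1 * 1 \<le> real M * \<Phi> * exp \<kappa>" using M \<Phi> \<kappa> by (intro mult_mono) auto
    then show ?thesis by (simp add: Y M_def)
  qed
  \<comment> \<open>With the \<open>\<epsilon>\<close> below, the pigeonhole condition reads
    \<open>(H + 1) ^ 4 > X * H ^ 2 + 1\<close>, which holds as soon as \<open>H ^ 2\<close> reaches
    \<open>X\<close>.\<close>
  define X where "X = 8 * m * M * G * Y"
  have X1: "X \<ge> 1"
  proof -
    have "1 * 1 * 1 * 1 * 1 \<le> 8 * real m * real M * G * Y" using M m G Y1 by (intro mult_mono) auto
    then show ?thesis by (simp add: X_def)
  qed
  define H where "H = nat \<lceil>sqrt X\<rceil>"
  have Hge: "sqrt X \<le> H" unfolding H_def by (rule real_nat_ceiling_ge)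
  have Hle: "H \<le> 2 * sqrt X"
  proof -
    have "1 \<le> sqrt X" using X1 by simp
    moreover have "H \<le> sqrt X + 1" unfolding H_def using X1 by (simp add: of_nat_ceiling)
    ultimately show ?thesis by linarith
  qed
  have H1: "real H \<ge> 1" using Hge X1 by (smt (verit) real_sqrt_ge_1_iff)
  have H2: "X \<le> real H ^ 2" "real H ^ 2 \<le> 4 * X"
  proof -
    have "sqrt X ^ 2 \<le> real H ^ 2" using Hge X1 by (intro power_mono) auto
    then show "X \<le> real H ^ 2" using X1 by simp
    have "real H ^ 2 \<le> (2 * sqrt X) ^ 2" using Hle by (intro power_mono) auto
    then show "real H ^ 2 \<le> 4 * X" using X1 by (simp add: power_mult_distrib)
  qed
  \<comment> \<open>Chosen so that the forms contribute
    \<open>m * \<epsilon> * H * Y = 1 / 4\<close>; \<open>cond\<close> leaves at most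
    \<open>1 / 2\<close> for the approximation error, and the total \<open>3 / 4\<close> contradicts
    the lower bound 1.\<close>
  define \<epsilon> where "\<epsilon> = 1 / (4 * m * H * Y)"
  have \<epsilon>: "\<epsilon> > 0" using m H1 Y1 by (simp add: \<epsilon>_def)
  have "2 * M * G * H / \<epsilon> + 1 = X * real H ^ 2 + 1"
    using m H1 Y1 by (simp add: \<epsilon>_def X_def power2_eq_square)
  also have "\<dots> \<le> real H ^ 2 * real H ^ 2 + 1" using H2 by (intro add_mono mult_right_mono) auto
  also have "\<dots> < real (H + 1) ^ 4"
  proof -
    have "real (H + 1) ^ 4 = real H ^ 2 * real H ^ 2 + 1 + (4 * real H ^ 3 + 6 * real H ^ 2 + 4 * real H)"
      by (simp add: eval_nat_numeral algebra_simps)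
    moreover have "4 * real H ^ 3 + 6 * real H ^ 2 + 4 * real H > 0" using H1 by (intro add_nonneg_pos) auto
    ultimately show ?thesis by linarith
  qed
  finally have Hcond: "real (H + 1) ^ 4 > 2 * card A * G * H / \<epsilon> + 1" by (simp add: M_def)
  obtain p :: "'a \<Rightarrow> int" where p: "\<exists>a\<in>A. p a \<noteq> 0" "\<And>a. a \<in> A \<Longrightarrow> \<bar>p a\<bar> \<le> int H"
    "\<And>b. b \<in> B \<Longrightarrow> \<bar>\<Sum>a\<in>A. c b a * of_int (p a)\<bar> \<le> \<epsilon>"
    using small_linear_forms[where c = c and G = G, OF fin card c \<epsilon> Hcond] by blast
  have pH: "\<bar>real_of_int (p a)\<bar> \<le> H" if "a \<in> A" for a using p(2)[OF that] by linarith
  show ?thesis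
  proof (rule that[OF p(1)], rule ccontr)
    fix \<sigma> assume \<sigma>: "\<sigma> \<in> \<Sigma>" and nz: "(\<Sum>a\<in>A. p a * \<phi> a \<sigma> * yy \<sigma> ^ e a) \<noteq> 0"
    obtain u v w where uvw: "\<sigma> = (u, v, w)" by (cases \<sigma>)
    define Sc where "Sc = (\<Sum>a\<in>A. p a * \<phi> a \<sigma> * exp ((e a - E / 2) * xx \<sigma>))"
    have "1 \<le> \<bar>Sc\<bar> * (real (card A) * real H * \<Phi> * exp (2 * real E * (\<bar>v\<bar> * lam + \<bar>w\<bar> * h) + E * \<bar>xx \<sigma>\<bar> / 2))"
      unfolding Sc_def by (rule exponential_sum_lower_bound[where \<phi> = "\<lambda>a. \<phi> a \<sigma>", OF fin(1) pH \<phi>[OF \<sigma>] e uvw nz])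
    also have "\<dots> \<le> \<bar>Sc\<bar> * (real (card A) * real H * \<Phi> * exp \<kappa>)"
      using cost[of u v w] \<sigma> uvw \<Phi> by (intro mult_left_mono) auto
    also have "\<dots> = \<bar>Sc\<bar> * (H * Y)" by (simp add: Y)
    finally have lower: "1 \<le> \<bar>Sc\<bar> * (H * Y)" .
    have "Sc = (\<Sum>a\<in>A. p a * (\<phi> a \<sigma> * exp ((e a - E / 2) * xx \<sigma>) - (\<Sum>b\<in>B. c b a * s b \<sigma>)))
        + (\<Sum>a\<in>A. \<Sum>b\<in>B. p a * (c b a * s b \<sigma>))"
      by (simp add: Sc_def right_diff_distrib sum_subtractf sum_distrib_left mult.assoc)
    also have "(\<Sum>a\<in>A. \<Sum>b\<in>B. p a * (c b a * s b \<sigma>)) = (\<Sum>b\<in>B. s b \<sigma> * (\<Sum>a\<in>A. c b a * p a))"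
      by (subst sum.swap) (simp add: sum_distrib_left mult_ac)
    finally have "\<bar>Sc\<bar> \<le> \<bar>\<Sum>a\<in>A. p a * (\<phi> a \<sigma> * exp ((e a - E / 2) * xx \<sigma>) - (\<Sum>b\<in>B. c b a * s b \<sigma>))\<bar>
        + \<bar>\<Sum>b\<in>B. s b \<sigma> * (\<Sum>a\<in>A. c b a * p a)\<bar>" by (simp add: abs_triangle_ineq)
    also have "\<dots> \<le> (\<Sum>a\<in>A. H * \<rho>) + (\<Sum>b\<in>B. 1 * \<epsilon>)"
    proof (intro add_mono order.trans[OF sum_abs] sum_mono)
      fix a assume a: "a \<in> A"
      show "\<bar>p a * (\<phi> a \<sigma> * exp ((e a - E / 2) * xx \<sigma>) - (\<Sum>b\<in>B. c b a * s b \<sigma>))\<bar> \<le> H * \<rho>"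
        unfolding abs_mult by (intro mult_mono pH a approx \<sigma>) auto
    next
      fix b assume b: "b \<in> B"
      show "\<bar>s b \<sigma> * (\<Sum>a\<in>A. c b a * p a)\<bar> \<le> 1 * \<epsilon>"
        unfolding abs_mult by (intro mult_mono s \<sigma> b p(3)) auto
    qed
    also have "\<dots> = M * H * \<rho> + m * \<epsilon>" by (simp add: M_def m_def)
    finally have "\<bar>Sc\<bar> * (H * Y) \<le> (M * H * \<rho> + m * \<epsilon>) * (H * Y)"
      using H1 Y1 by (intro mult_right_mono) auto
    also have "\<dots> = (M * Y * \<rho>) * real H ^ 2 + 1 / 4"
      using m H1 Y1 by (simp add: \<epsilon>_def field_simps power2_eq_square)
    also have "\<dots> \<le> 3 / 4"
    proof -
      have "\<rho> \<ge> 0"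
      proof -
        have "A \<noteq> {}" using M by (auto simp: M_def)
        then obtain a where "a \<in> A" by blast
        then show ?thesis using approx[OF \<sigma>, of a] by linarith
      qed
      then have "(M * Y * \<rho>) * real H ^ 2 \<le> (M * Y * \<rho>) * (4 * X)"
        using H2 Y1 by (intro mult_left_mono) auto
      also have "\<dots> = 64 * m * real M ^ 2 * G * Y ^ 2 * \<rho> / 2" by (simp add: X_def power2_eq_square)
      also have "\<dots> \<le> 1 / 2" using cond by (simp add: m_def M_def mult_ac)
      finally show ?thesis by (simp add: mult_ac)
    qed
    finally show False using lower by linarith
  qed
qed

end

section \<open>Taylor estimates for the exponential function\<close>

lemma exp_partial_sum_le: "x \<ge> 0 \<Longrightarrow> (\<Sum>m<n. x ^ m / fact m) \<le> exp x" for x :: real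
proof -
  assume x: "x \<ge> 0"
  obtain t where "exp x = (\<Sum>m<n. x ^ m / fact m) + exp t / fact n * x ^ n"
    using Maclaurin_exp_le[of x n] by blast
  moreover have "exp t / fact n * x ^ n \<ge> 0" using x by (intro mult_nonneg_nonneg) auto
  ultimately show ?thesis by linarith
qed

lemma power_div_fact_le_exp: "x \<ge> 0 \<Longrightarrow> x ^ n / fact n \<le> exp x" for x :: real
  using exp_partial_sum_le[of x "Suc n"] sum_nonneg[of "{..<n}" "\<lambda>m. x ^ m / fact m"] by simp

lemma exp_taylor_remainder:
  fixes x X :: real
  assumes "\<bar>x\<bar> \<le> X"
  shows "\<bar>exp x - (\<Sum>m<n. x ^ m / fact m)\<bar> \<le> exp X * (X ^ n / fact n)"
proof -
  obtain t where t: "\<bar>t\<bar> \<le> \<bar>x\<bar>" "exp x = (\<Sum>m<n. x ^ m / fact m) + exp t / fact n * x ^ n"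
    using Maclaurin_exp_le[of x n] by blast
  have "\<bar>exp x - (\<Sum>m<n. x ^ m / fact m)\<bar> = exp t * (\<bar>x\<bar> ^ n / fact n)"
    using t(2) by (simp add: abs_mult power_abs)
  also have "\<dots> \<le> exp X * (X ^ n / fact n)"
    using t(1) assms by (intro mult_mono divide_right_mono power_mono) auto
  finally show ?thesis .
qed

text \<open>One term of the exponential series gives \<open>n ^ n / fact n \<le> exp n\<close>; as
  0.0065 lies just below \<open>exp (- 5)\<close>, a net gain of \<open>exp (- 4)\<close> per Taylor
  term remains.\<close>

lemma power_div_fact_small:
  fixes x :: real
  assumes "0 \<le> x" "x \<le> 0.0065 * real n"
  shows "x ^ n / fact n \<le> exp (- 4 * real n)"
proof -
  \<comment> \<open>\<open>exp (- 5)\<close> is reached from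
    \<open>127 / 128 \<le> exp (- 1 / 128)\<close> by the powers 8, 8 and 10, since
    \<open>5 * 128 = 640\<close>.\<close>
  have "(0.0065 :: real) \<le> 0.6049 ^ 10" by (simp add: power_divide)
  also have "\<dots> \<le> (0.9391 ^ 8) ^ 10" by (intro power_mono) (simp_all add: power_divide)
  also have "\<dots> \<le> (((127 / 128) ^ 8) ^ 8) ^ 10" by (intro power_mono) (simp_all add: power_divide)
  also have "\<dots> \<le> ((exp (- 1 / 128) ^ 8) ^ 8) ^ 10"
    using exp_ge_add_one_self[of "- 1 / 128 :: real"] by (intro power_mono) auto
  also have "\<dots> = exp (- 5)" by (simp flip: exp_of_nat_mult)
  finally have e: "0.0065 \<le> exp (- 5 :: real)" .
  have "x \<le> exp (-5) * real n" using assms(2) mult_right_mono[OF e, of "real n"] by simp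
  then have "x ^ n / fact n \<le> (exp (-5) * real n) ^ n / fact n"
    using assms(1) by (intro divide_right_mono power_mono) auto
  also have "\<dots> = exp (-5) ^ n * (real n ^ n / fact n)" by (simp add: power_mult_distrib)
  also have "\<dots> \<le> exp (-5) ^ n * exp (real n)" by (intro mult_left_mono power_div_fact_le_exp) auto
  also have "\<dots> = exp (- 4 * real n)" by (simp flip: exp_of_nat_mult exp_add)
  finally show ?thesis .
qed

lemma abs_exp_diff_le:
  fixes a b M :: real
  assumes "\<bar>a\<bar> \<le> M" "\<bar>b\<bar> \<le> M"
  shows "\<bar>exp a - exp b\<bar> \<le> exp M * \<bar>a - b\<bar>"
proof -
  have *: "exp a - exp b \<le> exp a * (a - b)" if "b \<le> a" for a b :: real
  proof -
    have "1 + (b - a) \<le> exp (b - a)" by (rule exp_ge_add_one_self)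
    then have "exp a * (1 + (b - a)) \<le> exp a * exp (b - a)" by (intro mult_left_mono) auto
    then show ?thesis by (simp add: algebra_simps flip: exp_add)
  qed
  show ?thesis
  proof (cases "b \<le> a")
    case True
    have "exp a * (a - b) \<le> exp M * (a - b)" using True assms by (intro mult_right_mono) auto
    then show ?thesis using *[OF True] True by simp
  next
    case False
    have "exp b * (b - a) \<le> exp M * (b - a)" using False assms by (intro mult_right_mono) auto
    moreover have "\<bar>exp a - exp b\<bar> = exp b - exp a" "\<bar>a - b\<bar> = b - a" using False by auto
    moreover have "exp b - exp a \<le> exp b * (b - a)" using *[of a b] False by simp
    ultimately show ?thesis by (metis order_trans)
  qed
qed

text \<open>Different pairs of a binomial and a Taylor index can yield the same monomial; collecting
  them produces the coefficients of the linear forms.\<close>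

lemma sum_regroup:
  fixes d :: "'q \<Rightarrow> real"
  assumes "finite Q" "finite B" "f ` Q \<subseteq> B"
  shows "(\<Sum>b\<in>B. (\<Sum>x\<in>{x\<in>Q. f x = b}. d x) * s b) = (\<Sum>x\<in>Q. d x * s (f x))"
proof -
  have "(\<Sum>b\<in>B. (\<Sum>x\<in>{x\<in>Q. f x = b}. d x) * s b) = (\<Sum>b\<in>B. \<Sum>x\<in>{x\<in>Q. f x = b}. d x * s (f x))"
    by (intro sum.cong) (auto simp: sum_distrib_right)
  then show ?thesis using sum.group[OF assms, of "\<lambda>x. d x * s (f x)"] by simp
qed

lemma abs_sum_fibre_le:
  fixes d :: "'q \<Rightarrow> real"
  assumes "finite Q"
  shows "\<bar>\<Sum>x\<in>{x\<in>Q. f x = b}. d x\<bar> \<le> (\<Sum>x\<in>Q. \<bar>d x\<bar>)"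
  by (rule order.trans[OF sum_abs]) (use assms in \<open>auto intro!: sum_mono2\<close>)

section \<open>Coordinates adapted to the linear form\<close>

context linear_form
begin

definition "Lam = ln eta + N * lam - k * gam"

text \<open>Were \<open>Lam = 0\<close>, \<open>xx\<close> would be the value \<open>xa\<close> of a linear form in the two coordinates \<open>z1, z2\<close>.\<close>

definition z1 :: "int \<times> int \<times> int \<Rightarrow> int" where "z1 = (\<lambda>(u, v, w). u + int k * w)"
definition z2 :: "int \<times> int \<times> int \<Rightarrow> int" where "z2 = (\<lambda>(u, v, w). v - int N * w)"
definition xa :: "int \<times> int \<times> int \<Rightarrow> real" where "xa \<sigma> = z1 \<sigma> * gam + z2 \<sigma> * lam"

lemma xa_eq: "xa (u, v, w) = xx (u, v, w) - w * Lam"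
  by (simp add: xa_def z1_def z2_def xx_def Lam_def algebra_simps)

lemma gam_pos: "gam > 0" using golden_bounds by (simp add: gam_def)

text \<open>Taylor expansion of a monomial in the coordinates \<open>(xa, z2)\<close>, in which the exponential depends
  on the first coordinate only.\<close>

lemma monomial_expansion_2:
  fixes t X B2 :: real and I k1 k2 :: nat
  assumes X: "X > 0" and B2: "B2 > 0"
  defines "Q \<equiv> {..k1} \<times> {..<I}"
  defines "d \<equiv> (\<lambda>(i, n). (k1 choose i) * (X / gam) ^ i * (- lam * B2 / gam) ^ (k1 - i) * B2 ^ k2 * ((t * X) ^ n / fact n))"
  shows "(\<Sum>x\<in>Q. d x * ((xa \<sigma> / X) ^ (fst x + snd x) * (z2 \<sigma> / B2) ^ (k1 - fst x + k2)))
     = z1 \<sigma> ^ k1 * z2 \<sigma> ^ k2 * (\<Sum>n<I. (t * xa \<sigma>) ^ n / fact n)"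
    and "(\<Sum>x\<in>Q. \<bar>d x\<bar>) \<le> ((X + lam * B2) / gam) ^ k1 * B2 ^ k2 * exp (\<bar>t\<bar> * X)"
proof -
  \<comment> \<open>\<open>z1\<close> is eliminated in favour of \<open>xa\<close> and
    \<open>z2\<close>, and its powers are expanded binomially.\<close>
  have z1: "real_of_int (z1 \<sigma>) = xa \<sigma> / gam + (- lam * z2 \<sigma> / gam)"
    using gam_pos by (simp add: xa_def add_divide_distrib)
  have 1: "real_of_int (z1 \<sigma>) ^ k1 = (\<Sum>i\<le>k1. (k1 choose i) * (xa \<sigma> / gam) ^ i * (- lam * z2 \<sigma> / gam) ^ (k1 - i))"
    unfolding z1 by (rule binomial_ring)
  have "(\<Sum>x\<in>Q. d x * ((xa \<sigma> / X) ^ (fst x + snd x) * (z2 \<sigma> / B2) ^ (k1 - fst x + k2)))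
    = (\<Sum>i\<le>k1. \<Sum>n<I. ((k1 choose i) * (xa \<sigma> / gam) ^ i * (- lam * z2 \<sigma> / gam) ^ (k1 - i)) * (z2 \<sigma> ^ k2 * ((t * xa \<sigma>) ^ n / fact n)))"
    unfolding Q_def sum.cartesian_product
  proof (rule sum.cong)
    fix x assume "x \<in> {..k1} \<times> {..<I}"
    obtain i n where x: "x = (i, n)" by (cases x)
    have "(X / gam) ^ i * (xa \<sigma> / X) ^ i = (xa \<sigma> / gam) ^ i" "(t * X) ^ n * (xa \<sigma> / X) ^ n = (t * xa \<sigma>) ^ n"
      "(- lam * B2 / gam) ^ (k1 - i) * (z2 \<sigma> / B2) ^ (k1 - i) = (- lam * z2 \<sigma> / gam) ^ (k1 - i)"
      "B2 ^ k2 * (z2 \<sigma> / B2) ^ k2 = z2 \<sigma> ^ k2"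
      using X B2 by (simp_all flip: power_mult_distrib)
    note eqs = this
    have gen: "c * a1 * a2 * a3 * (a4 / f) * ((b1 * b4) * (b2 * b3)) = c * (a1 * b1) * (a2 * b2) * (a3 * b3) * ((a4 * b4) / f)"
      for c a1 a2 a3 a4 b1 b2 b3 b4 f :: real by (simp only: mult_ac times_divide_eq_right times_divide_eq_left)
    show "d x * ((xa \<sigma> / X) ^ (fst x + snd x) * (z2 \<sigma> / B2) ^ (k1 - fst x + k2)) =
      (case x of (i, n) \<Rightarrow> ((k1 choose i) * (xa \<sigma> / gam) ^ i * (- lam * z2 \<sigma> / gam) ^ (k1 - i)) * (z2 \<sigma> ^ k2 * ((t * xa \<sigma>) ^ n / fact n)))"
      unfolding x d_def split fst_conv snd_conv power_add gen eqs by (simp only: mult.assoc)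
  qed simp
  also have "\<dots> = z1 \<sigma> ^ k1 * z2 \<sigma> ^ k2 * (\<Sum>n<I. (t * xa \<sigma>) ^ n / fact n)"
    unfolding sum_distrib_left[symmetric] sum_distrib_right[symmetric] 1[symmetric] by (simp add: mult.assoc)
  finally show "(\<Sum>x\<in>Q. d x * ((xa \<sigma> / X) ^ (fst x + snd x) * (z2 \<sigma> / B2) ^ (k1 - fst x + k2)))
     = z1 \<sigma> ^ k1 * z2 \<sigma> ^ k2 * (\<Sum>n<I. (t * xa \<sigma>) ^ n / fact n)" .
  have "(\<Sum>x\<in>Q. \<bar>d x\<bar>) = (\<Sum>i\<le>k1. \<Sum>n<I. ((k1 choose i) * (X / gam) ^ i * (lam * B2 / gam) ^ (k1 - i)) * (B2 ^ k2 * ((\<bar>t\<bar> * X) ^ n / fact n)))"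
    unfolding Q_def sum.cartesian_product
    by (rule sum.cong) (use X B2 gam_pos lam_pos in \<open>auto simp: d_def abs_mult power_abs abs_divide\<close>)
  also have "\<dots> = (X / gam + lam * B2 / gam) ^ k1 * B2 ^ k2 * (\<Sum>n<I. (\<bar>t\<bar> * X) ^ n / fact n)"
    unfolding sum_distrib_left[symmetric] sum_distrib_right[symmetric] binomial_ring[symmetric] by (simp add: mult.assoc)
  also have "\<dots> \<le> (X / gam + lam * B2 / gam) ^ k1 * B2 ^ k2 * exp (\<bar>t\<bar> * X)"
    using X B2 gam_pos lam_pos by (intro mult_left_mono exp_partial_sum_le) auto
  finally show "(\<Sum>x\<in>Q. \<bar>d x\<bar>) \<le> ((X + lam * B2) / gam) ^ k1 * B2 ^ k2 * exp (\<bar>t\<bar> * X)"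
    by (simp add: add_divide_distrib)
qed

end

section \<open>Numerical bounds\<close>

lemma gam_bounds_aux: "0.38 \<le> ln golden" "ln golden \<le> 0.485"
proof -
  have "1 - 1 / golden \<le> ln golden" using golden_bounds ln_le_minus_one[of "1 / golden"] by (simp add: ln_div)
  moreover have "1 / golden \<le> 1 / 1.618" using golden_bounds by (intro divide_left_mono) auto
  ultimately show "0.38 \<le> ln golden" by simp
  have "golden \<le> (1 + 0.485 / 64) ^ 64" using golden_bounds by (simp add: power_divide)
  also have "\<dots> \<le> exp (0.485 / 64) ^ 64" using exp_ge_add_one_self[of "0.485 / 64 :: real"] by (intro power_mono) auto
  also have "\<dots> = exp 0.485" by (simp flip: exp_of_nat_mult)
  finally have "ln golden \<le> ln (exp 0.485)" using golden_bounds by (subst ln_le_cancel_iff) auto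
  then show "ln golden \<le> 0.485" by simp
qed

lemma ln_2_ge: "2 / 3 \<le> ln (2 :: real)"
proof -
  have "(1 / 2 :: real) \<le> (1 - 2 / 300) ^ 100" by (simp add: power_divide)
  also have "\<dots> \<le> exp (- 2 / 300) ^ 100" using exp_ge_add_one_self[of "- 2 / 300 :: real"] by (intro power_mono) auto
  also have "\<dots> = exp (- 2 / 3)" by (simp flip: exp_of_nat_mult)
  finally have "exp (2 / 3) \<le> (2 :: real)" by (simp add: exp_minus field_simps)
  then have "ln (exp (2 / 3)) \<le> ln (2 :: real)" by (subst ln_le_cancel_iff) auto
  then show ?thesis by simp
qed

text \<open>A single term of the exponential series suffices: degree 40 is 17 plus 23, and the
  surplus \<open>K ^ 23\<close> outweighs the constants. This pays for all polynomial factors in the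
  pigeonhole step.\<close>

lemma poly_factor_le_exp:
  fixes K :: real
  assumes "K \<ge> 10 ^ 11"
  shows "2 ^ 19 * K ^ 17 \<le> exp (0.01 * K)"
proof -
  have "2 ^ 19 * 100 ^ 40 * fact 40 \<le> (10 ^ 11 :: real) ^ 23" by (simp add: fact_numeral)
  also have "\<dots> \<le> K ^ 23" using assms by (intro power_mono) auto
  finally have "(2 ^ 19 * 100 ^ 40 * fact 40) * K ^ 17 \<le> K ^ 23 * K ^ 17" using assms by (intro mult_right_mono) auto
  then have "2 ^ 19 * K ^ 17 \<le> K ^ 40 / (100 ^ 40 * fact 40)"
    by (simp add: field_simps flip: power_add del: fact_numeral)
  also have "\<dots> = (0.01 * K) ^ 40 / fact 40" by (simp add: power_divide)
  also have "\<dots> \<le> exp (0.01 * K)" using assms by (intro power_div_fact_le_exp) auto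
  finally show ?thesis .
qed

section \<open>The parameters, and the contradiction\<close>

text \<open>\<open>K\<close> bounds the degree in \<open>z1, z2\<close> and \<open>8 * q\<close> the degree in \<open>y\<close>; \<open>exp b\<close> bounds the coordinates
  \<open>z1, z2\<close> of the points.\<close>

locale parameters = linear_form +
  fixes b :: real and q K :: nat
  assumes b: "b \<ge> 100" and q: "2.5 * b \<le> q" "q \<le> 2.51 * b" and hh: "h \<ge> 0.8"
    and K: "4 * 10 ^ 7 * lam * h * b\<^sup>2 \<le> K" "K \<le> 4.0001 * 10 ^ 7 * lam * h * b\<^sup>2"
    and N: "10 ^ 7 * h * b\<^sup>2 \<le> N" and eb: "10 ^ 8 * N * lam\<^sup>2 * b\<^sup>2 \<le> exp b"
    and Lam: "\<bar>Lam\<bar> \<le> exp (- 6.3 * (real q * real K))"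
begin

lemma lam_ge: "lam \<ge> 2 / 3"
proof -
  have "ln 2 \<le> lam" using g by (simp add: lam_def)
  then show ?thesis using ln_2_ge by linarith
qed

lemma gam_bounds: "0.38 \<le> gam" "gam \<le> 0.485"
  using gam_bounds_aux by (simp_all add: gam_def)

lemma K_ge: "2 * 10 ^ 7 * b\<^sup>2 \<le> K" "10 ^ 11 \<le> real K"
proof -
  have "2 / 3 * 0.8 \<le> lam * h" using lam_ge hh by (intro mult_mono) auto
  then have "4 * 10 ^ 7 * b\<^sup>2 * 0.5 \<le> 4 * 10 ^ 7 * b\<^sup>2 * (lam * h)" by (intro mult_left_mono) auto
  then show 1: "2 * 10 ^ 7 * b\<^sup>2 \<le> K" using K by (simp add: mult_ac)
  have "100 ^ 2 \<le> b\<^sup>2" using b by (intro power_mono) auto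
  then show "10 ^ 11 \<le> real K" using 1 by simp
qed

lemma q_ge: "250 \<le> real q" using q b by linarith

lemma q_le_K: "10 * real q \<le> K"
proof -
  have "b * 100 \<le> b\<^sup>2" using b by (simp add: power2_eq_square)
  then show ?thesis using K_ge q by simp
qed

text \<open>The conditions limit what Liouville's inequality charges for. \<open>u\<close> is
  bounded only through \<open>xx\<close>: \<open>golden\<close> is a unit, so its powers cost
  nothing beyond the size of the value. The scale \<open>s\<close> is 1 for the points in the plane
  and 3 for combinations \<open>\<sigma> - \<sigma>' + \<sigma>''\<close> on a line.\<close>

definition box :: "real \<Rightarrow> (int \<times> int \<times> int) set" where
  "box s = {(u, v, w). \<bar>v\<bar> * lam \<le> s * (0.03 * K) \<and> \<bar>w\<bar> * h \<le> s * (0.03 * K) \<and> \<bar>xx (u, v, w)\<bar> \<le> s * (0.0015 * K)}"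

definition "Z = 0.03 * K * (1 / lam + N / h)"

lemma box_w: assumes "(u, v, w) \<in> box s" "s \<le> 3" shows "\<bar>real_of_int w\<bar> \<le> 0.12 * K"
proof -
  have "\<bar>real_of_int w\<bar> * 0.8 \<le> \<bar>real_of_int w\<bar> * h" using hh by (intro mult_left_mono) auto
  also have "\<dots> \<le> s * (0.03 * K)" using assms by (simp add: box_def)
  also have "\<dots> \<le> 3 * (0.03 * K)" using assms by (intro mult_right_mono) auto
  finally show ?thesis by simp
qed

lemma box_w_Lam: assumes "(u, v, w) \<in> box s" "s \<le> 3"
  shows "\<bar>w * Lam\<bar> \<le> 0.12 * K * exp (- 6.3 * (real q * real K))" "\<bar>w * Lam\<bar> \<le> 1"
proof -
  show 1: "\<bar>w * Lam\<bar> \<le> 0.12 * K * exp (- 6.3 * (real q * real K))"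
    unfolding abs_mult by (rule mult_mono[OF box_w[OF assms] Lam]) auto
  have "0.12 * K \<le> 6.3 * (real q * real K)"
  proof -
    have "1 * real K \<le> real q * real K" using q_ge by (intro mult_right_mono) auto
    moreover have "0.12 * x \<le> 6.3 * y" if "1 * x \<le> y" "0 \<le> x" for x y :: real using that by simp
    ultimately show ?thesis using of_nat_0_le_iff by blast
  qed
  also have "\<dots> \<le> exp (6.3 * (real q * real K))" using exp_ge_add_one_self[of "6.3 * (real q * real K)"] by linarith
  finally have "0.12 * K * exp (- 6.3 * (real q * real K)) \<le> 1" by (simp add: exp_minus field_simps)
  then show "\<bar>w * Lam\<bar> \<le> 1" using 1 by linarith
qed

lemma box_xa: assumes "\<sigma> \<in> box s" "1 \<le> s" "s \<le> 3" shows "\<bar>xa \<sigma>\<bar> \<le> s * (0.0016 * K)"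
proof -
  obtain u v w where \<sigma>: "\<sigma> = (u, v, w)" by (cases \<sigma>)
  have "\<bar>xa \<sigma>\<bar> \<le> \<bar>xx \<sigma>\<bar> + 1" using box_w_Lam(2)[of u v w s] assms unfolding \<sigma> xa_eq by linarith
  also have "\<dots> \<le> s * (0.0015 * K) + 1" using assms unfolding \<sigma> by (simp add: box_def)
  also have "\<dots> \<le> s * (0.0015 * K) + s * (0.0001 * K)"
    using mult_mono[of 1 s 1 "0.0001 * K"] assms K_ge by simp
  finally show ?thesis by (simp add: algebra_simps)
qed

lemma box_xx: assumes "\<sigma> \<in> box s" "0 \<le> s" shows "\<bar>xx \<sigma>\<bar> \<le> s * (0.0016 * K)"
proof -
  have "\<bar>xx \<sigma>\<bar> \<le> s * (0.0015 * K)" using assms by (cases \<sigma>) (auto simp: box_def)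
  also have "\<dots> \<le> s * (0.0016 * K)" using assms by (intro mult_left_mono) auto
  finally show ?thesis .
qed

lemma box_z2: assumes "\<sigma> \<in> box s" shows "\<bar>real_of_int (z2 \<sigma>)\<bar> \<le> s * Z"
proof -
  obtain u v w where \<sigma>: "\<sigma> = (u, v, w)" by (cases \<sigma>)
  have vw: "\<bar>v\<bar> * lam \<le> s * (0.03 * K)" "\<bar>w\<bar> * h \<le> s * (0.03 * K)" using assms by (auto simp: \<sigma> box_def)
  have "\<bar>real_of_int (z2 \<sigma>)\<bar> \<le> \<bar>real_of_int v\<bar> + real N * \<bar>real_of_int w\<bar>"
    using abs_triangle_ineq4[of "real_of_int v" "real N * real_of_int w"] by (simp add: \<sigma> z2_def abs_mult)
  also have "\<dots> \<le> s * (0.03 * K) / lam + N * (s * (0.03 * K) / h)"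
    using vw lam_ge hh by (intro add_mono mult_left_mono) (auto simp: pos_le_divide_eq)
  also have "\<dots> = s * Z" by (simp add: Z_def distrib_left mult_ac)
  finally show ?thesis .
qed

text \<open>This is where \<open>eb\<close> enters. After division by \<open>gam \<ge> 0.38\<close>
  the second bound controls \<open>z1\<close> on \<open>box 1\<close>; the third controls the
  difference of \<open>z2\<close> between a point of \<open>box 3\<close> and one of
  \<open>box 1\<close>.\<close>

lemma Z_bounds: "Z > 0" "0.02 * K + 4 * lam * Z \<le> 0.38 * exp b" "4 * Z \<le> exp b"
proof -
  have Kp: "real K > 0" using K_ge by simp
  then show "Z > 0" unfolding Z_def using lam_ge hh by (intro mult_pos_pos add_pos_nonneg) auto
  define P where "P = N * lam\<^sup>2 * b\<^sup>2"
  have b2: "1 \<le> b\<^sup>2" using b by simp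
  have l2: "2 / 3 * lam \<le> lam\<^sup>2" using lam_ge by (simp add: power2_eq_square)
  have "real K \<le> 4.0001 * lam * (10 ^ 7 * h * b\<^sup>2)" using K(2) by (simp add: mult_ac)
  also have "\<dots> \<le> 4.0001 * lam * N" using N lam_ge by (intro mult_left_mono) auto
  also have "\<dots> \<le> 6.1 * (N * lam\<^sup>2)"
  proof -
    have "4.0001 * lam \<le> 6.1 * lam\<^sup>2" using l2 lam_ge by simp
    then have "real N * (4.0001 * lam) \<le> real N * (6.1 * lam\<^sup>2)" by (intro mult_left_mono) auto
    then show ?thesis by (simp add: mult_ac)
  qed
  also have "\<dots> \<le> 6.1 * (N * lam\<^sup>2) * b\<^sup>2" using mult_left_mono[OF b2, of "6.1 * (N * lam\<^sup>2)"] by simp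
  finally have 1: "real K \<le> 6.1 * P" by (simp add: P_def)
  have "lam * (0.03 * K * (N / h)) = 0.03 * lam * N * (K / h)" by simp
  also have "\<dots> \<le> 0.03 * lam * N * (4.0001 * 10 ^ 7 * lam * b\<^sup>2)"
    using K(2) hh lam_ge by (intro mult_left_mono) (auto simp: field_simps)
  also have "\<dots> = 0.03 * 4.0001 * 10 ^ 7 * P" by (simp add: P_def power2_eq_square)
  also have "\<dots> \<le> 1.3 * 10 ^ 6 * P" by (intro mult_right_mono) (auto simp: P_def)
  finally have 2: "lam * (0.03 * K * (N / h)) \<le> 1.3 * 10 ^ 6 * P" .
  have lZ: "lam * Z = 0.03 * K + lam * (0.03 * K * (N / h))"
    using lam_ge by (simp add: Z_def field_simps)
  have P: "10 ^ 8 * P \<le> exp b" "P \<ge> 0" using eb by (auto simp: P_def mult_ac)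
  have "0.02 * x + 4 * (0.03 * x + V) \<le> 0.38 * y"
    if "x \<le> 6.1 * P" "V \<le> 1.3 * 10 ^ 6 * P" "10 ^ 8 * P \<le> y" for x V y :: real using that P by simp
  from this[OF 1 2 P(1)] show *: "0.02 * K + 4 * lam * Z \<le> 0.38 * exp b" unfolding mult.assoc lZ .
  have **: "(2 / 3) * Z \<le> lam * Z" using \<open>Z > 0\<close> lam_ge by (intro mult_right_mono) auto
  have "4 * z \<le> y" if "(2 / 3) * z \<le> lz" "0.02 * x + 4 * lz \<le> 0.38 * y" "0 < x" "0 < z" for x y z lz :: real
    using that by simp
  from this[OF ** *[unfolded mult.assoc] Kp \<open>Z > 0\<close>] show "4 * Z \<le> exp b" .
qed

text \<open>There are \<open>4 * q * K * (K + 1)\<close> unknowns, and the forms are indexed by the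
  monomials of degree below \<open>q * K\<close> in \<open>xa\<close> and below \<open>K\<close> in
  \<open>z2\<close>: the ratio just exceeds the required 4.\<close>

lemma vanishing_2:
  defines "A \<equiv> (SIGMA k1:{..<K}. {..<K - k1}) \<times> {..<8 * q}"
  obtains p :: "(nat \<times> nat) \<times> nat \<Rightarrow> int" where "\<exists>a\<in>A. p a \<noteq> 0"
    "\<And>\<sigma>. \<sigma> \<in> box 1 \<Longrightarrow> (\<Sum>a\<in>A. p a * (z1 \<sigma> ^ fst (fst a) * z2 \<sigma> ^ snd (fst a)) * yy \<sigma> ^ snd a) = 0"
proof -
  \<comment> \<open>With \<open>I\<close> Taylor terms, a monomial of degree below \<open>K\<close>
    reaches \<open>xa\<close>-degrees below \<open>I + K = q * K\<close>.\<close>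
  define I where "I = (q - 1) * K"
  define E where "E = 8 * q - 1"
  define B where "B = {..<I + K} \<times> {..<K}"
  define X where "X = 0.0016 * real K"
  define c where "c = real E / 2"
  \<comment> \<open>The Liouville cost in units of \<open>q * K\<close> is
    \<open>2 * 8 * 0.06 + 8 * 0.0015 / 2 = 0.966\<close>.\<close>
  define \<kappa> where "\<kappa> = 0.97 * (real q * real K)"
  have q1: "q \<ge> 250" using q_ge by simp
  have "real K \<ge> 1" using K_ge(2) by simp
  then have K1: "K \<ge> 1" by simp
  have X: "X > 0" using K1 by (simp add: X_def)
  have c: "0 \<le> c" "c \<le> 4 * real q" by (simp_all add: c_def E_def)
  have IK: "I + K = q * K" using q1 by (simp add: I_def algebra_simps)
  have fin: "finite A" "finite B" "B \<noteq> {}" using K1 q1 by (auto simp: A_def B_def I_def lessThan_empty_iff)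
  have cB: "card B = q * K * K" by (simp add: B_def IK)
  have "card (SIGMA k1:{..<K}. {..<K - k1}) = (\<Sum>k1<K. K - k1)" by simp
  also have "\<dots> = (\<Sum>j\<in>{1..K}. j)"
    by (rule sum.reindex_bij_witness[of _ "\<lambda>j. K - j" "\<lambda>j. K - j"]) auto
  also have "\<dots> = K * (K + 1) div 2" using Sum_Icc_nat[of 1 K] by simp
  finally have cT: "card (SIGMA k1:{..<K}. {..<K - k1}) = K * (K + 1) div 2" .
  have cA: "card A = 4 * (q * K * (K + 1))"
  proof -
    have "even (K * (K + 1))" by simp
    then obtain j where j: "K * (K + 1) = 2 * j" by (rule evenE)
    have "card A = j * (8 * q)" unfolding A_def card_cartesian_product cT j by simp
    then show ?thesis using j by (simp only: mult.assoc) simp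
  qed
  have card: "card A \<ge> 4 * card B" by (simp add: cA cB algebra_simps)
  define \<beta> where "\<beta> = b * real K"
  define M where "M = real (card A)"
  have M: "M \<le> 8 * q * real K ^ 2" "M \<ge> 1"
  proof -
    have "q * K * (K + 1) \<le> q * K * (2 * K)" using K1 by (intro mult_left_mono) auto
    then have "card A \<le> 8 * q * K ^ 2" by (simp add: cA power2_eq_square)
    then show "M \<le> 8 * q * real K ^ 2" unfolding M_def by (metis of_nat_le_iff of_nat_mult of_nat_numeral of_nat_power)
    have "card B \<ge> 1" using fin by (simp add: Suc_le_eq card_gt_0_iff)
    then have "card A \<ge> 1" using card by linarith
    then show "M \<ge> 1" by (simp add: M_def)
  qed
  define G where "G = exp (\<beta> + c * X)"
  define \<Phi> where "\<Phi> = exp \<beta>"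
  define Y where "Y = M * \<Phi> * exp \<kappa>"
  define R1 where "R1 = exp (c * X) * (4 * q * (0.12 * K * exp (- 6.3 * (real q * real K))))"
  define R2 where "R2 = exp (c * X) * ((c * X) ^ I / fact I)"
  define \<rho> where "\<rho> = \<Phi> * (R1 + R2)"
  define \<phi> where "\<phi> = (\<lambda>(a :: (nat \<times> nat) \<times> nat) \<sigma>. z1 \<sigma> ^ fst (fst a) * z2 \<sigma> ^ snd (fst a))"
  define t where "t = (\<lambda>a :: (nat \<times> nat) \<times> nat. real (snd a) - real E / 2)"
  have tc: "\<bar>t a\<bar> \<le> c" if "a \<in> A" for a
  proof -
    have "snd a \<le> E" using that by (auto simp: A_def E_def)
    then show ?thesis unfolding t_def c_def by (simp add: abs_le_iff field_simps)
  qed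
  define d where "d = (\<lambda>a :: (nat \<times> nat) \<times> nat. \<lambda>(i, n). (fst (fst a) choose i) * (X / gam) ^ i * (- lam * Z / gam) ^ (fst (fst a) - i) * Z ^ snd (fst a) * ((t a * X) ^ n / fact n))"
  define f where "f = (\<lambda>a :: (nat \<times> nat) \<times> nat. \<lambda>x :: nat \<times> nat. (fst x + snd x, fst (fst a) - fst x + snd (fst a)))"
  define QQ where "QQ = (\<lambda>a :: (nat \<times> nat) \<times> nat. {..fst (fst a)} \<times> {..<I})"
  define cc where "cc = (\<lambda>b a. \<Sum>x\<in>{x\<in>QQ a. f a x = b}. d a x)"
  define s where "s = (\<lambda>b \<sigma>. (xa \<sigma> / X) ^ fst b * (z2 \<sigma> / Z) ^ snd b)"
  note exp2 = monomial_expansion_2[OF X Z_bounds(1)]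
  have XZ: "(X + lam * Z) / gam \<le> exp b" "Z \<le> exp b"
  proof -
    have lz: "0 \<le> lam * Z" using lam_ge Z_bounds(1) by simp
    have "X + lam * Z \<le> 0.38 * exp b" using Z_bounds(2) lz by (simp add: X_def)
    also have "\<dots> \<le> gam * exp b" using gam_bounds by (intro mult_right_mono) auto
    finally show "(X + lam * Z) / gam \<le> exp b" using gam_bounds by (simp add: field_simps)
    show "Z \<le> exp b" using Z_bounds by linarith
  qed
  have powexp: "exp b ^ k1 * exp b ^ k2 \<le> exp \<beta>" if "k1 + k2 < K" for k1 k2
  proof -
    have "real (k1 + k2) * b \<le> real K * b" using that b by (intro mult_right_mono) auto
    then show ?thesis by (simp add: \<beta>_def algebra_simps flip: exp_of_nat_mult exp_add)
  qed
  have Asum: "fst (fst a) + snd (fst a) < K" "snd a \<le> E" if "a \<in> A" for a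
    using that by (auto simp: A_def E_def)
  have xa1: "\<bar>xa \<sigma>\<bar> \<le> X" and z21: "\<bar>real_of_int (z2 \<sigma>)\<bar> \<le> Z" and xx1: "\<bar>xx \<sigma>\<bar> \<le> X" if "\<sigma> \<in> box 1" for \<sigma>
    using box_xa[OF that] box_z2[OF that] box_xx[OF that] by (auto simp: X_def)
  have z1b: "\<bar>real_of_int (z1 \<sigma>)\<bar> \<le> exp b" if "\<sigma> \<in> box 1" for \<sigma>
  proof -
    have "gam * real_of_int (z1 \<sigma>) = xa \<sigma> - lam * z2 \<sigma>" by (simp add: xa_def)
    then have "gam * \<bar>real_of_int (z1 \<sigma>)\<bar> = \<bar>xa \<sigma> - lam * z2 \<sigma>\<bar>" using gam_pos by (metis abs_mult abs_of_pos)
    also have "\<dots> \<le> X + lam * Z" using xa1[OF that] z21[OF that] lam_pos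
      by (intro order.trans[OF abs_triangle_ineq4] add_mono) (auto simp: abs_mult)
    finally have "\<bar>real_of_int (z1 \<sigma>)\<bar> \<le> (X + lam * Z) / gam" using gam_pos by (simp add: field_simps)
    then show ?thesis using XZ by linarith
  qed
  have \<phi>: "\<bar>real_of_int (\<phi> a \<sigma>)\<bar> \<le> \<Phi>" if "\<sigma> \<in> box 1" "a \<in> A" for a \<sigma>
  proof -
    have "\<bar>real_of_int (\<phi> a \<sigma>)\<bar> \<le> exp b ^ fst (fst a) * exp b ^ snd (fst a)"
      unfolding \<phi>_def of_int_mult of_int_power abs_mult power_abs
      using z1b[OF that(1)] z21[OF that(1)] XZ by (intro mult_mono power_mono) auto
    then show ?thesis using powexp[OF Asum(1)[OF that(2)]] by (simp add: \<Phi>_def)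
  qed
  have G: "\<bar>cc b' a\<bar> \<le> G" if "a \<in> A" "b' \<in> B" for a b'
  proof -
    have "\<bar>cc b' a\<bar> \<le> (\<Sum>x\<in>QQ a. \<bar>d a x\<bar>)" unfolding cc_def by (rule abs_sum_fibre_le) (simp add: QQ_def)
    also have "\<dots> \<le> ((X + lam * Z) / gam) ^ fst (fst a) * Z ^ snd (fst a) * exp (\<bar>t a\<bar> * X)"
      unfolding QQ_def d_def by (rule exp2(2))
    also have "\<dots> \<le> exp b ^ fst (fst a) * exp b ^ snd (fst a) * exp (c * X)"
      using XZ tc[OF that(1)] X Z_bounds(1) lam_pos gam_pos by (intro mult_mono power_mono) auto
    also have "\<dots> \<le> exp \<beta> * exp (c * X)" using powexp[OF Asum(1)[OF that(1)]] by (intro mult_right_mono) auto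
    finally show ?thesis by (simp add: G_def exp_add)
  qed
  have s: "\<bar>s b' \<sigma>\<bar> \<le> 1" if "\<sigma> \<in> box 1" "b' \<in> B" for b' \<sigma>
    unfolding s_def abs_mult power_abs abs_divide
    using xa1[OF that(1)] z21[OF that(1)] X Z_bounds(1) by (intro mult_le_one power_le_one) auto
  have approx: "\<bar>\<phi> a \<sigma> * exp ((real (snd a) - real E / 2) * xx \<sigma>) - (\<Sum>b\<in>B. cc b a * s b \<sigma>)\<bar> \<le> \<rho>"
    if \<sigma>: "\<sigma> \<in> box 1" and a: "a \<in> A" for a \<sigma>
  proof -
    obtain u v w where uvw: "\<sigma> = (u, v, w)" by (cases \<sigma>)
    have "f a ` QQ a \<subseteq> B" using Asum(1)[OF a] by (auto simp: f_def QQ_def B_def)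
    then have "(\<Sum>b\<in>B. cc b a * s b \<sigma>) = (\<Sum>x\<in>QQ a. d a x * s (f a x) \<sigma>)"
      unfolding cc_def by (intro sum_regroup fin) (auto simp: QQ_def)
    also have "\<dots> = \<phi> a \<sigma> * (\<Sum>n<I. (t a * xa \<sigma>) ^ n / fact n)"
      using exp2(1)[where ?k1.0 = "fst (fst a)" and ?k2.0 = "snd (fst a)" and I = I and t = "t a" and \<sigma> = \<sigma>] by (simp add: QQ_def d_def s_def f_def \<phi>_def)
    finally have "\<phi> a \<sigma> * exp ((real (snd a) - real E / 2) * xx \<sigma>) - (\<Sum>b\<in>B. cc b a * s b \<sigma>) =
       \<phi> a \<sigma> * ((exp (t a * xx \<sigma>) - exp (t a * xa \<sigma>)) + (exp (t a * xa \<sigma>) - (\<Sum>n<I. (t a * xa \<sigma>) ^ n / fact n)))"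
      by (simp add: t_def algebra_simps)
    also have "\<bar>\<dots>\<bar> \<le> \<Phi> * (R1 + R2)"
      unfolding abs_mult
    proof (intro mult_mono \<phi> \<sigma> a order.trans[OF abs_triangle_ineq] add_mono)
      have tx: "\<bar>t a * x\<bar> \<le> c * X" if "\<bar>x\<bar> \<le> X" for x unfolding abs_mult using tc[OF a] that c by (intro mult_mono) auto
      have "\<bar>exp (t a * xx \<sigma>) - exp (t a * xa \<sigma>)\<bar> \<le> exp (c * X) * \<bar>t a * xx \<sigma> - t a * xa \<sigma>\<bar>"
        by (intro abs_exp_diff_le tx xa1 xx1 \<sigma>)
      also have "t a * xx \<sigma> - t a * xa \<sigma> = t a * (w * Lam)" by (simp add: uvw xa_eq algebra_simps)
      also have "exp (c * X) * \<bar>t a * (w * Lam)\<bar> \<le> R1"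
        unfolding R1_def abs_mult[of "t a"] using tc[OF a] c box_w_Lam(1)[of u v w 1] \<sigma> uvw
        by (intro mult_left_mono mult_mono) auto
      finally show "\<bar>exp (t a * xx \<sigma>) - exp (t a * xa \<sigma>)\<bar> \<le> R1" .
      show "\<bar>exp (t a * xa \<sigma>) - (\<Sum>n<I. (t a * xa \<sigma>) ^ n / fact n)\<bar> \<le> R2"
        unfolding R2_def by (intro exp_taylor_remainder tx xa1 \<sigma>)
    qed (auto simp: \<Phi>_def)
    finally show ?thesis by (simp add: \<rho>_def)
  qed
  have cost: "2 * real E * (\<bar>real_of_int v\<bar> * lam + \<bar>real_of_int w\<bar> * h) + E * \<bar>xx (u, v, w)\<bar> / 2 \<le> \<kappa>" if "(u, v, w) \<in> box 1" for u v w :: int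
  proof -
    have "2 * real E * (\<bar>real_of_int v\<bar> * lam + \<bar>real_of_int w\<bar> * h) + E * \<bar>xx (u, v, w)\<bar> / 2 \<le> 2 * (8 * real q) * (0.06 * K) + (8 * real q) * (0.0015 * K) / 2"
      using that lam_pos hh by (intro add_mono mult_mono divide_right_mono) (auto simp: E_def box_def)
    also have "\<dots> \<le> \<kappa>" by (simp add: \<kappa>_def)
    finally show ?thesis .
  qed
  have cX: "c * X \<le> 0.0064 * (real q * real K)" "0 \<le> c * X"
    using mult_right_mono[OF c(2), of X] c X by (auto simp: X_def)
  have I: "real I = (real q - 1) * K" using q1 by (simp add: I_def of_nat_diff)
  have qK: "250 * real K \<le> real q * real K" using q1 by (intro mult_right_mono) auto
  \<comment> \<open>Here \<open>2.5 * b \<le> q\<close> enters: monomials of size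
    \<open>exp (b * K)\<close> may cost only a fixed fraction of \<open>q * K\<close>.\<close>
  have \<beta>: "\<beta> \<le> 0.4 * (real q * real K)" using q(1) mult_right_mono[of "2.5 * b" q "real K"] by (simp add: \<beta>_def)
  have R2: "R2 \<le> exp (c * X - 4 * real I)"
  proof -
    have "c * X \<le> 0.0065 * real I" using cX qK by (simp add: I algebra_simps)
    then show ?thesis unfolding R2_def using power_div_fact_small[of "c * X" I] cX by (simp add: exp_diff exp_minus field_simps)
  qed
  have R1: "R1 \<le> 0.48 * q * K * exp (c * X - 6.3 * (real q * real K))"
  proof -
    have "exp (c * X - 6.3 * (real q * real K)) = exp (c * X) * exp (- 6.3 * (real q * real K))"
      by (simp only: exp_add[symmetric]) simp
    then show ?thesis by (simp add: R1_def)
  qed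
  have "64 * real (card B) * (real (card A))\<^sup>2 * G * Y\<^sup>2 * \<rho> = 64 * real (card B) * M ^ 4 * exp (4 * \<beta> + c * X + 2 * \<kappa>) * (R1 + R2)"
  proof -
    have e: "exp (4 * \<beta> + c * X + 2 * \<kappa>) = exp \<beta> ^ 4 * exp (c * X) * exp \<kappa> ^ 2"
      by (simp add: exp_add flip: exp_of_nat_mult)
    have "64 * m * M\<^sup>2 * (eb * ec) * (M * eb * ek)\<^sup>2 * (eb * r) = 64 * m * M ^ 4 * (eb ^ 4 * ec * ek ^ 2) * r"
      for m M eb ec ek r :: real by (simp add: eval_nat_numeral)
    note gen = this
    show ?thesis unfolding e G_def Y_def \<rho>_def \<Phi>_def M_def[symmetric] exp_add[of \<beta> "c * X"] by (rule gen)
  qed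
  also have "\<dots> \<le> 1"
  proof -
    define x where "x = real q * real K"
    define P where "P = 64 * real (card B) * M ^ 4"
    have qK1: "real q \<le> K / 10" "1 \<le> real q" using q_le_K q1 by auto
    have "P \<le> 64 * (q * real K ^ 2) * (8 * q * real K ^ 2) ^ 4"
      unfolding P_def using M by (intro mult_mono power_mono) (auto simp: cB power2_eq_square)
    also have "\<dots> = 2 ^ 18 * real q ^ 5 * real K ^ 10" by (simp add: power_mult_distrib eval_nat_numeral)
    also have "\<dots> \<le> 2 ^ 18 * real K ^ 5 * real K ^ 10"
      using qK1 by (intro mult_mono power_mono) auto
    finally have P: "P \<le> 2 ^ 18 * real K ^ 15" by (simp add: eval_nat_numeral)
    have K1': "1 \<le> real K" using K1 by simp
    have P1: "P * (0.48 * q * K) \<le> exp (0.01 * K) / 2"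
    proof -
      have "P * (0.48 * q * K) \<le> (2 ^ 18 * real K ^ 15) * (1 * real K * real K)"
        using P qK1 by (intro mult_mono) auto
      also have "\<dots> = 2 ^ 19 * real K ^ 17 / 2" by (simp add: eval_nat_numeral)
      also have "\<dots> \<le> exp (0.01 * K) / 2" by (intro divide_right_mono poly_factor_le_exp K_ge) auto
      finally show ?thesis .
    qed
    have P2: "P \<le> exp (0.01 * K) / 2"
    proof -
      have "P \<le> 2 ^ 18 * real K ^ 17" using P power_increasing[of 15 17 "real K"] K1' by simp
      then show ?thesis using poly_factor_le_exp[OF K_ge(2)] by simp
    qed
    have x: "250 * real K \<le> x" "c * X \<le> 0.0064 * x" "\<beta> \<le> 0.4 * x" "\<kappa> = 0.97 * x" "real I = x - real K"
      using qK cX \<beta> I by (auto simp: x_def \<kappa>_def algebra_simps)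
    have R1x: "R1 \<le> 0.48 * q * K * exp (c * X - 6.3 * x)" using R1 by (simp add: x_def)
    have gen: "0.01 * kk + (4 * be + y + 2 * ka) + (y - 6.3 * x) \<le> 0" "0.01 * kk + (4 * be + y + 2 * ka) + (y - 4 * i) \<le> 0"
      if "250 * kk \<le> x" "y \<le> 0.0064 * x" "be \<le> 0.4 * x" "ka = 0.97 * x" "i = x - kk" "1 \<le> kk" for kk x y be ka i :: real
      using that by simp_all
    have e1: "0.01 * K + (4 * \<beta> + c * X + 2 * \<kappa>) + (c * X - 6.3 * x) \<le> 0" by (rule gen(1)[OF x K1'])
    \<comment> \<open>The budget in units of \<open>q * K\<close>: \<open>4 * 0.4\<close> for the
      monomials and \<open>2 * 0.97\<close> for Liouville, against a gain of almost 4 from the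
      Taylor remainder.\<close>
    have e2: "0.01 * K + (4 * \<beta> + c * X + 2 * \<kappa>) + (c * X - 4 * real I) \<le> 0" by (rule gen(2)[OF x K1'])
    have "P * exp (4 * \<beta> + c * X + 2 * \<kappa>) * R1 \<le> P * exp (4 * \<beta> + c * X + 2 * \<kappa>) * (0.48 * q * K * exp (c * X - 6.3 * x))"
      using R1x M by (intro mult_left_mono) (auto simp: P_def)
    also have "\<dots> = (P * (0.48 * q * K)) * (exp (4 * \<beta> + c * X + 2 * \<kappa>) * exp (c * X - 6.3 * x))" by (simp only: mult_ac)
    also have "\<dots> \<le> exp (0.01 * K) / 2 * (exp (4 * \<beta> + c * X + 2 * \<kappa>) * exp (c * X - 6.3 * x))"
      by (intro mult_right_mono P1) auto
    also have "\<dots> = exp (0.01 * K + (4 * \<beta> + c * X + 2 * \<kappa>) + (c * X - 6.3 * x)) / 2"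
      by (simp only: exp_add times_divide_eq_left mult.assoc)
    also have "\<dots> \<le> 1 / 2" using e1 by simp
    finally have 1: "P * exp (4 * \<beta> + c * X + 2 * \<kappa>) * R1 \<le> 1 / 2" .
    have "P * exp (4 * \<beta> + c * X + 2 * \<kappa>) * R2 \<le> exp (0.01 * K) / 2 * exp (4 * \<beta> + c * X + 2 * \<kappa>) * exp (c * X - 4 * real I)"
      using P2 R2 cX(2) M by (intro mult_mono) (auto simp: P_def R2_def)
    also have "\<dots> = exp (0.01 * K + (4 * \<beta> + c * X + 2 * \<kappa>) + (c * X - 4 * real I)) / 2"
      by (simp only: exp_add times_divide_eq_left mult.assoc)
    also have "\<dots> \<le> 1 / 2" using e2 by simp
    finally have 2: "P * exp (4 * \<beta> + c * X + 2 * \<kappa>) * R2 \<le> 1 / 2" .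
    show ?thesis using 1 2 by (simp add: P_def distrib_left)
  qed
  finally have cond: "64 * real (card B) * (real (card A))\<^sup>2 * G * Y\<^sup>2 * \<rho> \<le> 1" .
  have \<beta>0: "0 \<le> \<beta>" using b by (simp add: \<beta>_def)
  have pos: "1 \<le> G" "1 \<le> \<Phi>" "0 \<le> \<kappa>" using \<beta>0 cX by (auto simp: G_def \<Phi>_def \<kappa>_def)
  show ?thesis
  proof (rule vanishing_combination[where A = A and B = B and c = cc and G = G and \<Sigma> = "box 1" and s = s and \<phi> = \<phi>
      and \<Phi> = \<Phi> and e = snd and E = E and \<rho> = \<rho> and \<kappa> = \<kappa> and Y = Y])
    fix p :: "(nat \<times> nat) \<times> nat \<Rightarrow> int"
    assume "\<exists>a\<in>A. p a \<noteq> 0" "\<And>\<sigma>. \<sigma> \<in> box 1 \<Longrightarrow> (\<Sum>a\<in>A. p a * \<phi> a \<sigma> * yy \<sigma> ^ snd a) = 0"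
    then show thesis using that by (simp add: \<phi>_def)
  qed (fact fin card pos cond | (rule G s \<phi> Asum(2) approx cost, assumption+) | simp add: Y_def M_def)+
qed

end

context parameters
begin

text \<open>On a line only one coordinate is left, and degree \<open>2 * K\<close> in it with \<open>4 * q\<close> powers of \<open>y\<close>
  leaves room for the pigeonhole.\<close>

lemma vanishing_1:
  fixes \<Sigma> :: "(int \<times> int \<times> int) set" and t0 :: int and \<xi>0 \<kappa>0 B2 :: real
  assumes \<Sigma>: "\<Sigma> \<subseteq> box 3" and B2: "1 \<le> B2" "B2 \<le> exp b"
    and t0: "\<And>\<sigma>. \<sigma> \<in> \<Sigma> \<Longrightarrow> \<bar>real_of_int (z2 \<sigma> - t0)\<bar> \<le> B2"
    and line: "\<And>\<sigma>. \<sigma> \<in> \<Sigma> \<Longrightarrow> xa \<sigma> = \<xi>0 + \<kappa>0 * (z2 \<sigma> - t0)"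
    and \<xi>0: "\<bar>\<xi>0\<bar> \<le> 0.0016 * K" and \<kappa>0: "\<bar>\<kappa>0\<bar> * B2 \<le> 0.0064 * K"
  defines "A \<equiv> {..<2 * K} \<times> {..<4 * q}"
  obtains p :: "nat \<times> nat \<Rightarrow> int" where "\<exists>a\<in>A. p a \<noteq> 0"
    "\<And>\<sigma>. \<sigma> \<in> \<Sigma> \<Longrightarrow> (\<Sum>a\<in>A. p a * ((z2 \<sigma> - t0) ^ fst a) * yy \<sigma> ^ snd a) = 0"
proof -
  \<comment> \<open>Powers of the single coordinate stay below \<open>I + 2 * K = 2 * q * K\<close>,
    against \<open>8 * q * K\<close> unknowns: the ratio is exactly 4.\<close>
  define I where "I = 2 * ((q - 1) * K)"
  define E where "E = 4 * q - 1"
  define B where "B = {..<I + 2 * K}"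
  define X where "X = 0.0048 * real K"
  define c where "c = real E / 2"
  \<comment> \<open>On \<open>box 3\<close> the cost is
    \<open>2 * 4 * 0.18 + 4 * 0.0045 / 2 = 1.449\<close>.\<close>
  define \<kappa> where "\<kappa> = 1.45 * (real q * real K)"
  have q1: "q \<ge> 250" using q_ge by simp
  have "real K \<ge> 1" using K_ge(2) by simp
  then have K1: "K \<ge> 1" by simp
  have X: "X > 0" using K1 by (simp add: X_def)
  have c: "0 \<le> c" "c \<le> 2 * real q" by (simp_all add: c_def E_def)
  have IK: "I + 2 * K = 2 * (q * K)" using q1 by (simp add: I_def algebra_simps)
  have fin: "finite A" "finite B" "B \<noteq> {}" using K1 q1 by (auto simp: A_def B_def I_def lessThan_empty_iff)
  have cB: "card B = 2 * (q * K)" by (simp add: B_def IK)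
  have cA: "card A = 4 * (2 * (q * K))" by (simp add: A_def card_cartesian_product)
  have card: "card A \<ge> 4 * card B" by (simp add: cA cB)
  define \<beta> where "\<beta> = b * real K"
  define M where "M = real (card A)"
  have M: "M = 8 * q * real K" "M \<ge> 1"
  proof -
    show "M = 8 * q * real K" by (simp add: M_def cA)
    have "card B \<ge> 1" using fin by (simp add: Suc_le_eq card_gt_0_iff)
    then have "card A \<ge> 1" using card by linarith
    then show "M \<ge> 1" by (simp add: M_def)
  qed
  define c8 where "c8 = c * (0.008 * K)"
  define G where "G = exp (2 * \<beta> + c8)"
  define \<Phi> where "\<Phi> = exp (2 * \<beta>)"
  define Y where "Y = M * \<Phi> * exp \<kappa>"
  define R1 where "R1 = exp (c * X) * (2 * q * (0.12 * K * exp (- 6.3 * (real q * real K))))"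
  define R2 where "R2 = exp c8 * ((c * (0.0064 * K)) ^ I / fact I)"
  define \<rho> where "\<rho> = \<Phi> * (R1 + R2)"
  define \<phi> where "\<phi> = (\<lambda>(a :: nat \<times> nat) \<sigma>. (z2 \<sigma> - t0) ^ fst a)"
  define t where "t = (\<lambda>a :: nat \<times> nat. real (snd a) - real E / 2)"
  have Asum: "fst a < 2 * K" "snd a \<le> E" if "a \<in> A" for a
    using that by (auto simp: A_def E_def)
  have tc: "\<bar>t a\<bar> \<le> c" if "a \<in> A" for a
    using Asum(2)[OF that] unfolding t_def c_def by (simp add: abs_le_iff field_simps)
  \<comment> \<open>On the line only \<open>\<kappa>0 * (z2 \<sigma> - t0)\<close> varies and is
    expanded; the constant factor \<open>exp (t a * \<xi>0)\<close> is kept exact inside the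
    coefficients.\<close>
  define d where "d = (\<lambda>(a :: nat \<times> nat) (n :: nat). exp (t a * \<xi>0) * B2 ^ fst a * ((t a * (\<kappa>0 * B2)) ^ n / fact n))"
  define f where "f = (\<lambda>(a :: nat \<times> nat) (n :: nat). fst a + n)"
  define cc where "cc = (\<lambda>b a. \<Sum>x\<in>{x\<in>{..<I}. f a x = b}. d a x)"
  define s where "s = (\<lambda>(n :: nat) \<sigma>. (real_of_int (z2 \<sigma> - t0) / B2) ^ n)"
  have B2p: "B2 > 0" using B2 by simp
  have powexp: "B2 ^ k1 \<le> exp (2 * \<beta>)" if "k1 < 2 * K" for k1
  proof -
    have "B2 ^ k1 \<le> exp b ^ k1" using B2 by (intro power_mono) auto
    also have "\<dots> \<le> exp (2 * \<beta>)"
    proof -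
      have "real k1 * b \<le> real (2 * K) * b" using that b by (intro mult_right_mono) auto
      then show ?thesis by (simp add: \<beta>_def algebra_simps flip: exp_of_nat_mult)
    qed
    finally show ?thesis .
  qed
  have xa1: "\<bar>xa \<sigma>\<bar> \<le> X" and xx1: "\<bar>xx \<sigma>\<bar> \<le> X" if "\<sigma> \<in> \<Sigma>" for \<sigma>
    using box_xa[of \<sigma> 3] box_xx[of \<sigma> 3] \<Sigma> that by (auto simp: X_def)
  have \<phi>: "\<bar>real_of_int (\<phi> a \<sigma>)\<bar> \<le> \<Phi>" if "\<sigma> \<in> \<Sigma>" "a \<in> A" for a \<sigma>
  proof -
    have "\<bar>real_of_int (\<phi> a \<sigma>)\<bar> \<le> B2 ^ fst a"
      unfolding \<phi>_def of_int_power power_abs using t0[OF that(1)] by (intro power_mono) auto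
    then show ?thesis using powexp[OF Asum(1)[OF that(2)]] by (simp add: \<Phi>_def)
  qed
  have tx: "\<bar>t a * x\<bar> \<le> c * X'" if "a \<in> A" "\<bar>x\<bar> \<le> X'" for a x X'
    unfolding abs_mult using tc[OF that(1)] that(2) c by (intro mult_mono) auto
  have tk: "\<bar>\<kappa>0 * B2\<bar> \<le> 0.0064 * K" using \<kappa>0 B2p by (simp add: abs_mult)
  have e8: "exp (c * (0.0016 * K)) * exp (c * (0.0064 * K)) = exp c8"
    by (simp add: c8_def algebra_simps flip: exp_add)
  have G: "\<bar>cc b' a\<bar> \<le> G" if "a \<in> A" "b' \<in> B" for a b'
  proof -
    have "\<bar>cc b' a\<bar> \<le> (\<Sum>x<I. \<bar>d a x\<bar>)" unfolding cc_def by (rule abs_sum_fibre_le) simp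
    also have "\<dots> = exp (t a * \<xi>0) * B2 ^ fst a * (\<Sum>n<I. \<bar>t a * (\<kappa>0 * B2)\<bar> ^ n / fact n)"
      using B2p by (simp add: d_def sum_distrib_left abs_mult power_abs)
    also have "\<dots> \<le> exp (t a * \<xi>0) * B2 ^ fst a * exp \<bar>t a * (\<kappa>0 * B2)\<bar>"
      using B2p by (intro mult_left_mono exp_partial_sum_le) auto
    also have "\<dots> \<le> exp (c * (0.0016 * K)) * exp (2 * \<beta>) * exp (c * (0.0064 * K))"
      using tx[OF that(1) \<xi>0] tx[OF that(1) tk] powexp[OF Asum(1)[OF that(1)]] B2p
      by (intro mult_mono) auto
    also have "\<dots> = G" unfolding G_def exp_add e8[symmetric] by simp
    finally show ?thesis .
  qed
  have s: "\<bar>s b' \<sigma>\<bar> \<le> 1" if "\<sigma> \<in> \<Sigma>" "b' \<in> B" for b' \<sigma>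
    unfolding s_def power_abs abs_divide using t0[OF that(1)] B2p by (intro power_le_one) auto
  have approx: "\<bar>\<phi> a \<sigma> * exp ((real (snd a) - real E / 2) * xx \<sigma>) - (\<Sum>b\<in>B. cc b a * s b \<sigma>)\<bar> \<le> \<rho>"
    if \<sigma>: "\<sigma> \<in> \<Sigma>" and a: "a \<in> A" for a \<sigma>
  proof -
    obtain u v w where uvw: "\<sigma> = (u, v, w)" by (cases \<sigma>)
    define y where "y = \<kappa>0 * (z2 \<sigma> - t0)"
    have y: "\<bar>y\<bar> \<le> 0.0064 * K"
    proof -
      have "\<bar>y\<bar> \<le> \<bar>\<kappa>0\<bar> * B2" unfolding y_def abs_mult using t0[OF \<sigma>] by (intro mult_left_mono) auto
      then show ?thesis using \<kappa>0 by simp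
    qed
    have xy: "xa \<sigma> = \<xi>0 + y" using line[OF \<sigma>] by (simp add: y_def)
    have "f a ` {..<I} \<subseteq> B" using Asum(1)[OF a] by (auto simp: f_def B_def)
    then have "(\<Sum>b\<in>B. cc b a * s b \<sigma>) = (\<Sum>x<I. d a x * s (f a x) \<sigma>)"
      unfolding cc_def by (intro sum_regroup fin) auto
    also have "\<dots> = \<phi> a \<sigma> * (exp (t a * \<xi>0) * (\<Sum>n<I. (t a * y) ^ n / fact n))"
      unfolding sum_distrib_left
    proof (rule sum.cong)
      fix n
      let ?z = "real_of_int (z2 \<sigma> - t0)"
      have e: "B2 ^ fst a * (?z / B2) ^ fst a = ?z ^ fst a" "(t a * (\<kappa>0 * B2)) ^ n * (?z / B2) ^ n = (t a * y) ^ n"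
        using B2p by (simp_all add: y_def flip: power_mult_distrib)
      have "d a n * s (f a n) \<sigma> = exp (t a * \<xi>0) * ((B2 ^ fst a * (?z / B2) ^ fst a) * (((t a * (\<kappa>0 * B2)) ^ n * (?z / B2) ^ n) / fact n))"
        unfolding d_def s_def f_def power_add by (simp only: mult_ac times_divide_eq_right times_divide_eq_left)
      then show "d a n * s (f a n) \<sigma> = \<phi> a \<sigma> * (exp (t a * \<xi>0) * ((t a * y) ^ n / fact n))"
        unfolding e by (simp add: \<phi>_def)
    qed simp
    finally have sum: "(\<Sum>b\<in>B. cc b a * s b \<sigma>) = \<phi> a \<sigma> * (exp (t a * \<xi>0) * (\<Sum>n<I. (t a * y) ^ n / fact n))" .
    have ta: "real (snd a) - real E / 2 = t a" by (simp add: t_def)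
    have split: "exp (t a * xa \<sigma>) = exp (t a * \<xi>0) * exp (t a * y)" by (simp add: xy distrib_left exp_add)
    have "\<phi> a \<sigma> * exp ((real (snd a) - real E / 2) * xx \<sigma>) - (\<Sum>b\<in>B. cc b a * s b \<sigma>) =
       \<phi> a \<sigma> * ((exp (t a * xx \<sigma>) - exp (t a * xa \<sigma>)) + exp (t a * \<xi>0) * (exp (t a * y) - (\<Sum>n<I. (t a * y) ^ n / fact n)))"
      unfolding ta sum split by (simp only: right_diff_distrib distrib_left)
    also have "\<bar>\<dots>\<bar> \<le> \<Phi> * (R1 + R2)"
      unfolding abs_mult[of "real_of_int (\<phi> a \<sigma>)"]
    proof (intro mult_mono \<phi> \<sigma> a order.trans[OF abs_triangle_ineq] add_mono)
      have "\<bar>exp (t a * xx \<sigma>) - exp (t a * xa \<sigma>)\<bar> \<le> exp (c * X) * \<bar>t a * xx \<sigma> - t a * xa \<sigma>\<bar>"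
        by (intro abs_exp_diff_le tx xa1 xx1 \<sigma> a)
      also have "t a * xx \<sigma> - t a * xa \<sigma> = t a * (w * Lam)" by (simp add: uvw xa_eq algebra_simps)
      also have "exp (c * X) * \<bar>t a * (w * Lam)\<bar> \<le> R1"
        unfolding R1_def abs_mult[of "t a"] using tc[OF a] c box_w_Lam(1)[of u v w 3] \<sigma> uvw \<Sigma>
        by (intro mult_left_mono mult_mono) auto
      finally show "\<bar>exp (t a * xx \<sigma>) - exp (t a * xa \<sigma>)\<bar> \<le> R1" .
      have "\<bar>exp (t a * \<xi>0) * (exp (t a * y) - (\<Sum>n<I. (t a * y) ^ n / fact n))\<bar> \<le>
        exp (c * (0.0016 * K)) * (exp (c * (0.0064 * K)) * ((c * (0.0064 * K)) ^ I / fact I))"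
        unfolding abs_mult using tx[OF a \<xi>0] by (intro mult_mono exp_taylor_remainder tx a y) auto
      then show "\<bar>exp (t a * \<xi>0) * (exp (t a * y) - (\<Sum>n<I. (t a * y) ^ n / fact n))\<bar> \<le> R2"
        by (simp add: R2_def mult.assoc flip: e8)
    qed (auto simp: \<Phi>_def)
    finally show ?thesis by (simp add: \<rho>_def)
  qed
  have cost: "2 * real E * (\<bar>real_of_int v\<bar> * lam + \<bar>real_of_int w\<bar> * h) + E * \<bar>xx (u, v, w)\<bar> / 2 \<le> \<kappa>" if "(u, v, w) \<in> \<Sigma>" for u v w
  proof -
    have "(u, v, w) \<in> box 3" using that \<Sigma> by blast
    then have "2 * real E * (\<bar>real_of_int v\<bar> * lam + \<bar>real_of_int w\<bar> * h) + E * \<bar>xx (u, v, w)\<bar> / 2 \<le> 2 * (4 * real q) * (0.18 * K) + (4 * real q) * (0.0045 * K) / 2"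
      using lam_pos hh by (intro add_mono mult_mono divide_right_mono) (auto simp: E_def box_def)
    also have "\<dots> \<le> \<kappa>" by (simp add: \<kappa>_def)
    finally show ?thesis .
  qed
  define x where "x = real q * real K"
  have cK: "c * real K \<le> 2 * x" "0 \<le> c * real K" using mult_right_mono[OF c(2), of "real K"] c by (auto simp: x_def)
  have I: "real I = 2 * (x - real K)" using q1 by (simp add: I_def of_nat_diff x_def algebra_simps)
  have qK: "250 * real K \<le> x" unfolding x_def using q1 by (intro mult_right_mono) auto
  have \<beta>: "\<beta> \<le> 0.4 * x" using q(1) mult_right_mono[of "2.5 * b" q "real K"] by (simp add: \<beta>_def x_def)
  have R2: "R2 \<le> exp (c8 - 4 * real I)"
  proof -
    have "c * (0.0064 * K) \<le> 0.0065 * real I" using cK qK by (simp add: I algebra_simps)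
    then show ?thesis unfolding R2_def using power_div_fact_small[of "c * (0.0064 * K)" I] cK by (simp add: exp_diff exp_minus field_simps)
  qed
  have R1: "R1 \<le> 0.48 * q * K * exp (c * X - 6.3 * x)"
  proof -
    have "exp (c * X - 6.3 * x) = exp (c * X) * exp (- 6.3 * x)"
      by (simp only: exp_add[symmetric]) simp
    then show ?thesis by (simp add: R1_def flip: x_def)
  qed
  have "64 * real (card B) * (real (card A))\<^sup>2 * G * Y\<^sup>2 * \<rho> = 64 * real (card B) * M ^ 4 * exp (8 * \<beta> + c8 + 2 * \<kappa>) * (R1 + R2)"
  proof -
    have e: "exp (8 * \<beta> + c8 + 2 * \<kappa>) = exp (2 * \<beta>) ^ 4 * exp c8 * exp \<kappa> ^ 2"
      by (simp add: exp_add flip: exp_of_nat_mult)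
    have gen: "64 * m * M\<^sup>2 * (eb * ec) * (M * eb * ek)\<^sup>2 * (eb * r) = 64 * m * M ^ 4 * (eb ^ 4 * ec * ek ^ 2) * r"
      for m M eb ec ek r :: real by (simp add: eval_nat_numeral)
    show ?thesis unfolding e G_def Y_def \<rho>_def \<Phi>_def M_def[symmetric] exp_add[of "2 * \<beta>" c8] by (rule gen)
  qed
  also have "\<dots> \<le> 1"
  proof -
    define P where "P = 64 * real (card B) * M ^ 4"
    have qK1: "real q \<le> K / 10" "1 \<le> real q" using q_le_K q1 by auto
    have K1': "1 \<le> real K" using K1 by simp
    have "P = 2 ^ 19 * real q ^ 5 * real K ^ 5" unfolding P_def M(1) cB by (simp add: power_mult_distrib eval_nat_numeral)
    also have "\<dots> \<le> 2 ^ 19 * (real K / 10) ^ 5 * real K ^ 5"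
      using qK1 by (intro mult_mono power_mono) auto
    also have "\<dots> \<le> 2 ^ 18 * real K ^ 10" by (simp add: power_divide eval_nat_numeral)
    also have "\<dots> \<le> 2 ^ 18 * real K ^ 15" using K1' by (intro mult_left_mono power_increasing) auto
    finally have P: "P \<le> 2 ^ 18 * real K ^ 15" .
    have P1: "P * (0.48 * q * K) \<le> exp (0.01 * K) / 2"
    proof -
      have "P * (0.48 * q * K) \<le> (2 ^ 18 * real K ^ 15) * (1 * real K * real K)"
        using P qK1 by (intro mult_mono) auto
      also have "\<dots> = 2 ^ 19 * real K ^ 17 / 2" by (simp add: eval_nat_numeral)
      also have "\<dots> \<le> exp (0.01 * K) / 2" by (intro divide_right_mono poly_factor_le_exp K_ge) auto
      finally show ?thesis .
    qed
    have P2: "P \<le> exp (0.01 * K) / 2"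
    proof -
      have "P \<le> 2 ^ 18 * real K ^ 17" using P power_increasing[of 15 17 "real K"] K1' by simp
      then show ?thesis using poly_factor_le_exp[OF K_ge(2)] by simp
    qed
    have xx: "250 * real K \<le> x" "c * real K \<le> 2 * x" "\<beta> \<le> 0.4 * x" "\<kappa> = 1.45 * x" "real I = 2 * (x - real K)"
      "c8 = 0.008 * (c * real K)" "c * X = 0.0048 * (c * real K)"
      using qK cK \<beta> I by (auto simp: x_def \<kappa>_def c8_def X_def)
    have gen: "0.01 * kk + (8 * be + e8 + 2 * ka) + (y - 6.3 * x) \<le> 0" "0.01 * kk + (8 * be + e8 + 2 * ka) + (e8 - 4 * i) \<le> 0"
      if "250 * kk \<le> x" "ck \<le> 2 * x" "be \<le> 0.4 * x" "ka = 1.45 * x" "i = 2 * (x - kk)" "e8 = 0.008 * ck" "y = 0.0048 * ck" "1 \<le> kk" for kk x y be ka i ck e8 :: real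
      using that by simp_all
    \<comment> \<open>The constant 6.3 of the hypothesis on \<open>Lam\<close> comes from here: it
      has to beat \<open>8 * 0.4 + 2 * 1.45 = 6.1\<close> and some small terms.\<close>
    have e1: "0.01 * K + (8 * \<beta> + c8 + 2 * \<kappa>) + (c * X - 6.3 * x) \<le> 0" by (rule gen(1)[OF xx K1'])
    have e2: "0.01 * K + (8 * \<beta> + c8 + 2 * \<kappa>) + (c8 - 4 * real I) \<le> 0" by (rule gen(2)[OF xx K1'])
    have "P * exp (8 * \<beta> + c8 + 2 * \<kappa>) * R1 \<le> P * exp (8 * \<beta> + c8 + 2 * \<kappa>) * (0.48 * q * K * exp (c * X - 6.3 * x))"
      using R1 M by (intro mult_left_mono) (auto simp: P_def)
    also have "\<dots> = (P * (0.48 * q * K)) * (exp (8 * \<beta> + c8 + 2 * \<kappa>) * exp (c * X - 6.3 * x))" by (simp only: mult_ac)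
    also have "\<dots> \<le> exp (0.01 * K) / 2 * (exp (8 * \<beta> + c8 + 2 * \<kappa>) * exp (c * X - 6.3 * x))"
      by (intro mult_right_mono P1) auto
    also have "\<dots> = exp (0.01 * K + (8 * \<beta> + c8 + 2 * \<kappa>) + (c * X - 6.3 * x)) / 2"
      by (simp only: exp_add times_divide_eq_left mult.assoc)
    also have "\<dots> \<le> 1 / 2" using e1 by simp
    finally have 1: "P * exp (8 * \<beta> + c8 + 2 * \<kappa>) * R1 \<le> 1 / 2" .
    have "P * exp (8 * \<beta> + c8 + 2 * \<kappa>) * R2 \<le> exp (0.01 * K) / 2 * exp (8 * \<beta> + c8 + 2 * \<kappa>) * exp (c8 - 4 * real I)"
      using P2 R2 cK(2) c M by (intro mult_mono) (auto simp: P_def R2_def)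
    also have "\<dots> = exp (0.01 * K + (8 * \<beta> + c8 + 2 * \<kappa>) + (c8 - 4 * real I)) / 2"
      by (simp only: exp_add times_divide_eq_left mult.assoc)
    also have "\<dots> \<le> 1 / 2" using e2 by simp
    finally have 2: "P * exp (8 * \<beta> + c8 + 2 * \<kappa>) * R2 \<le> 1 / 2" .
    show ?thesis using 1 2 by (simp add: P_def distrib_left)
  qed
  finally have cond: "64 * real (card B) * (real (card A))\<^sup>2 * G * Y\<^sup>2 * \<rho> \<le> 1" .
  have \<beta>0: "0 \<le> \<beta>" using b by (simp add: \<beta>_def)
  have pos: "1 \<le> G" "1 \<le> \<Phi>" "0 \<le> \<kappa>" using \<beta>0 c by (auto simp: G_def \<Phi>_def \<kappa>_def c8_def)
  show ?thesis
  proof (rule vanishing_combination[where A = A and B = B and c = cc and G = G and \<Sigma> = \<Sigma> and s = s and \<phi> = \<phi>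
      and \<Phi> = \<Phi> and e = snd and E = E and \<rho> = \<rho> and \<kappa> = \<kappa> and Y = Y])
    fix p :: "nat \<times> nat \<Rightarrow> int"
    assume "\<exists>a\<in>A. p a \<noteq> 0" "\<And>\<sigma>. \<sigma> \<in> \<Sigma> \<Longrightarrow> (\<Sum>a\<in>A. p a * \<phi> a \<sigma> * yy \<sigma> ^ snd a) = 0"
    then show thesis using that by (simp add: \<phi>_def)
  qed (fact fin card pos cond | (rule G s \<phi> Asum(2) approx cost, assumption+) | simp add: Y_def M_def)+
qed

end

section \<open>Lattice points, shears and multiplicative independence\<close>

lemma card_int_interval:
  fixes a c X :: real
  assumes a: "a > 0" and X: "X \<ge> 0"
  shows "finite {u :: int. \<bar>u * a + c\<bar> \<le> X}" "2 * X / a - 1 \<le> card {u :: int. \<bar>u * a + c\<bar> \<le> X}"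
    "card {u :: int. \<bar>u * a + c\<bar> \<le> X} \<le> 2 * X / a + 1"
proof -
  define lo hi where "lo = (- X - c) / a" and "hi = (X - c) / a"
  have "\<bar>x * a + c\<bar> \<le> X \<longleftrightarrow> lo \<le> x \<and> x \<le> hi" for x :: real
  proof -
    have "lo \<le> x \<longleftrightarrow> - X \<le> x * a + c" "x \<le> hi \<longleftrightarrow> x * a + c \<le> X"
      unfolding lo_def hi_def pos_divide_le_eq[OF a] pos_le_divide_eq[OF a] by (simp_all add: algebra_simps)
    then show ?thesis unfolding abs_le_iff by (metis minus_le_iff)
  qed
  then have eq: "{u :: int. \<bar>u * a + c\<bar> \<le> X} = {\<lceil>lo\<rceil>..\<lfloor>hi\<rfloor>}"
    by (simp add: Collect_conj_eq ceiling_le_iff le_floor_iff atLeastAtMost_def atLeast_def atMost_def)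
  have d: "hi - lo = 2 * X / a" by (simp add: hi_def lo_def flip: diff_divide_distrib)
  have nn: "2 * X / a \<ge> 0" using a X by simp
  show "finite {u :: int. \<bar>u * a + c\<bar> \<le> X}" unfolding eq by simp
  have card: "real (card {\<lceil>lo\<rceil>..\<lfloor>hi\<rfloor>}) = max 0 (\<lfloor>hi\<rfloor> - \<lceil>lo\<rceil> + 1)" by simp
  have fl: "hi - 1 < \<lfloor>hi\<rfloor>" "\<lfloor>hi\<rfloor> \<le> hi" "lo \<le> \<lceil>lo\<rceil>" "\<lceil>lo\<rceil> < lo + 1" by linarith+
  show "2 * X / a - 1 \<le> card {u :: int. \<bar>u * a + c\<bar> \<le> X}"
    unfolding eq card d[symmetric] using fl by linarith
  show "card {u :: int. \<bar>u * a + c\<bar> \<le> X} \<le> 2 * X / a + 1"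
    unfolding eq card d[symmetric] using fl nn d by linarith
qed

text \<open>Each pair of points with different \<open>f\<close> excludes a single slope
  \<open>\<tau>\<close>, so only finitely many are excluded.\<close>

lemma exists_injective_shear:
  fixes f g :: "'a \<Rightarrow> real"
  assumes fin: "finite S" and inj: "inj_on (\<lambda>x. (f x, g x)) S"
  obtains \<tau> :: real where "inj_on (\<lambda>x. g x + \<tau> * f x) S"
proof -
  define bad where "bad = (\<lambda>(x, y). (g y - g x) / (f x - f y)) ` (S \<times> S)"
  have "finite bad" using fin by (simp add: bad_def)
  then obtain \<tau> where \<tau>: "\<tau> \<notin> bad" using ex_new_if_finite[OF infinite_UNIV_char_0] by blast
  have "inj_on (\<lambda>x. g x + \<tau> * f x) S"
  proof (rule inj_onI)
    fix x y assume xy: "x \<in> S" "y \<in> S" and eq: "g x + \<tau> * f x = g y + \<tau> * f y"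
    have "f x = f y"
    proof (rule ccontr)
      assume "f x \<noteq> f y"
      then have "\<tau> = (g y - g x) / (f x - f y)" using eq by (simp add: field_simps)
      then have "\<tau> \<in> bad" using xy by (auto simp: bad_def)
      then show False using \<tau> by simp
    qed
    then show "x = y" using eq inj xy by (auto simp: inj_on_def)
  qed
  then show ?thesis by (rule that)
qed

lemma conj_int_sym:
  assumes "conj_int x y" shows "conj_int y x"
proof -
  obtain a b :: int where ab: "x = of_int a + of_int b * golden" "y = of_int a + of_int b * golden'"
    using assms by (auto simp: conj_int_def)
  have g': "golden' = 1 - golden" using golden_add by simp
  have "y = of_int (a + b) + of_int (- b) * golden" "x = of_int (a + b) + of_int (- b) * golden'"
    unfolding ab g' by (simp_all add: algebra_simps)
  then show ?thesis unfolding conj_int_def by blast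
qed

context linear_form
begin

lemma xx_add: "xx (\<sigma> + \<sigma>') = xx \<sigma> + xx \<sigma>'" and xx_diff: "xx (\<sigma> - \<sigma>') = xx \<sigma> - xx \<sigma>'"
  and z1_add: "z1 (\<sigma> + \<sigma>') = z1 \<sigma> + z1 \<sigma>'" and z1_diff: "z1 (\<sigma> - \<sigma>') = z1 \<sigma> - z1 \<sigma>'"
  and z2_add: "z2 (\<sigma> + \<sigma>') = z2 \<sigma> + z2 \<sigma>'" and z2_diff: "z2 (\<sigma> - \<sigma>') = z2 \<sigma> - z2 \<sigma>'"
  by (cases \<sigma>; cases \<sigma>'; simp add: xx_def z1_def z2_def algebra_simps)+

lemma xa_add: "xa (\<sigma> + \<sigma>') = xa \<sigma> + xa \<sigma>'" and xa_diff: "xa (\<sigma> - \<sigma>') = xa \<sigma> - xa \<sigma>'"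
  by (simp_all add: xa_def z1_add z1_diff z2_add z2_diff algebra_simps)

lemma yy_add: "yy (\<sigma> + \<sigma>') = yy \<sigma> * yy \<sigma>'" and yy_diff: "yy (\<sigma> - \<sigma>') = yy \<sigma> / yy \<sigma>'"
  by (simp_all add: xx_add xx_diff exp_add exp_diff flip: exp_xx)

lemma yy_pos: "yy \<sigma> > 0" by (simp flip: exp_xx)

text \<open>Conjugation keeps the power of \<open>g\<close> and replaces \<open>golden\<close> by
  \<open>golden'\<close>, whose absolute value is \<open>1 / golden\<close>; comparing the two
  relations gives \<open>golden powi (u + u) = 1\<close>.\<close>

lemma golden_g_independent:
  fixes u v :: int
  assumes "golden powi u * real g powi v = 1"
  shows "u = 0" "v = 0"
proof -
  have gg: "golden > 1" using golden_bounds by simp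
  have g0: "real g > 1" using g by simp
  define m n where "m = real g ^ nat (- v)" and "n = real g ^ nat v"
  have mn: "m > 0" "n > 0" using g0 by (simp_all add: m_def n_def)
  have "real g powi v * m = n" by (cases "v \<ge> 0") (use g0 in \<open>auto simp: m_def n_def power_int_def power_inverse field_simps\<close>)
  then have eq: "golden powi u * n = m" using assms by (metis mult.assoc mult_1)
  have "conj_int (real (g ^ j)) (real (g ^ j))" for j using conj_int_of_int[of "int (g ^ j)"] by simp
  then have cj: "conj_int m m" "conj_int n n" by (simp_all add: m_def n_def)
  have "conj_int (golden powi u * n + (-1) * m) (golden' powi u * n + (-1) * m)"
    using conj_int_of_int[of "-1"] by (intro conj_int_add conj_int_mult conj_int_golden_powi cj) simp
  then have c2: "conj_int (golden' powi u * n + (-1) * m) (golden powi u * n + (-1) * m)" by (rule conj_int_sym)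
  \<comment> \<open>If the conjugate of a vanishing number were nonzero, the norm inequality with
    the conjugates exchanged would read \<open>0 \<ge> 1\<close>.\<close>
  have eq': "golden' powi u * n = m"
    using conj_int_norm_ge_1[OF c2] eq by fastforce
  have "golden powi u = golden' powi u" using eq eq' mn by (metis mult_right_cancel less_irrefl)
  then have "\<bar>golden\<bar> powi u = \<bar>golden'\<bar> powi u" by (simp flip: power_int_abs)
  moreover have "\<bar>golden'\<bar> = inverse golden" using golden_mult golden_bounds gg by (simp add: field_simps abs_if)
  ultimately have "golden powi u * golden powi u = 1" using gg by (simp add: power_int_inverse field_simps)
  moreover have "golden powi (u + u) = golden powi u * golden powi u" by (rule power_int_add) (use gg in auto)
  ultimately have "golden powi (u + u) = 1" by simp
  then have "exp (of_int (u + u) * ln golden) = 1" using gg by (simp add: powi_eq_exp)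
  then show u: "u = 0" using gg by simp
  then have "exp (of_int v * ln (real g)) = 1" using assms g0 by (simp add: powi_eq_exp)
  then show "v = 0" using g0 by simp
qed

end

context parameters
begin

text \<open>It bounds the degree of the eliminated polynomial in both stages: \<open>8 * q\<close>
  translates of degree \<open>K\<close> in the plane, \<open>4 * q\<close> translates of degree
  \<open>2 * K\<close> on the line.\<close>

definition "deg = 8 * q * K"

text \<open>\<open>core\<close> plus \<open>shifts\<close> plus the steps \<open>(j, 0, 0)\<close>
  of the elimination must fit into \<open>box 1\<close>, which explains the bounds for
  \<open>v\<close> and \<open>xx\<close> slightly below those of \<open>box\<close>. The shifts need
  only outnumber \<open>deg\<close>, for which two free coordinates suffice; \<open>w = 0\<close>
  leaves the whole range of \<open>w\<close> to \<open>core\<close>.\<close>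

definition core :: "(int \<times> int \<times> int) set" where
  "core = {(u, v, w). \<bar>v\<bar> * lam \<le> 0.0294 * K \<and> \<bar>w\<bar> * h \<le> 0.03 * K \<and> \<bar>xx (u, v, w)\<bar> \<le> 0.00147 * K}"

definition shifts :: "(int \<times> int \<times> int) set" where
  "shifts = {(u, v, w). \<bar>v\<bar> * lam \<le> 0.0005 * K \<and> w = 0 \<and> \<bar>xx (u, v, w)\<bar> \<le> 0.00001 * K}"

lemma scales: "3.2 * 10 ^ 11 \<le> K / lam" "3.2 * 10 ^ 7 * b\<^sup>2 \<le> K / lam" "2 * 10 ^ 11 \<le> K / h" "4 * 10 ^ 11 \<le> K / gam"
  "4 * 10 ^ 7 * b\<^sup>2 \<le> K / lam / h" "K / lam \<le> 4.0001 * 10 ^ 7 * h * b\<^sup>2"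
proof -
  have b2: "10 ^ 4 \<le> b\<^sup>2" using power_mono[of 100 b 2] b by simp
  show 5: "4 * 10 ^ 7 * b\<^sup>2 \<le> K / lam / h" using K lam_ge hh by (simp add: field_simps)
  have kl: "4 * 10 ^ 7 * b\<^sup>2 * h \<le> K / lam" using mult_right_mono[OF 5, of h] hh by simp
  have "4 * 10 ^ 7 * b\<^sup>2 * 0.8 \<le> 4 * 10 ^ 7 * b\<^sup>2 * h" using hh by (intro mult_left_mono) auto
  moreover have "4 * 10 ^ 7 * b\<^sup>2 * 0.8 = 3.2 * 10 ^ 7 * b\<^sup>2" by simp
  ultimately show 2: "3.2 * 10 ^ 7 * b\<^sup>2 \<le> K / lam" using kl by linarith
  then show "3.2 * 10 ^ 11 \<le> K / lam" using b2 by simp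
  have "4 * 10 ^ 7 * b\<^sup>2 * lam \<le> K / h" using K(1) hh by (simp add: field_simps)
  moreover have "4 * 10 ^ 7 * b\<^sup>2 * (2 / 3) \<le> 4 * 10 ^ 7 * b\<^sup>2 * lam" using lam_ge by (intro mult_left_mono) auto
  moreover have "2 * 10 ^ 11 \<le> 4 * 10 ^ 7 * b\<^sup>2 * (2 / 3)" using b2 by simp
  ultimately show "2 * 10 ^ 11 \<le> K / h" by linarith
  have "real K / 0.485 \<le> K / gam" using gam_bounds by (intro divide_left_mono) auto
  moreover have "2 * 10 ^ 11 / 0.485 \<le> real K / 0.485" using K_ge(1) b2 by (intro divide_right_mono) auto
  moreover have "4 * 10 ^ 11 \<le> 2 * 10 ^ 11 / (0.485 :: real)" by simp
  ultimately show "4 * 10 ^ 11 \<le> K / gam" by linarith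
  show "K / lam \<le> 4.0001 * 10 ^ 7 * h * b\<^sup>2" using K(2) lam_ge by (simp add: field_simps)
qed

text \<open>The bound on \<open>xx\<close> is no product condition, but for fixed
  \<open>(v, w)\<close> it confines \<open>u\<close> to an interval of length
  \<open>2 * X / gam\<close>, so the count is made fibrewise.\<close>

lemma card_slab:
  fixes Sv Sw X :: real
  assumes "0 \<le> Sv" "0 \<le> Sw" "0 \<le> X"
  defines "S \<equiv> {(u, v, w). \<bar>real_of_int v\<bar> * lam \<le> Sv \<and> \<bar>real_of_int w\<bar> * h \<le> Sw \<and> \<bar>xx (u, v, w)\<bar> \<le> X}"
  assumes pos: "1 \<le> 2 * Sv / lam" "1 \<le> 2 * Sw / h" "1 \<le> 2 * X / gam"
  shows "finite S" "(2 * Sv / lam - 1) * (2 * Sw / h - 1) * (2 * X / gam - 1) \<le> card S"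
proof -
  define Vs where "Vs = {v :: int. \<bar>v * lam + 0\<bar> \<le> Sv}"
  define Ws where "Ws = {w :: int. \<bar>w * h + 0\<bar> \<le> Sw}"
  define Us where "Us = (\<lambda>(v :: int, w :: int). {u :: int. \<bar>u * gam + (v * lam + w * ln eta)\<bar> \<le> X})"
  have h0: "h > 0" using hh by simp
  have S: "S = (\<lambda>((v, w), u). (u, v, w)) ` (Sigma (Vs \<times> Ws) Us)"
    using lam_pos h0 by (auto simp: S_def Vs_def Ws_def Us_def xx_def abs_mult add.assoc image_iff)
  have inj: "inj_on (\<lambda>((v, w), u). (u, v, w)) (Sigma (Vs \<times> Ws) Us)" by (auto simp: inj_on_def)
  have V: "finite Vs" "2 * Sv / lam - 1 \<le> card Vs" unfolding Vs_def by (rule card_int_interval; use lam_pos assms in simp)+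
  have W: "finite Ws" "2 * Sw / h - 1 \<le> card Ws" unfolding Ws_def by (rule card_int_interval; use h0 assms in simp)+
  have U: "finite (Us vw)" "2 * X / gam - 1 \<le> card (Us vw)" for vw
    unfolding Us_def by (cases vw; simp; rule card_int_interval; use gam_pos assms in simp)+
  show "finite S" unfolding S using V W U by (intro finite_imageI finite_SigmaI) auto
  have "(2 * Sv / lam - 1) * (2 * Sw / h - 1) * (2 * X / gam - 1) \<le> real (card Vs) * real (card Ws) * (2 * X / gam - 1)"
    using V W pos by (intro mult_mono mult_right_mono) auto
  also have "\<dots> = (\<Sum>vw\<in>Vs \<times> Ws. 2 * X / gam - 1)" using V W by (simp add: card_cartesian_product)
  also have "\<dots> \<le> (\<Sum>vw\<in>Vs \<times> Ws. real (card (Us vw)))" by (intro sum_mono U)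
  also have "\<dots> = card S" unfolding S card_image[OF inj] using V W U by (simp add: card_SigmaI)
  finally show "(2 * Sv / lam - 1) * (2 * Sw / h - 1) * (2 * X / gam - 1) \<le> card S" .
qed

text \<open>This inequality fixes the size of \<open>K\<close>: the left side is at most about
  \<open>807 * b ^ 2 * K ^ 2\<close>, the number of points at least about
  \<open>1.03 / 10 ^ 5 * K ^ 3 / (lam * h * gam)\<close>, and the constant \<open>4 * 10 ^ 7\<close>
  in the choice of \<open>K\<close> just makes the latter larger.\<close>

lemma core: "finite core" "2 * deg * deg < card core"
proof -
  have s: "core = {(u, v, w). \<bar>real_of_int v\<bar> * lam \<le> 0.0294 * K \<and> \<bar>real_of_int w\<bar> * h \<le> 0.03 * K \<and> \<bar>xx (u, v, w)\<bar> \<le> 0.00147 * K}"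
    by (simp add: core_def)
  have p: "1 \<le> 2 * (0.0294 * K) / lam" "1 \<le> 2 * (0.03 * K) / h" "1 \<le> 2 * (0.00147 * K) / gam"
    using scales by simp_all
  note c = card_slab[OF _ _ _ p, folded s]
  show "finite core" by (rule c(1)) auto
  have b2: "0 < b\<^sup>2" using b by simp
  have Kp: "0 < real K" using K_ge(2) by simp
  have "2 * real deg * real deg = 128 * (real q * real q) * (real K * real K)" by (simp add: deg_def)
  also have "\<dots> \<le> 128 * ((2.51 * b) * (2.51 * b)) * (real K * real K)"
    using q q_ge by (intro mult_left_mono mult_right_mono mult_mono) auto
  also have "\<dots> = 806.4128 * (b\<^sup>2 * (real K * real K))" by (simp add: power2_eq_square)
  also have "\<dots> < 852 * (b\<^sup>2 * (real K * real K))"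
    using mult_pos_pos[OF b2 mult_pos_pos[OF Kp Kp]] by (intro mult_strict_right_mono) auto
  also have "\<dots> = 2.13 / 10 ^ 5 * (4 * 10 ^ 7 * b\<^sup>2 * (real K * real K))" by simp
  also have "\<dots> \<le> 2.13 / 10 ^ 5 * (K / lam / h * (real K * real K))"
    using scales(5) by (intro mult_left_mono mult_right_mono) auto
  also have "\<dots> = 2.13 / 10 ^ 5 * ((K / lam) * (K / h) * K)" by simp
  also have "\<dots> \<le> 2.13 / 10 ^ 5 * ((K / lam) * (K / h) * (0.485 * (K / gam)))"
  proof -
    have "real K * gam \<le> real K * 0.485" using gam_bounds by (intro mult_left_mono) auto
    then have "real K \<le> 0.485 * (K / gam)" using gam_pos by (simp add: field_simps)
    then show ?thesis using lam_pos hh by (intro mult_left_mono) auto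
  qed
  also have "\<dots> = (2.13 / 10 ^ 5 * 0.485) * ((K / lam) * (K / h) * (K / gam))" by simp
  also have "\<dots> \<le> (0.0587 * 0.0599 * 0.002939) * ((K / lam) * (K / h) * (K / gam))"
    using lam_pos hh gam_pos by (intro mult_right_mono) auto
  also have "\<dots> = (0.0587 * (K / lam)) * (0.0599 * (K / h)) * (0.002939 * (K / gam))" by simp
  also have "\<dots> \<le> (2 * (0.0294 * K) / lam - 1) * (2 * (0.03 * K) / h - 1) * (2 * (0.00147 * K) / gam - 1)"
  proof -
    have "0.0587 * A \<le> 2 * (0.0294 * A) - 1" "0.0599 * B \<le> 2 * (0.03 * B) - 1" "0.002939 * C \<le> 2 * (0.00147 * C) - 1"
      "0 \<le> 0.0587 * A" "0 \<le> 0.0599 * B" "0 \<le> 0.002939 * C"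
      if "3.2 * 10 ^ 11 \<le> A" "2 * 10 ^ 11 \<le> B" "4 * 10 ^ 11 \<le> C" for A B C :: real
      using that by simp_all
    note l = this[OF scales(1) scales(3) scales(4)]
    have "(0.0587 * (K / lam)) * (0.0599 * (K / h)) * (0.002939 * (K / gam)) \<le>
      (2 * (0.0294 * (K / lam)) - 1) * (2 * (0.03 * (K / h)) - 1) * (2 * (0.00147 * (K / gam)) - 1)"
      by (rule mult_mono[OF mult_mono[OF l(1) l(2) _ l(5)] l(3) _ l(6)])
         (rule order.trans[OF l(4) l(1)], rule mult_nonneg_nonneg[OF order.trans[OF l(4) l(1)] order.trans[OF l(5) l(2)]])
    then show ?thesis by (simp only: times_divide_eq_right)
  qed
  also have "\<dots> \<le> card core" by (rule c(2)) auto
  finally have "real (2 * deg * deg) < real (card core)" by simp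
  then show "2 * deg * deg < card core" by (simp only: of_nat_less_iff)
qed

lemma shifts: "finite shifts" "deg < card shifts" "0 \<in> shifts"
proof -
  \<comment> \<open>The condition \<open>w = 0\<close> is disguised as
    \<open>\<bar>w\<bar> * h \<le> 0.99 * h\<close>, so that \<open>card_slab\<close> applies; its
    factor for \<open>w\<close> is then \<open>2 * 0.99 - 1\<close>.\<close>
  define S where "S = {(u, v, w). \<bar>real_of_int v\<bar> * lam \<le> 0.0005 * K \<and> \<bar>real_of_int w\<bar> * h \<le> 0.99 * h \<and> \<bar>xx (u, v, w)\<bar> \<le> 0.00001 * K}"
  have h0: "h > 0" using hh by simp
  have "\<bar>real_of_int w\<bar> * h \<le> 0.99 * h \<longleftrightarrow> w = 0" for w :: int
  proof -
    have "\<bar>real_of_int w\<bar> * h \<le> 0.99 * h \<longleftrightarrow> \<bar>real_of_int w\<bar> \<le> 0.99" using h0 by (rule mult_le_cancel_right_pos)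
    also have "\<dots> \<longleftrightarrow> w = 0" by (simp, linarith)
    finally show ?thesis .
  qed
  then have s: "S = shifts" by (auto simp: S_def shifts_def)
  have p: "1 \<le> 2 * (0.0005 * K) / lam" "1 \<le> 2 * (0.99 * h) / h" "1 \<le> 2 * (0.00001 * K) / gam"
    using scales h0 by simp_all
  note c = card_slab[OF _ _ _ p, folded S_def, unfolded s]
  show "finite shifts" by (rule c(1)) (use h0 in auto)
  have Kp: "0 < real K" using K_ge(2) by simp
  have "real deg = 8 * real q * K" by (simp add: deg_def)
  also have "\<dots> \<le> 8 * (2.51 * b) * K" using q by (intro mult_right_mono) auto
  also have "\<dots> < 1.2 * (100 * b) * K" using b Kp by simp
  also have "\<dots> \<le> 1.2 * b\<^sup>2 * K" using b by (intro mult_right_mono) (auto simp: power2_eq_square)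
  also have "\<dots> \<le> 3.9 / 10 ^ 8 * (3.2 * 10 ^ 7 * b\<^sup>2) * K" using Kp by simp
  also have "\<dots> \<le> 3.9 / 10 ^ 8 * (K / lam) * K" using scales(2) by (intro mult_right_mono mult_left_mono) auto
  also have "\<dots> \<le> 3.9 / 10 ^ 8 * (K / lam) * (0.485 * (K / gam))"
  proof -
    have "real K * gam \<le> real K * 0.485" using gam_bounds by (intro mult_left_mono) auto
    then have "real K \<le> 0.485 * (K / gam)" using gam_pos by (simp add: field_simps)
    then show ?thesis using lam_pos by (intro mult_left_mono) auto
  qed
  also have "\<dots> = (3.9 / 10 ^ 8 * 0.485) * ((K / lam) * (K / gam))" by simp
  also have "\<dots> \<le> (0.00099 * 0.98 * 0.0000199) * ((K / lam) * (K / gam))"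
    using lam_pos gam_pos by (intro mult_right_mono) auto
  also have "\<dots> = (0.00099 * (K / lam)) * 0.98 * (0.0000199 * (K / gam))" by simp
  also have "\<dots> \<le> (2 * (0.0005 * K) / lam - 1) * (2 * (0.99 * h) / h - 1) * (2 * (0.00001 * K) / gam - 1)"
  proof -
    have "0.00099 * A \<le> 2 * (0.0005 * A) - 1" "0.0000199 * C \<le> 2 * (0.00001 * C) - 1"
      "0 \<le> 0.00099 * A" "0 \<le> 0.0000199 * C"
      if "3.2 * 10 ^ 11 \<le> A" "4 * 10 ^ 11 \<le> C" for A C :: real
      using that by simp_all
    note l = this[OF scales(1) scales(4)]
    have "(0.00099 * (K / lam)) * 0.98 * (0.0000199 * (K / gam)) \<le>
      (2 * (0.0005 * (K / lam)) - 1) * 0.98 * (2 * (0.00001 * (K / gam)) - 1)"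
      by (rule mult_mono[OF mult_right_mono[OF l(1)] l(2) _ l(4)])
         (simp, rule mult_nonneg_nonneg[OF order.trans[OF l(3) l(1)]], simp)
    moreover have "2 * (0.99 * h) / h - 1 = 0.98" using h0 by simp
    ultimately show ?thesis by (simp only: times_divide_eq_right)
  qed
  also have "\<dots> \<le> card shifts" by (rule c(2)) (use h0 in auto)
  finally show "deg < card shifts" by simp
  show "0 \<in> shifts" by (simp add: shifts_def zero_prod_def xx_def)
qed

end

section \<open>Polynomials under a shear of the plane\<close>

lemma swap_vars_add: "swap_vars (p + q) = swap_vars p + swap_vars q"
  and swap_vars_power: "swap_vars (p ^ n) = swap_vars p ^ n"
  by (rule ev2_eqI, simp)+

lemma swap_vars_sum: "swap_vars (sum f A) = (\<Sum>x\<in>A. swap_vars (f x))"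
  by (induction A rule: infinite_finite_induct) (auto simp: swap_vars_add)

lemma ideg_const: "ideg [:[:c:]:] = 0"
  using ideg_le_iff[of "[:[:c:]:]" 0] by (auto simp: coeff_pCons split: nat.split)

lemma degree_power_le': "degree (p ^ n) \<le> n * degree p"
  using degree_power_le[of p n] by (simp add: mult.commute)

text \<open>The coefficients of a polynomial in \<open>z1, z2\<close>, rewritten in the variables \<open>z1, z2 + \<tau> z1\<close>: for a suitable shear \<open>\<tau>\<close>
  the second variable separates the points, as the zero estimate requires.\<close>
definition sheared_poly :: "real \<Rightarrow> (nat \<times> nat) set \<Rightarrow> (nat \<times> nat \<Rightarrow> int) \<Rightarrow> real poly poly" where
  "sheared_poly \<tau> T p = (\<Sum>k\<in>T. [:[:of_int (p k):]:] * [:0, 1:] ^ fst k * [:[:0, 1:], [:-\<tau>:]:] ^ snd k)"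

lemma ev2_sheared_poly:
  "ev2 (sheared_poly \<tau> T p) a b = (\<Sum>k\<in>T. of_int (p k) * a ^ fst k * (b - \<tau> * a) ^ snd k)"
proof -
  have e: "ev2 [:0, 1:] a b = a" "ev2 [:[:0, 1:], [:-\<tau>:]:] a b = b - \<tau> * a" "ev2 [:[:c:]:] a b = c" for c
    by (simp_all add: ev2_def)
  show ?thesis unfolding sheared_poly_def ev2_sum ev2_mult ev2_power e ..
qed

text \<open>A shear mixes the variables and respects only the total degree; this is why the
  exponents in the plane range over a triangle and not over a square.\<close>

lemma degree_sheared_poly:
  assumes "finite T" "\<And>k. k \<in> T \<Longrightarrow> fst k + snd k \<le> n"
  shows "degree (sheared_poly \<tau> T p) \<le> n" "ideg (sheared_poly \<tau> T p) \<le> n"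
proof -
  show "degree (sheared_poly \<tau> T p) \<le> n" unfolding sheared_poly_def
  proof (rule degree_sum_le[OF assms(1)])
    fix k assume k: "k \<in> T"
    have "degree [:[:of_int (p k):] :: real poly:] \<le> 0" by simp
    moreover have "degree ([:0, 1 :: real poly:] ^ fst k) \<le> fst k * 1"
      by (rule order.trans[OF degree_power_le']) auto
    moreover have "degree ([:[:0, 1:], [:-\<tau>:]:] ^ snd k) \<le> snd k * 1"
      by (rule order.trans[OF degree_power_le'], rule mult_left_mono) (auto intro: order.trans[OF degree_pCons_le])
    ultimately have "degree ([:[:of_int (p k):]:] * [:0, 1:] ^ fst k * [:[:0, 1:], [:-\<tau>:]:] ^ snd k) \<le> 0 + fst k * 1 + snd k * 1"
      by (intro order.trans[OF degree_mult_le] add_mono)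
    then show "degree ([:[:of_int (p k):]:] * [:0, 1:] ^ fst k * [:[:0, 1:], [:-\<tau>:]:] ^ snd k) \<le> n"
      using assms(2)[OF k] by simp
  qed
  show "ideg (sheared_poly \<tau> T p) \<le> n" unfolding sheared_poly_def swap_vars_sum
  proof (rule degree_sum_le[OF assms(1)])
    fix k assume k: "k \<in> T"
    have z: "ideg [:0, 1 :: real poly:] \<le> 0" "ideg [:[:0, 1:], [:-\<tau>:]:] \<le> 1"
      unfolding ideg_le_iff by (auto simp: coeff_pCons split: nat.split)
    have "degree (swap_vars [:0, 1 :: real poly:] ^ fst k) \<le> fst k * 0"
      by (rule order.trans[OF degree_power_le'], rule mult_left_mono[OF z(1)]) simp
    moreover have "degree (swap_vars [:[:0, 1:], [:-\<tau>:]:] ^ snd k) \<le> snd k * 1"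
      by (rule order.trans[OF degree_power_le'], rule mult_left_mono[OF z(2)]) simp
    moreover have "ideg [:[:of_int (p k):]:] \<le> 0" using ideg_const by simp
    ultimately have "ideg ([:[:of_int (p k):]:] * [:0, 1:] ^ fst k * [:[:0, 1:], [:-\<tau>:]:] ^ snd k) \<le> 0 + fst k * 0 + snd k * 1"
      unfolding swap_vars_mult swap_vars_power by (intro order.trans[OF degree_mult_le] add_mono)
    then show "ideg ([:[:of_int (p k):]:] * [:0, 1:] ^ fst k * [:[:0, 1:], [:-\<tau>:]:] ^ snd k) \<le> n"
      using assms(2)[OF k] by simp
  qed
qed

text \<open>Evaluation at \<open>b + \<tau> * a\<close> undoes the shear and leaves the independent
  monomials themselves.\<close>

lemma sheared_poly_nonzero:
  assumes "finite T" "k \<in> T" "p k \<noteq> 0"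
  shows "sheared_poly \<tau> T p \<noteq> 0"
proof
  assume *: "sheared_poly \<tau> T p = 0"
  define W where "W = (\<Sum>k\<in>T. monom (monom (real_of_int (p k)) (snd k)) (fst k))"
  have "W = 0"
  proof (rule ev2_eqI)
    fix a b
    have "ev2 W a b = ev2 (sheared_poly \<tau> T p) a (b + \<tau> * a)"
      by (simp add: W_def ev2_sum ev2_monom poly_monom ev2_sheared_poly mult_ac)
    then show "ev2 W a b = ev2 0 a b" by (simp add: *)
  qed
  have "coeff (coeff W (fst k)) (snd k) = (\<Sum>k'\<in>T. if k' = k then real_of_int (p k) else 0)"
    unfolding W_def coeff_sum by (intro sum.cong) (auto simp: prod_eq_iff)
  then show False using \<open>W = 0\<close> assms by simp
qed

section \<open>A line through many points\<close>

context parameters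
begin

text \<open>Equal \<open>z2\<close> makes \<open>v - v'\<close> a multiple of \<open>N\<close>, but
  \<open>N\<close> exceeds the width of \<open>core\<close> in \<open>v\<close>. So the plane
  coordinates separate the points, although three integers are projected to two.\<close>

lemma z2_inj:
  assumes "(u, v, w) \<in> core" "(u', v', w') \<in> core" "z2 (u, v, w) = z2 (u', v', w')"
  shows "v = v'" "w = w'"
proof -
  have "\<bar>real_of_int (v - v')\<bar> * lam \<le> 0.0588 * K"
  proof -
    have "\<bar>real_of_int (v - v')\<bar> * lam \<le> (\<bar>real_of_int v\<bar> + \<bar>real_of_int v'\<bar>) * lam"
      using lam_pos by (intro mult_right_mono) auto
    also have "\<dots> \<le> 0.0294 * K + 0.0294 * K" unfolding distrib_right
      using assms by (intro add_mono) (auto simp: core_def)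
    finally show ?thesis by simp
  qed
  then have "\<bar>real_of_int (v - v')\<bar> \<le> 0.0588 * (K / lam)" using lam_pos by (simp add: field_simps)
  also have "\<dots> \<le> 0.0588 * (4.0001 * 10 ^ 7 * h * b\<^sup>2)" using scales by (intro mult_left_mono) auto
  also have "\<dots> < 10 ^ 7 * h * b\<^sup>2" using hh b by simp
  also have "\<dots> \<le> N" by (rule N)
  finally have lt: "\<bar>v - v'\<bar> < int N" by linarith
  have eq: "v - v' = int N * (w - w')" using assms(3) by (simp add: z2_def algebra_simps)
  have "w - w' = 0"
  proof (rule ccontr)
    assume "w - w' \<noteq> 0"
    then have "int N * 1 \<le> int N * \<bar>w - w'\<bar>" by (intro mult_left_mono) auto
    also have "\<dots> = \<bar>v - v'\<bar>" by (simp add: eq abs_mult)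
    finally show False using lt by simp
  qed
  then show "w = w'" "v = v'" using eq by auto
qed

lemma core_inj: "inj_on (\<lambda>\<sigma>. (real_of_int (z1 \<sigma>), real_of_int (z2 \<sigma>))) core"
proof (rule inj_onI)
  fix \<sigma> \<sigma>' assume *: "\<sigma> \<in> core" "\<sigma>' \<in> core" "(real_of_int (z1 \<sigma>), real_of_int (z2 \<sigma>)) = (real_of_int (z1 \<sigma>'), real_of_int (z2 \<sigma>'))"
  obtain u v w u' v' w' where \<sigma>: "\<sigma> = (u, v, w)" "\<sigma>' = (u', v', w')" by (cases \<sigma>; cases \<sigma>')
  then have "v = v'" "w = w'" using z2_inj[of u v w u' v' w'] * by auto
  then show "\<sigma> = \<sigma>'" using * \<sigma> by (simp add: z1_def)
qed

lemma box_sum: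
  assumes "\<sigma> \<in> core" "\<rho> \<in> shifts" "j < 8 * q"
  shows "\<sigma> + \<rho> + (int j, 0, 0) \<in> box 1"
proof -
  obtain u v w u' v' w' where \<sigma>: "\<sigma> = (u, v, w)" "\<rho> = (u', v', w')" by (cases \<sigma>; cases \<rho>)
  have "b * 100 \<le> b\<^sup>2" using b by (simp add: power2_eq_square)
  have "real j * gam \<le> (8 * q) * 0.485" using assms(3) gam_bounds by (intro mult_mono) auto
  also have "\<dots> \<le> 9.8 * b" using q by simp
  also have "\<dots> \<le> 0.00001 * (2 * 10 ^ 7 * b\<^sup>2)" using \<open>b * 100 \<le> b\<^sup>2\<close> b by simp
  also have "\<dots> \<le> 0.00001 * K" using K_ge(1) by (intro mult_left_mono) auto
  finally have j: "real j * gam \<le> 0.00001 * K" .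
  have "\<bar>xx (\<sigma> + \<rho> + (int j, 0, 0))\<bar> \<le> \<bar>xx \<sigma>\<bar> + \<bar>xx \<rho>\<bar> + \<bar>xx (int j, 0, 0)\<bar>"
    unfolding xx_add by linarith
  also have "xx (int j, 0, 0) = real j * gam" by (simp add: xx_def)
  also have "\<bar>xx \<sigma>\<bar> + \<bar>xx \<rho>\<bar> + \<bar>real j * gam\<bar> \<le> 0.00147 * K + 0.00001 * K + 0.00001 * K"
    using assms j gam_pos unfolding \<sigma> by (intro add_mono) (auto simp: core_def shifts_def)
  also have "\<dots> \<le> 0.0015 * K" by simp
  finally have x: "\<bar>xx (\<sigma> + \<rho> + (int j, 0, 0))\<bar> \<le> 0.0015 * K" .
  have "\<bar>real_of_int (v + v')\<bar> * lam \<le> (\<bar>real_of_int v\<bar> + \<bar>real_of_int v'\<bar>) * lam"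
    using lam_pos by (intro mult_right_mono) auto
  also have "\<dots> \<le> 0.0294 * K + 0.0005 * K" unfolding distrib_right
    using assms \<sigma> by (intro add_mono) (auto simp: core_def shifts_def)
  also have "\<dots> \<le> 0.03 * K" by simp
  finally have v: "\<bar>real_of_int (v + v')\<bar> * lam \<le> 0.03 * K" .
  show ?thesis using x v assms unfolding \<sigma> by (simp add: box_def core_def shifts_def)
qed

text \<open>If no line carried more than \<open>deg\<close> points of \<open>core\<close>, the zero
  estimate with \<open>F = deg\<close> would give
  \<open>card core \<le> 2 * deg * deg\<close>.\<close>

lemma exists_rich_line:
  obtains \<tau> \<delta>1 \<delta>2 s1 s2 :: real where "(\<delta>1, \<delta>2) \<noteq> (0, 0)"
    "deg < card {\<sigma> \<in> core. \<exists>t. z1 \<sigma> = s1 + t * \<delta>1 \<and> z2 \<sigma> + \<tau> * z1 \<sigma> = s2 + t * \<delta>2}"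
proof -
  note outer = that
  obtain \<tau> :: real where \<tau>: "inj_on (\<lambda>\<sigma>. real_of_int (z2 \<sigma>) + \<tau> * real_of_int (z1 \<sigma>)) core"
    using exists_injective_shear[OF core(1) core_inj] by blast
  define \<pi> where "\<pi> = (\<lambda>\<sigma>. (real_of_int (z1 \<sigma>), real_of_int (z2 \<sigma>) + \<tau> * real_of_int (z1 \<sigma>)))"
  have \<pi>_inj: "inj_on \<pi> core" using \<tau> by (auto simp: \<pi>_def inj_on_def)
  define T where "T = (SIGMA k1:{..<K}. {..<K - k1})"
  obtain p :: "(nat \<times> nat) \<times> nat \<Rightarrow> int" where p: "\<exists>a\<in>T \<times> {..<8 * q}. p a \<noteq> 0"
    "\<And>\<sigma>. \<sigma> \<in> box 1 \<Longrightarrow> (\<Sum>a\<in>T \<times> {..<8 * q}. p a * (z1 \<sigma> ^ fst (fst a) * z2 \<sigma> ^ snd (fst a)) * yy \<sigma> ^ snd a) = 0"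
    using vanishing_2 unfolding T_def[symmetric] by blast
  define P where "P = (\<lambda>l. sheared_poly \<tau> T (\<lambda>k. p (k, l)))"
  have finT: "finite T" by (simp add: T_def)
  have T: "fst k + snd k \<le> K" if "k \<in> T" for k using that by (auto simp: T_def)
  obtain k0 l0 where kl: "k0 \<in> T" "l0 < 8 * q" "p (k0, l0) \<noteq> 0" using p(1) by auto
  have nz: "P l0 \<noteq> 0" unfolding P_def by (rule sheared_poly_nonzero[OF finT kl(1)]) (use kl in simp)
  \<comment> \<open>Adding \<open>(j, 0, 0)\<close> multiplies \<open>yy\<close> by
    \<open>golden ^ j\<close>, which gives distinct positive nodes, and moves the sheared
    coordinates by \<open>(j, \<tau> * j)\<close>.\<close>
  define e where "e = (\<lambda>j. (real j, \<tau> * real j))"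
  have gg: "golden > 1" using golden_bounds by simp
  have inj: "inj_on (\<lambda>j. golden ^ j) {..<8 * q}" using gg by (auto simp: inj_on_def)
  have degP: "degree (P l) \<le> K" "ideg (P l) \<le> K" if "l < 8 * q" for l
    unfolding P_def using degree_sheared_poly[OF finT T] by blast+
  have gpos: "golden ^ j > 0" if "j < 8 * q" for j using gg by simp
  obtain D where D: "D \<noteq> 0" "degree D \<le> 8 * q * K" "ideg D \<le> 8 * q * K"
    "\<And>a b Y. Y \<noteq> 0 \<Longrightarrow> (\<And>j. j < 8 * q \<Longrightarrow> (\<Sum>l<8 * q. ev2 (P l) (a + fst (e j)) (b + snd (e j)) * (golden ^ j * Y) ^ l) = 0)
       \<Longrightarrow> ev2 D a b = 0"
  proof (rule eliminate_exponential[where P = P and e = e and y = "\<lambda>j. golden ^ j" and ?d1.0 = K and ?d2.0 = K,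
      OF kl(2) nz degP gpos inj])
    fix D :: "real poly poly"
    assume "D \<noteq> 0" "degree D \<le> 8 * q * K" "ideg D \<le> 8 * q * K"
      "\<And>a b Y. Y \<noteq> 0 \<Longrightarrow> (\<And>j. j < 8 * q \<Longrightarrow> (\<Sum>l<8 * q. ev2 (P l) (a + fst (e j)) (b + snd (e j)) * (golden ^ j * Y) ^ l) = 0)
       \<Longrightarrow> ev2 D a b = 0"
    then show thesis by (rule that)
  qed
  have zero: "ev2 D (fst (\<pi> \<sigma>) + fst (\<pi> \<rho>)) (snd (\<pi> \<sigma>) + snd (\<pi> \<rho>)) = 0" if "\<sigma> \<in> core" "\<rho> \<in> shifts" for \<sigma> \<rho>
  proof (rule D(4)[of "yy (\<sigma> + \<rho>)"])
    show "yy (\<sigma> + \<rho>) \<noteq> 0" using yy_pos[of "\<sigma> + \<rho>"] by simp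
    fix j assume j: "j < 8 * q"
    let ?s = "\<sigma> + \<rho> + (int j, 0, 0)"
    have yj: "yy ?s = golden ^ j * yy (\<sigma> + \<rho>)" unfolding yy_add[of "\<sigma> + \<rho>"] by (simp add: yy_def)
    have z: "real_of_int (z1 ?s) = fst (\<pi> \<sigma>) + fst (\<pi> \<rho>) + fst (e j)"
      "real_of_int (z2 ?s) = snd (\<pi> \<sigma>) + snd (\<pi> \<rho>) + snd (e j) - \<tau> * (fst (\<pi> \<sigma>) + fst (\<pi> \<rho>) + fst (e j))"
      unfolding z1_add z2_add by (simp_all add: \<pi>_def e_def z1_def z2_def algebra_simps)
    have "0 = (\<Sum>a\<in>T \<times> {..<8 * q}. p a * (z1 ?s ^ fst (fst a) * z2 ?s ^ snd (fst a)) * yy ?s ^ snd a)"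
      using p(2)[OF box_sum[OF that j]] by simp
    also have "\<dots> = (\<Sum>k\<in>T. \<Sum>l<8 * q. p (k, l) * (z1 ?s ^ fst k * z2 ?s ^ snd k) * yy ?s ^ l)"
      by (simp add: sum.cartesian_product case_prod_unfold)
    also have "\<dots> = (\<Sum>l<8 * q. \<Sum>k\<in>T. p (k, l) * (z1 ?s ^ fst k * z2 ?s ^ snd k) * yy ?s ^ l)"
      by (rule sum.swap)
    also have "\<dots> = (\<Sum>l<8 * q. ev2 (P l) (fst (\<pi> \<sigma>) + fst (\<pi> \<rho>) + fst (e j)) (snd (\<pi> \<sigma>) + snd (\<pi> \<rho>) + snd (e j)) * (golden ^ j * yy (\<sigma> + \<rho>)) ^ l)"
      unfolding P_def ev2_sheared_poly of_int_mult of_int_power z yj sum_distrib_right by (simp add: mult.assoc)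
    finally show "(\<Sum>l<8 * q. ev2 (P l) (fst (\<pi> \<sigma>) + fst (\<pi> \<rho>) + fst (e j)) (snd (\<pi> \<sigma>) + snd (\<pi> \<rho>) + snd (e j)) * (golden ^ j * yy (\<sigma> + \<rho>)) ^ l) = 0"
      by simp
  qed
  show ?thesis
  proof (rule ccontr)
    assume none: "\<not> thesis"
    have \<pi>s: "inj_on \<pi> shifts" by (auto simp: inj_on_def \<pi>_def shifts_def z1_def z2_def)
    have deg1: "deg \<ge> 1" using q_ge K_ge by (simp add: deg_def Suc_le_eq)
    have "card (\<pi> ` core) \<le> 2 * deg * max deg deg"
    proof (rule card_zeros_of_sumset_le[OF D(1)])
      show "degree D \<le> deg" "ideg D \<le> deg" "1 \<le> deg" using D deg1 by (auto simp: deg_def)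
      show "finite (\<pi> ` shifts)" "finite (\<pi> ` core)" using core shifts by auto
      show "(0, 0) \<in> \<pi> ` shifts" using shifts(3) by (auto simp: \<pi>_def z1_def z2_def zero_prod_def image_iff intro!: bexI[of _ "(0, 0, 0)"])
      show "deg < card (\<pi> ` shifts)" using shifts \<pi>s by (simp add: card_image)
      show "inj_on snd (\<pi> ` core)" using \<tau> by (auto simp: \<pi>_def inj_on_def)
      show "ev2 D (fst b + fst a) (snd b + snd a) = 0" if "a \<in> \<pi> ` shifts" "b \<in> \<pi> ` core" for a b
        using that zero by auto
      show "card {x \<in> \<pi> ` core. \<exists>t. x = (fst s + t * fst \<delta>, snd s + t * snd \<delta>)} \<le> deg" if "\<delta> \<noteq> (0, 0)" for s \<delta> :: "real \<times> real"
      proof (rule ccontr)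
        assume "\<not> ?thesis"
        moreover have "{x \<in> \<pi> ` core. \<exists>t. x = (fst s + t * fst \<delta>, snd s + t * snd \<delta>)} =
          \<pi> ` {\<sigma> \<in> core. \<exists>t. z1 \<sigma> = fst s + t * fst \<delta> \<and> z2 \<sigma> + \<tau> * z1 \<sigma> = snd s + t * snd \<delta>}"
          by (auto simp: \<pi>_def)
        moreover have "card (\<pi> ` {\<sigma> \<in> core. \<exists>t. z1 \<sigma> = fst s + t * fst \<delta> \<and> z2 \<sigma> + \<tau> * z1 \<sigma> = snd s + t * snd \<delta>})
          \<le> card {\<sigma> \<in> core. \<exists>t. z1 \<sigma> = fst s + t * fst \<delta> \<and> z2 \<sigma> + \<tau> * z1 \<sigma> = snd s + t * snd \<delta>}"
          using core by (intro card_image_le) auto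
        ultimately have "deg < card {\<sigma> \<in> core. \<exists>t. z1 \<sigma> = fst s + t * fst \<delta> \<and> z2 \<sigma> + \<tau> * z1 \<sigma> = snd s + t * snd \<delta>}"
          by simp
        then show False using none outer[of "fst \<delta>" "snd \<delta>" "fst s" \<tau> "snd s"] \<open>\<delta> \<noteq> (0, 0)\<close> by simp
      qed
    qed
    then show False using core(2) \<pi>_inj by (simp add: card_image)
  qed
qed

end

section \<open>The contradiction on the rich line\<close>

context parameters
begin

text \<open>For equal \<open>w\<close> the powers of \<open>eta\<close> cancel, so the independence
  of \<open>golden\<close> and \<open>g\<close> decides, whatever relations \<open>eta\<close> may
  satisfy.\<close>

lemma yy_w_inj:
  assumes "yy (u, v, w) = yy (u', v', w)" shows "u = u'" "v = v'"
proof -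
  have pos: "golden > 0" "real g > 0" using golden_bounds g by auto
  have "yy ((u, v, w) - (u', v', w)) = 1" unfolding yy_diff using assms yy_pos[of "(u', v', w)"] by simp
  then have "golden powi (u - u') * real g powi (v - v') = 1" by (simp add: yy_def)
  then have "u - u' = 0" "v - v' = 0" by (rule golden_g_independent)+
  then show "u = u'" "v = v'" by auto
qed

lemma core_box: "\<sigma> \<in> core \<Longrightarrow> \<sigma> \<in> box 1"
proof -
  assume "\<sigma> \<in> core"
  moreover have "0.0294 * real K \<le> 0.03 * K" "0.00147 * real K \<le> 0.0015 * K" by simp_all
  ultimately show ?thesis by (cases \<sigma>) (auto simp: core_def box_def)
qed

lemma box_comb:
  assumes "\<sigma> \<in> core" "\<sigma>' \<in> core" "\<sigma>'' \<in> core"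
  shows "\<sigma> - \<sigma>' + \<sigma>'' \<in> box 3"
proof -
  obtain u v w u' v' w' u'' v'' w'' where \<sigma>: "\<sigma> = (u, v, w)" "\<sigma>' = (u', v', w')" "\<sigma>'' = (u'', v'', w'')"
    by (cases \<sigma>; cases \<sigma>'; cases \<sigma>'')
  have c: "\<bar>real_of_int (a - a' + a'')\<bar> * l \<le> 3 * B"
    if "\<bar>real_of_int a\<bar> * l \<le> B" "\<bar>real_of_int a'\<bar> * l \<le> B" "\<bar>real_of_int a''\<bar> * l \<le> B" "l > 0" for a a' a'' :: int and l B :: real
  proof -
    have "\<bar>real_of_int (a - a' + a'')\<bar> * l \<le> (\<bar>real_of_int a\<bar> + \<bar>real_of_int a'\<bar> + \<bar>real_of_int a''\<bar>) * l"
      using that by (intro mult_right_mono) auto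
    then show ?thesis using that by (simp add: distrib_right)
  qed
  have b1: "\<sigma> \<in> box 1" "\<sigma>' \<in> box 1" "\<sigma>'' \<in> box 1" using assms core_box by auto
  have h0: "h > 0" using hh by simp
  have "\<bar>real_of_int (v - v' + v'')\<bar> * lam \<le> 3 * (0.03 * K)" "\<bar>real_of_int (w - w' + w'')\<bar> * h \<le> 3 * (0.03 * K)"
    using b1 lam_pos h0 unfolding \<sigma> by (intro c; simp add: box_def)+
  moreover have "\<bar>xx (\<sigma> - \<sigma>' + \<sigma>'')\<bar> \<le> 3 * (0.0015 * K)"
  proof -
    have "\<bar>xx \<sigma>\<bar> \<le> 0.0015 * K" "\<bar>xx \<sigma>'\<bar> \<le> 0.0015 * K" "\<bar>xx \<sigma>''\<bar> \<le> 0.0015 * K" using b1 by (auto simp: box_def \<sigma>)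
    then show ?thesis unfolding xx_add xx_diff by linarith
  qed
  ultimately show ?thesis by (simp add: box_def \<sigma>)
qed

lemma contradiction: False
proof -
  obtain \<tau> \<delta>1 \<delta>2 s1 s2 :: real where \<delta>: "(\<delta>1, \<delta>2) \<noteq> (0, 0)"
    and rich: "deg < card {\<sigma> \<in> core. \<exists>t. z1 \<sigma> = s1 + t * \<delta>1 \<and> z2 \<sigma> + \<tau> * z1 \<sigma> = s2 + t * \<delta>2}"
    by (rule exists_rich_line)
  define L where "L = {\<sigma> \<in> core. \<exists>t. z1 \<sigma> = s1 + t * \<delta>1 \<and> z2 \<sigma> + \<tau> * z1 \<sigma> = s2 + t * \<delta>2}"
  have Lc: "L \<subseteq> core" by (auto simp: L_def)
  have finL: "finite L" using Lc core(1) finite_subset by blast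
  have cL: "deg < card L" using rich by (simp add: L_def)
  have Kp: "10 ^ 11 \<le> real K" by (rule K_ge)
  have degK: "2000 * real K \<le> deg"
  proof -
    have "250 * real K \<le> real q * real K" using q_ge by (intro mult_right_mono) auto
    then show ?thesis by (simp add: deg_def mult_ac)
  qed
  define \<epsilon> where "\<epsilon> = \<delta>2 - \<tau> * \<delta>1"
  have lin: "\<exists>t. z1 \<sigma> - z1 \<sigma>' = t * \<delta>1 \<and> z2 \<sigma> - z2 \<sigma>' = t * \<epsilon>" if in_L: "\<sigma> \<in> L" "\<sigma>' \<in> L" for \<sigma> \<sigma>'
  proof -
    obtain t t' where "z1 \<sigma> = s1 + t * \<delta>1" "z2 \<sigma> + \<tau> * z1 \<sigma> = s2 + t * \<delta>2"
      "z1 \<sigma>' = s1 + t' * \<delta>1" "z2 \<sigma>' + \<tau> * z1 \<sigma>' = s2 + t' * \<delta>2" using in_L unfolding L_def by blast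
    then have "z1 \<sigma> - z1 \<sigma>' = (t - t') * \<delta>1" "z2 \<sigma> - z2 \<sigma>' = (t - t') * \<epsilon>"
      by (auto simp: \<epsilon>_def algebra_simps)
    then show ?thesis by blast
  qed
  have "L \<noteq> {}" using cL by auto
  then obtain \<sigma>b where \<sigma>b: "\<sigma>b \<in> L" by blast
  obtain ub vb wb where ub: "\<sigma>b = (ub, vb, wb)" by (cases \<sigma>b)
  \<comment> \<open>On a line of constant \<open>z2\<close> also \<open>v\<close> and
    \<open>w\<close> are constant, and the bound on \<open>xx\<close> leaves an interval with at
    most \<open>deg\<close> values of \<open>u\<close>.\<close>
  have \<epsilon>: "\<epsilon> \<noteq> 0"
  proof
    assume e0: "\<epsilon> = 0"
    define U where "U = {u :: int. \<bar>u * gam + (vb * lam + wb * ln eta)\<bar> \<le> 0.00147 * K}"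
    have U: "finite U" "card U \<le> 2 * (0.00147 * K) / gam + 1"
      unfolding U_def by (rule card_int_interval; use gam_pos in simp)+
    have "L \<subseteq> (\<lambda>u. (u, vb, wb)) ` U"
    proof
      fix \<sigma> assume \<sigma>: "\<sigma> \<in> L"
      obtain u v w where u: "\<sigma> = (u, v, w)" by (cases \<sigma>)
      have "z2 \<sigma> = z2 \<sigma>b" using lin[OF \<sigma> \<sigma>b] e0 by auto
      then have "v = vb" "w = wb" using z2_inj[of u v w ub vb wb] \<sigma> \<sigma>b Lc unfolding u ub by auto
      moreover have "\<bar>xx \<sigma>\<bar> \<le> 0.00147 * K" using \<sigma> Lc u by (auto simp: core_def)
      ultimately show "\<sigma> \<in> (\<lambda>u. (u, vb, wb)) ` U" using u by (auto simp: U_def xx_def add.assoc)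
    qed
    then have "card L \<le> card ((\<lambda>u. (u, vb, wb)) ` U)" using U by (intro card_mono) auto
    also have "\<dots> \<le> card U" using U by (intro card_image_le)
    finally have "real (card L) \<le> 2 * (0.00147 * K) / gam + 1" using U by linarith
    also have "\<dots> \<le> 2 * (0.00147 * K) / 0.38 + 1" using gam_bounds by (intro add_mono divide_left_mono) auto
    also have "\<dots> \<le> deg" using degK Kp by simp
    finally show False using cL by simp
  qed
  define m where "m = \<delta>1 / \<epsilon>"
  have z1z2: "real_of_int (z1 \<sigma>) - z1 \<sigma>' = m * (z2 \<sigma> - z2 \<sigma>')" if "\<sigma> \<in> L" "\<sigma>' \<in> L" for \<sigma> \<sigma>'
    using lin[OF that] \<epsilon> by (auto simp: m_def)
  define \<kappa>0 where "\<kappa>0 = m * gam + lam"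
  have xaL: "xa \<sigma> - xa \<sigma>' = \<kappa>0 * (z2 \<sigma> - z2 \<sigma>')" if "\<sigma> \<in> L" "\<sigma>' \<in> L" for \<sigma> \<sigma>'
  proof -
    have "xa \<sigma> - xa \<sigma>' = (real_of_int (z1 \<sigma>) - z1 \<sigma>') * gam + (z2 \<sigma> - z2 \<sigma>') * lam"
      by (simp add: xa_def algebra_simps)
    then show ?thesis unfolding z1z2[OF that] \<kappa>0_def by (simp add: algebra_simps)
  qed
  have z2inj: "inj_on z2 L"
  proof (rule inj_onI)
    fix \<sigma> \<sigma>' assume *: "\<sigma> \<in> L" "\<sigma>' \<in> L" "z2 \<sigma> = z2 \<sigma>'"
    then have "z1 \<sigma> = z1 \<sigma>'" using z1z2[of \<sigma> \<sigma>'] by simp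
    then show "\<sigma> = \<sigma>'" using core_inj * Lc by (auto simp: inj_on_def)
  qed
  \<comment> \<open>A fibre of \<open>yy\<close> on the line has at most one point for each
    \<open>w\<close>, hence at most \<open>0.08 * K\<close> points; fewer than \<open>4 * q\<close>
    values would leave too few points.\<close>
  have many: "4 * q \<le> card (yy ` L)"
  proof (rule ccontr)
    assume few: "\<not> ?thesis"
    define Ws where "Ws = {w :: int. \<bar>w * h + 0\<bar> \<le> 0.03 * K}"
    have W: "finite Ws" "card Ws \<le> 2 * (0.03 * K) / h + 1"
      unfolding Ws_def by (rule card_int_interval; use hh in simp)+
    have "card L \<le> card (yy ` L) * card Ws"
    proof (rule card_le_card_image_mult[OF finL])
      fix x assume "x \<in> L"
      have "inj_on (\<lambda>\<sigma>. snd (snd \<sigma>)) {y \<in> L. yy y = yy x}"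
        by (auto simp: inj_on_def) (metis yy_w_inj)+
      moreover have "(\<lambda>\<sigma>. snd (snd \<sigma>)) ` {y \<in> L. yy y = yy x} \<subseteq> Ws"
        using Lc hh by (auto simp: Ws_def core_def abs_mult)
      ultimately show "card {y \<in> L. yy y = yy x} \<le> card Ws" using W(1) card_inj_on_le by blast
    qed
    also have "\<dots> \<le> (4 * q) * card Ws" using few by (intro mult_right_mono) auto
    finally have "real (card L) \<le> real (4 * q) * card Ws" by (metis of_nat_le_iff of_nat_mult)
    also have "\<dots> \<le> (4 * real q) * (0.08 * K)"
    proof -
      have "2 * (0.03 * K) / h + 1 \<le> 2 * (0.03 * K) / 0.8 + 1" using hh by (intro add_mono divide_left_mono) auto
      also have "\<dots> \<le> 0.08 * K" using Kp by simp
      finally show ?thesis using W(2) by (intro mult_mono) auto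
    qed
    also have "\<dots> \<le> deg" by (simp add: deg_def)
    finally show False using cL by simp
  qed
  then obtain S where S: "S \<subseteq> yy ` L" "card S = 4 * q" by (metis obtain_subset_with_card_n)
  have finS: "finite S" using S(1) finL finite_subset by blast
  obtain f where f: "bij_betw f {0..<4 * q} S" using ex_bij_betw_nat_finite[OF finS] S(2) by auto
  define sg where "sg = (\<lambda>j. inv_into L yy (f j))"
  have sg: "sg j \<in> L" "yy (sg j) = f j" if "j < 4 * q" for j
  proof -
    have "f j \<in> yy ` L" using f that S(1) by (auto simp: bij_betw_def)
    then show "sg j \<in> L" "yy (sg j) = f j" by (auto simp: sg_def inv_into_into f_inv_into_f)
  qed
  \<comment> \<open>Translation by the difference of two points of the line stays on the line and
    multiplies \<open>yy\<close> by a factor depending on \<open>j\<close> alone: the analogue of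
    the steps \<open>(j, 0, 0)\<close> in the plane.\<close>
  define SS where "SS = (\<lambda>(j, \<sigma>). sg j - \<sigma>b + \<sigma>) ` ({..<4 * q} \<times> L)"
  have finSS: "finite SS" using finL by (simp add: SS_def)
  have SSbox: "SS \<subseteq> box 3" using sg(1) \<sigma>b Lc unfolding SS_def by (force intro!: box_comb)
  define t0 where "t0 = z2 \<sigma>b"
  have line: "xa \<sigma> = xa \<sigma>b + \<kappa>0 * (z2 \<sigma> - t0)" if in_SS: "\<sigma> \<in> SS" for \<sigma>
  proof -
    obtain j \<rho> where \<rho>: "\<sigma> = sg j - \<sigma>b + \<rho>" "j < 4 * q" "\<rho> \<in> L" using in_SS by (auto simp: SS_def)
    have "xa (sg j) - xa \<sigma>b + xa \<rho> = xa \<sigma>b + (xa (sg j) - xa \<sigma>b) + (xa \<rho> - xa \<sigma>b)" by simp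
    also have "\<dots> = xa \<sigma>b + \<kappa>0 * ((z2 (sg j) - z2 \<sigma>b) + (z2 \<rho> - z2 \<sigma>b))"
      unfolding xaL[OF sg(1)[OF \<rho>(2)] \<sigma>b] xaL[OF \<rho>(3) \<sigma>b] by (simp add: algebra_simps)
    finally show ?thesis by (simp add: \<rho>(1) xa_add xa_diff z2_add z2_diff t0_def algebra_simps)
  qed
  \<comment> \<open>The exact maximum, so that \<open>\<bar>\<kappa>0\<bar> * B2\<close> is the
    distance of two values of \<open>xa\<close> and hence at most
    \<open>(3 + 1) * 0.0016 * K\<close>; a cruder bound for \<open>z2\<close> would spoil
    this.\<close>
  define B2 where "B2 = Max ((\<lambda>\<sigma>. \<bar>real_of_int (z2 \<sigma> - t0)\<bar>) ` SS)"
  have q0: "0 < 4 * q" using q_ge by simp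
  have SSne: "SS \<noteq> {}" using q0 \<sigma>b by (auto simp: SS_def lessThan_empty_iff)
  have B2ge: "\<bar>real_of_int (z2 \<sigma> - t0)\<bar> \<le> B2" if "\<sigma> \<in> SS" for \<sigma>
    unfolding B2_def using that finSS by (intro Max_ge) auto
  have "B2 \<in> (\<lambda>\<sigma>. \<bar>real_of_int (z2 \<sigma> - t0)\<bar>) ` SS" unfolding B2_def using finSS SSne by (intro Max_in) auto
  then obtain \<sigma>m where \<sigma>m: "\<sigma>m \<in> SS" "B2 = \<bar>real_of_int (z2 \<sigma>m - t0)\<bar>" by auto
  have bb: "\<sigma>b \<in> box 1" using \<sigma>b Lc core_box by blast
  have B2_1: "1 \<le> B2"
  proof (rule ccontr)
    assume small: "\<not> 1 \<le> B2"
    have "z2 \<rho> = 2 * t0 - z2 (sg 0)" if "\<rho> \<in> L" for \<rho>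
    proof -
      have "sg 0 - \<sigma>b + \<rho> \<in> SS" using q0 that by (auto simp: SS_def)
      then have "\<bar>real_of_int (z2 (sg 0 - \<sigma>b + \<rho>) - t0)\<bar> < 1" using B2ge small by fastforce
      then have "z2 (sg 0 - \<sigma>b + \<rho>) - t0 = 0" by linarith
      then show ?thesis by (simp add: z2_add z2_diff t0_def)
    qed
    then have "z2 ` L \<subseteq> {2 * t0 - z2 (sg 0)}" by auto
    then have "card (z2 ` L) \<le> 1" using card_mono[of "{2 * t0 - z2 (sg 0)}" "z2 ` L"] by simp
    then have "card L \<le> 1" using card_image[OF z2inj] by simp
    then show False using cL degK Kp by simp
  qed
  have B2_b: "B2 \<le> exp b"
  proof -
    have "\<bar>real_of_int (z2 \<sigma>m - t0)\<bar> \<le> \<bar>real_of_int (z2 \<sigma>m)\<bar> + \<bar>real_of_int (z2 \<sigma>b)\<bar>" unfolding t0_def by simp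
    also have "\<dots> \<le> 3 * Z + 1 * Z" using \<sigma>m(1) SSbox bb by (intro add_mono box_z2) auto
    also have "\<dots> \<le> exp b" using Z_bounds(3) by simp
    finally show ?thesis using \<sigma>m(2) by simp
  qed
  have xb: "\<bar>xa \<sigma>b\<bar> \<le> 0.0016 * K" using box_xa[OF bb] by simp
  have \<kappa>b: "\<bar>\<kappa>0\<bar> * B2 \<le> 0.0064 * K"
  proof -
    have "\<bar>\<kappa>0\<bar> * B2 = \<bar>xa \<sigma>m - xa \<sigma>b\<bar>" unfolding \<sigma>m(2) line[OF \<sigma>m(1)] by (simp add: abs_mult)
    also have "\<dots> \<le> \<bar>xa \<sigma>m\<bar> + \<bar>xa \<sigma>b\<bar>" by (rule abs_triangle_ineq4)
    also have "\<dots> \<le> 3 * (0.0016 * K) + 0.0016 * K" using \<sigma>m(1) SSbox xb by (intro add_mono box_xa) auto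
    finally show ?thesis by simp
  qed
  obtain p :: "nat \<times> nat \<Rightarrow> int" where p: "\<exists>a\<in>{..<2 * K} \<times> {..<4 * q}. p a \<noteq> 0"
    "\<And>\<sigma>. \<sigma> \<in> SS \<Longrightarrow> (\<Sum>a\<in>{..<2 * K} \<times> {..<4 * q}. p a * ((z2 \<sigma> - t0) ^ fst a) * yy \<sigma> ^ snd a) = 0"
    using vanishing_1[OF SSbox B2_1 B2_b B2ge line xb \<kappa>b] by blast
  \<comment> \<open>Polynomials in one variable, stored with constant inner coefficients so that
    \<open>eliminate_exponential\<close> applies with inner degree 0.\<close>
  define P where "P = (\<lambda>l. \<Sum>k<2 * K. monom [:real_of_int (p (k, l)):] k)"
  have evP: "ev2 (P l) a b' = (\<Sum>k<2 * K. real_of_int (p (k, l)) * a ^ k)" for l and a b' :: real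
    by (simp add: P_def ev2_sum ev2_monom)
  have cP: "coeff (P l) k = (if k < 2 * K then [:real_of_int (p (k, l)):] else 0)" for l k
    by (simp add: P_def coeff_sum)
  obtain k0 l0 where kl: "k0 < 2 * K" "l0 < 4 * q" "p (k0, l0) \<noteq> 0" using p(1) by auto
  have nz: "P l0 \<noteq> 0" using cP[of l0 k0] kl by auto
  have degP: "degree (P l) \<le> 2 * K" "ideg (P l) \<le> 0" if "l < 4 * q" for l
  proof -
    show "degree (P l) \<le> 2 * K" by (rule degree_le) (simp add: cP)
    show "ideg (P l) \<le> 0" unfolding ideg_le_iff by (simp add: cP)
  qed
  define yj where "yj = (\<lambda>j. yy (sg j) / yy \<sigma>b)"
  define e where "e = (\<lambda>j. (real_of_int (z2 (sg j) - t0), 0 :: real))"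
  have yjpos: "yj j > 0" if "j < 4 * q" for j using yy_pos by (simp add: yj_def)
  have yjinj: "inj_on yj {..<4 * q}"
  proof (rule inj_onI)
    fix i j assume ij: "i \<in> {..<4 * q}" "j \<in> {..<4 * q}" "yj i = yj j"
    then have "f i = f j" using sg(2) yy_pos[of \<sigma>b] by (simp add: yj_def)
    then show "i = j" using inj_onD[OF bij_betw_imp_inj_on[OF f]] ij(1,2) by simp
  qed
  obtain D where D: "D \<noteq> 0" "degree D \<le> 4 * q * (2 * K)" "ideg D \<le> 4 * q * 0"
    "\<And>a b Y. Y \<noteq> 0 \<Longrightarrow> (\<And>j. j < 4 * q \<Longrightarrow> (\<Sum>l<4 * q. ev2 (P l) (a + fst (e j)) (b + snd (e j)) * (yj j * Y) ^ l) = 0)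
       \<Longrightarrow> ev2 D a b = 0"
  proof (rule eliminate_exponential[where P = P and e = e and y = yj and ?d1.0 = "2 * K" and ?d2.0 = 0,
      OF kl(2) nz degP yjpos yjinj])
    fix D :: "real poly poly"
    assume "D \<noteq> 0" "degree D \<le> 4 * q * (2 * K)" "ideg D \<le> 4 * q * 0"
      "\<And>a b Y. Y \<noteq> 0 \<Longrightarrow> (\<And>j. j < 4 * q \<Longrightarrow> (\<Sum>l<4 * q. ev2 (P l) (a + fst (e j)) (b + snd (e j)) * (yj j * Y) ^ l) = 0)
       \<Longrightarrow> ev2 D a b = 0"
    then show thesis by (rule that)
  qed
  have zero: "ev2 D (real_of_int (z2 \<rho> - t0)) 0 = 0" if "\<rho> \<in> L" for \<rho>
  proof (rule D(4)[of "yy \<rho>"])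
    show "yy \<rho> \<noteq> 0" using yy_pos[of \<rho>] by simp
    fix j assume j: "j < 4 * q"
    let ?s = "sg j - \<sigma>b + \<rho>"
    have s: "?s \<in> SS" using j that by (auto simp: SS_def)
    have ys: "yy ?s = yj j * yy \<rho>" by (simp add: yy_add yy_diff yj_def)
    have zs: "real_of_int (z2 ?s - t0) = real_of_int (z2 \<rho> - t0) + fst (e j)"
      by (simp add: z2_add z2_diff e_def t0_def)
    have "0 = (\<Sum>a\<in>{..<2 * K} \<times> {..<4 * q}. p a * ((z2 ?s - t0) ^ fst a) * yy ?s ^ snd a)"
      by (rule p(2)[OF s, symmetric])
    also have "\<dots> = (\<Sum>k<2 * K. \<Sum>l<4 * q. p (k, l) * ((z2 ?s - t0) ^ k) * yy ?s ^ l)"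
      unfolding sum.cartesian_product by (simp add: case_prod_unfold)
    also have "\<dots> = (\<Sum>l<4 * q. \<Sum>k<2 * K. p (k, l) * ((z2 ?s - t0) ^ k) * yy ?s ^ l)" by (rule sum.swap)
    also have "\<dots> = (\<Sum>l<4 * q. ev2 (P l) (real_of_int (z2 \<rho> - t0) + fst (e j)) (0 + snd (e j)) * (yj j * yy \<rho>) ^ l)"
      unfolding evP of_int_mult of_int_power zs ys sum_distrib_right ..
    finally show "(\<Sum>l<4 * q. ev2 (P l) (real_of_int (z2 \<rho> - t0) + fst (e j)) (0 + snd (e j)) * (yj j * yy \<rho>) ^ l) = 0"
      by simp
  qed
  define r where "r = map_poly (\<lambda>c. poly c 0) D"
  have r: "poly r a = ev2 D a 0" for a by (simp add: r_def ev2_altdef)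
  have const: "degree (coeff D i) = 0" for i using D(3) ideg_le_iff[of D 0] by simp
  have "poly (coeff D i) x = poly (coeff D i) 0" for i x
  proof -
    obtain c where "coeff D i = [:c:]" using const by (rule degree_eq_zeroE)
    then show ?thesis by simp
  qed
  then have "ev2 D a x = ev2 D a 0" for a x
    unfolding ev2_altdef by (intro arg_cong[where f = "\<lambda>p. poly p a"] poly_eqI) (simp add: coeff_map_poly)
  then have "r \<noteq> 0" using ev2_nonzero[OF D(1)] r by (metis poly_0)
  \<comment> \<open>A nonzero polynomial of degree at most \<open>deg\<close> in one variable would
    vanish at more than \<open>deg\<close> points.\<close>
  have "card L = card ((\<lambda>\<rho>. real_of_int (z2 \<rho> - t0)) ` L)"
    by (rule card_image[symmetric]) (use z2inj in \<open>auto simp: inj_on_def\<close>)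
  also have "\<dots> \<le> card {x. poly r x = 0}"
    by (rule card_mono) (use poly_roots_finite[OF \<open>r \<noteq> 0\<close>] zero in \<open>auto simp: r\<close>)
  also have "\<dots> \<le> degree r" using \<open>r \<noteq> 0\<close> by (rule card_poly_roots_bound)
  also have "\<dots> \<le> degree D" unfolding r_def by (rule degree_map_poly_le)
  also have "\<dots> \<le> deg" using D(2) by (simp add: deg_def)
  finally show False using cL by simp
qed

end

section \<open>Lower bound for the linear form, and the equation\<close>

lemma exp_2_2_ge: "8 \<le> exp (2.2 :: real)"
proof -
  have "(8 :: real) \<le> (1 + 2.2 / 64) ^ 64" by (simp add: power_divide)
  also have "\<dots> \<le> exp (2.2 / 64) ^ 64" using exp_ge_add_one_self[of "2.2 / 64 :: real"] by (intro power_mono) auto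
  also have "\<dots> = exp 2.2" by (simp flip: exp_of_nat_mult)
  finally show ?thesis .
qed

lemma nat_ceiling_le: "0 \<le> x \<Longrightarrow> real (nat \<lceil>x\<rceil>) \<le> x + 1" for x :: real
  by (simp add: of_nat_nat of_int_ceiling_le_add_one)

lemma exp_1_ge: "2.69 \<le> exp (1 :: real)"
proof -
  have "(2.69 :: real) \<le> (1 + 1 / 64) ^ 64" by (simp add: power_divide)
  also have "\<dots> \<le> exp (1 / 64) ^ 64" using exp_ge_add_one_self[of "1 / 64 :: real"] by (intro power_mono) auto
  also have "\<dots> = exp 1" by (simp flip: exp_of_nat_mult)
  finally show ?thesis .
qed

lemma abs_ln_one_minus_le:
  fixes t :: real
  assumes "\<bar>t\<bar> \<le> 1 / 2"
  shows "\<bar>ln (1 - t)\<bar> \<le> 2 * \<bar>t\<bar>"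
proof -
  have p: "1 - t \<ge> 1 / 2" using assms by linarith
  have "ln (1 - t) \<le> (1 - t) - 1" using p by (intro ln_le_minus_one) auto
  then have 1: "ln (1 - t) \<le> 2 * \<bar>t\<bar>" by linarith
  have "ln (1 / (1 - t)) \<le> 1 / (1 - t) - 1" using p by (intro ln_le_minus_one) auto
  also have "\<dots> = (1 - (1 - t)) / (1 - t)" unfolding diff_divide_distrib[of 1 "1 - t"] using p by simp
  also have "\<dots> = t / (1 - t)" by simp
  also have "\<dots> \<le> \<bar>t\<bar> / (1 / 2)" using p by (intro frac_le) auto
  finally have "- ln (1 - t) \<le> 2 * \<bar>t\<bar>" using p by (simp add: ln_div)
  then show ?thesis using 1 by (simp add: abs_le_iff)
qed

context linear_form
begin

text \<open>\<open>q\<close> and \<open>K\<close> are rounded up, which 2.51 and 4.0001 absorb;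
  \<open>6.4 * 10 ^ 8\<close> is \<open>6.3 * 2.51 * 4.0001 * 10 ^ 7\<close> rounded up. The bound
  includes that \<open>Lam\<close> is nonzero.\<close>

lemma Lam_lower_bound:
  assumes b: "b \<ge> 100" and hh: "h \<ge> 0.8" and N: "10 ^ 7 * h * b\<^sup>2 \<le> N"
    and eb: "10 ^ 8 * N * lam\<^sup>2 * b\<^sup>2 \<le> exp b"
  shows "exp (- (6.4 * 10 ^ 8 * b ^ 3 * lam * h)) < \<bar>Lam\<bar>"
proof (rule ccontr)
  assume small: "\<not> ?thesis"
  define q where "q = nat \<lceil>2.5 * b\<rceil>"
  define K where "K = nat \<lceil>4 * 10 ^ 7 * lam * h * b\<^sup>2\<rceil>"
  have q: "2.5 * b \<le> q" "q \<le> 2.5 * b + 1" unfolding q_def using b by (auto intro: real_nat_ceiling_ge nat_ceiling_le)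
  have q': "q \<le> 2.51 * b" using q b by simp
  have l: "2 / 3 \<le> lam"
  proof -
    have "ln 2 \<le> lam" using g by (simp add: lam_def)
    then show ?thesis using ln_2_ge by linarith
  qed
  have big: "10 ^ 4 * (2 / 3 * 0.8) \<le> lam * h * b\<^sup>2"
  proof -
    have "2 / 3 * 0.8 * 100\<^sup>2 \<le> lam * h * b\<^sup>2" using l hh b by (intro mult_mono power_mono) auto
    then show ?thesis by simp
  qed
  have K: "4 * 10 ^ 7 * lam * h * b\<^sup>2 \<le> K" "K \<le> 4 * 10 ^ 7 * lam * h * b\<^sup>2 + 1"
    unfolding K_def using big by (auto simp: mult.assoc intro: real_nat_ceiling_ge nat_ceiling_le)
  have K': "K \<le> 4.0001 * 10 ^ 7 * lam * h * b\<^sup>2" using K(2) big by (simp add: mult.assoc)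
  have "6.3 * (real q * real K) \<le> 6.3 * ((2.51 * b) * (4.0001 * 10 ^ 7 * lam * h * b\<^sup>2))"
    using q' K' b by (intro mult_left_mono mult_mono) auto
  also have "\<dots> = (6.3 * 2.51 * 4.0001 * 10 ^ 7) * (b ^ 3 * lam * h)" by (simp add: eval_nat_numeral)
  also have "\<dots> \<le> (6.4 * 10 ^ 8) * (b ^ 3 * lam * h)"
    using b l hh by (intro mult_right_mono) auto
  finally have e: "6.3 * (real q * real K) \<le> 6.4 * 10 ^ 8 * b ^ 3 * lam * h" by (simp add: mult.assoc)
  have "\<bar>Lam\<bar> \<le> exp (- (6.4 * 10 ^ 8 * b ^ 3 * lam * h))" using small by simp
  also have "\<dots> \<le> exp (- 6.3 * (real q * real K))" using e by simp
  finally have L: "\<bar>Lam\<bar> \<le> exp (- 6.3 * (real q * real K))" .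
  interpret parameters g N k n1 n2 h b q K
    by unfold_locales (fact b q(1) q' hh K(1) K' N eb L)+
  show False by (rule contradiction)
qed

text \<open>The equation makes \<open>Lam\<close> equal to \<open>- ln (1 - t)\<close>, of size at
  most \<open>2 * \<bar>t\<bar> \<le> 8 / g ^ j\<close>; the summand 2.2 is an upper bound for
  \<open>ln 8\<close>.\<close>

lemma exponent_bound:
  fixes j :: nat
  assumes b: "b \<ge> 100" and hh: "h \<ge> 0.8" and N: "10 ^ 7 * h * b\<^sup>2 \<le> N"
    and eb: "10 ^ 8 * N * lam\<^sup>2 * b\<^sup>2 \<le> exp b"
    and eq: "golden ^ k = eta * real g ^ N * (1 - t)" and t: "\<bar>t\<bar> \<le> 4 / real g ^ j"
  shows "j * lam \<le> 6.4 * 10 ^ 8 * b ^ 3 * lam * h + 2.2"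
proof (rule ccontr)
  assume big: "\<not> ?thesis"
  have nn: "0 \<le> 6.4 * 10 ^ 8 * b ^ 3 * lam * h" using b lam_pos hh by simp
  have gj: "real g ^ j = exp (j * lam)" using g by (simp add: lam_def pow_eq_exp)
  have "8 \<le> exp (2.2 :: real)" by (rule exp_2_2_ge)
  also have "\<dots> \<le> exp (j * lam)" unfolding exp_le_cancel_iff using big nn by linarith
  finally have "4 / real g ^ j \<le> 1 / 2" unfolding gj by (simp add: field_simps)
  then have t2: "\<bar>t\<bar> \<le> 1 / 2" using t by linarith
  then have p: "1 - t > 0" by (auto simp: abs_le_iff)
  have gg: "golden > 0" "real g > 0" using golden_bounds g by auto
  have "k * gam = ln (golden ^ k)" using gg by (simp add: gam_def ln_realpow)
  also have "\<dots> = ln eta + N * lam + ln (1 - t)"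
    unfolding eq using eta_pos gg p by (simp add: ln_mult ln_realpow lam_def)
  finally have "Lam = - ln (1 - t)" by (simp add: Lam_def)
  then have "\<bar>Lam\<bar> \<le> 2 * \<bar>t\<bar>" using abs_ln_one_minus_le[OF t2] by simp
  also have "\<dots> \<le> 8 / real g ^ j" using t by simp
  also have "\<dots> = 8 * exp (- (j * lam))" by (simp add: gj exp_minus field_simps)
  also have "\<dots> \<le> exp 2.2 * exp (- (j * lam))" using exp_2_2_ge by (intro mult_right_mono) auto
  also have "\<dots> = exp (2.2 - j * lam)" by (simp flip: exp_add)
  also have "\<dots> \<le> exp (- (6.4 * 10 ^ 8 * b ^ 3 * lam * h))" using big by simp
  finally show False using Lam_lower_bound[OF b hh N eb] by simp
qed

end

text \<open>In \<open>b\<close> the summand 28 exceeds the logarithm of \<open>10 ^ 12\<close>, and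
  the factor 1.02 is chosen since \<open>b / 1.02 + b / 51 = b\<close>: it leaves
  \<open>exp (b / 51)\<close> to absorb \<open>b ^ 2\<close>.\<close>

lemma numeric_bounds:
  fixes n lam :: real
  assumes lam: "2 / 3 \<le> lam" and n: "1.08 * 10 ^ 48 * lam ^ 9 \<le> n"
  defines "b \<equiv> 1.02 * (ln n + 2 * ln lam + 28)"
  shows "100 \<le> b" "3 * 10 ^ 8 * n * lam\<^sup>2 * b\<^sup>2 \<le> exp b"
    "1.01 * (6.4 * 10 ^ 8 * b ^ 3) ^ 3 * lam\<^sup>2 * (0.81 + 3 * lam) < n"
proof -
  define Q where "Q = ln (1.08 * 10 ^ 48 :: real)"
  have Q: "100 \<le> Q" "Q \<le> 112"
  proof -
    have "exp (100 :: real) = exp 1 ^ 100" by (simp flip: exp_of_nat_mult)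
    also have "\<dots> \<le> 3 ^ 100" using exp_le by (intro power_mono) auto
    also have "\<dots> \<le> 1.08 * 10 ^ 48" by simp
    finally show "100 \<le> Q" unfolding Q_def by (subst ln_ge_iff) auto
    have "(1.08 * 10 ^ 48 :: real) \<le> 2.69 ^ 112" by (simp add: power_divide)
    also have "\<dots> \<le> exp 1 ^ 112" using exp_1_ge by (intro power_mono) auto
    also have "\<dots> = exp 112" by (simp flip: exp_of_nat_mult)
    finally have "Q \<le> ln (exp 112)" unfolding Q_def by (subst ln_le_cancel_iff) auto
    then show "Q \<le> 112" by simp
  qed
  have lp: "lam > 0" using lam by simp
  have n0: "1.08 * 10 ^ 48 * lam ^ 9 > 0" using lp by simp
  then have np: "n > 0" using n by linarith
  have "ln (1.08 * 10 ^ 48 * lam ^ 9) \<le> ln n" using n n0 np by (subst ln_le_cancel_iff) auto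
  then have lnn: "Q + 9 * ln lam \<le> ln n" using lp by (simp add: Q_def ln_mult ln_realpow)
  have "- 0.5 \<le> ln lam"
  proof -
    have "ln (1 / lam) \<le> 1 / lam - 1" using lp by (intro ln_le_minus_one) auto
    also have "\<dots> \<le> 1 / (2 / 3) - 1" using lam by (intro diff_right_mono divide_left_mono) auto
    finally show ?thesis using lp by (simp add: ln_div)
  qed
  then show b100: "100 \<le> b" using lnn Q by (simp add: b_def)
  show "3 * 10 ^ 8 * n * lam\<^sup>2 * b\<^sup>2 \<le> exp b"
  proof -
    have "exp (2 * ln lam) = lam\<^sup>2" using lp by (simp add: exp_double)
    then have e1: "exp (ln n + 2 * ln lam + 28) = n * lam\<^sup>2 * exp 28"
      using np by (simp add: exp_add)
    have "(10 ^ 12 :: real) \<le> 2.69 ^ 28" by (simp add: power_divide)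
    also have "\<dots> \<le> exp 1 ^ 28" using exp_1_ge by (intro power_mono) auto
    also have "\<dots> = exp 28" by (simp flip: exp_of_nat_mult)
    finally have e28: "10 ^ 12 \<le> exp (28 :: real)" .
    \<comment> \<open>\<open>exp w \<ge> exp 1 * w\<close> is squared; this tangent bound suffices
      because only \<open>6 / 10 ^ 4 * b ^ 2\<close> has to be absorbed.\<close>
    define w where "w = b / 102"
    have w: "0 \<le> w" using b100 by (simp add: w_def)
    have "2.69 * w \<le> exp 1 * exp (w - 1)"
      using exp_ge_add_one_self[of "w - 1"] w exp_1_ge by (intro mult_mono) auto
    then have "2.69 * w \<le> exp w" by (simp flip: exp_add)
    then have "(2.69 * w) ^ 2 \<le> exp w ^ 2" using w by (intro power_mono) auto
    also have "\<dots> = exp (b / 51)" by (simp add: w_def flip: exp_of_nat_mult)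
    finally have e2: "6 / 10 ^ 4 * b\<^sup>2 \<le> exp (b / 51)"
      by (simp add: w_def power_mult_distrib power_divide field_simps) (smt (verit) zero_le_power2)
    have "3 * 10 ^ 8 * n * lam\<^sup>2 * b\<^sup>2 \<le> 6 * 10 ^ 8 * (n * lam\<^sup>2 * b\<^sup>2)"
      using np by (simp add: mult.assoc)
    also have "\<dots> = n * lam\<^sup>2 * 10 ^ 12 * (6 / 10 ^ 4 * b\<^sup>2)" by simp
    also have "\<dots> \<le> n * lam\<^sup>2 * exp 28 * exp (b / 51)"
      using np e28 e2 by (intro mult_mono mult_left_mono) auto
    also have "\<dots> = exp (ln n + 2 * ln lam + 28 + b / 51)" unfolding exp_add[of _ "b / 51"] e1 ..
    also have "ln n + 2 * ln lam + 28 + b / 51 = b" by (simp add: b_def)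
    finally show ?thesis .
  qed
  \<comment> \<open>Normalized so that \<open>n = 1.08 * 10 ^ 48 * lam ^ 3 * y ^ 9\<close>. The
    hypothesis becomes \<open>lam ^ 6 \<le> y ^ 9\<close>, so \<open>ln lam\<close> is at most
    \<open>1.5 * ln y\<close> and \<open>b\<close> is bounded linearly in \<open>y\<close> alone;
    then both sides of the last claim compare as multiples of
    \<open>lam ^ 3 * y ^ 9\<close>.\<close>
  define y where "y = root 9 (n / (1.08 * 10 ^ 48 * lam ^ 3))"
  have y0: "y > 0" using np lp by (simp add: y_def)
  have y9: "n = 1.08 * 10 ^ 48 * lam ^ 3 * y ^ 9" using np lp by (simp add: y_def)
  have "ln n = Q + 3 * ln lam + 9 * ln y" unfolding y9 Q_def using lp y0 by (simp add: ln_mult ln_realpow)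
  then have b1: "b = 1.02 * (Q + 5 * ln lam + 9 * ln y + 28)" and ly: "6 * ln lam \<le> 9 * ln y"
    using lnn by (simp_all add: b_def)
  have "ln y \<le> y - 1" using y0 by (rule ln_le_minus_one)
  then have b2: "b \<le> 1.02 * (140 + 16.5 * (y - 1))"
  proof -
    have gen: "v + 5 * a + 9 * c + 28 \<le> 140 + 16.5 * d" if "6 * a \<le> 9 * c" "v \<le> 112" "c \<le> d" for a c d v :: real
    proof -
      have "5 * a \<le> 7.5 * c" using that by simp
      moreover have "16.5 * c \<le> 16.5 * d" using that by simp
      ultimately show ?thesis using that by simp
    qed
    have "Q + 5 * ln lam + 9 * ln y + 28 \<le> 140 + 16.5 * (y - 1)" by (rule gen[OF ly Q(2) \<open>ln y \<le> y - 1\<close>])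
    then show ?thesis unfolding b1 by (rule mult_left_mono) simp
  qed
  have ylarge: "0.7 \<le> y"
  proof -
    have "lam ^ 6 \<le> y ^ 9"
    proof -
      have "(1.08 * 10 ^ 48 * lam ^ 3) * lam ^ 6 \<le> (1.08 * 10 ^ 48 * lam ^ 3) * y ^ 9"
        using n unfolding y9 by (simp add: mult.assoc flip: power_add)
      then show ?thesis by (rule mult_left_le_imp_le) (use lp in simp)
    qed
    moreover have "0.7 ^ 9 \<le> (2 / 3 :: real) ^ 6" by (simp add: power_divide)
    moreover have "(2 / 3) ^ 6 \<le> lam ^ 6" using lam by (intro power_mono) auto
    ultimately have "0.7 ^ 9 \<le> y ^ 9" by linarith
    then show ?thesis using y0 by (simp add: power_mono_iff)
  qed
  have "b \<le> 210 * y" using b2 ylarge by (simp add: field_simps)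
  then have "b ^ 9 \<le> (210 * y) ^ 9" using b100 by (intro power_mono) auto
  then have b9: "b ^ 9 \<le> 210 ^ 9 * y ^ 9" by (simp add: power_mult_distrib)
  have "1.01 * (6.4 * 10 ^ 8 * b ^ 3) ^ 3 * lam\<^sup>2 * (0.81 + 3 * lam) \<le> 1.01 * (6.4 * 10 ^ 8 * b ^ 3) ^ 3 * lam\<^sup>2 * (4.22 * lam)"
    using lam b100 by (intro mult_left_mono) auto
  also have "\<dots> = (1.01 * (6.4 * 10 ^ 8) ^ 3 * 4.22) * lam ^ 3 * b ^ 9"
    by (simp add: power_mult_distrib eval_nat_numeral)
  also have "\<dots> \<le> (1.01 * (6.4 * 10 ^ 8) ^ 3 * 4.22) * lam ^ 3 * (210 ^ 9 * y ^ 9)"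
    using b9 lp by (intro mult_left_mono) auto
  also have "\<dots> = (1.01 * (6.4 * 10 ^ 8) ^ 3 * 4.22 * 210 ^ 9) * (lam ^ 3 * y ^ 9)" by simp
  also have "\<dots> < (1.08 * 10 ^ 48) * (lam ^ 3 * y ^ 9)" using lp y0 by (intro mult_strict_right_mono) auto
  also have "\<dots> = n" unfolding y9 by simp
  finally show "1.01 * (6.4 * 10 ^ 8 * b ^ 3) ^ 3 * lam\<^sup>2 * (0.81 + 3 * lam) < n" .
qed

section \<open>Repdigits, the three successive bounds and the equation\<close>

lemma repunit_times:
  assumes "g \<ge> 2" shows "repunit g m * (g - 1) = g ^ m - 1"
proof -
  have "\<exists>c. g ^ m = c * (g - 1) + 1"
  proof (induction m)
    case (Suc m)
    then obtain c where c: "g ^ m = c * (g - 1) + 1" by blast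
    have "g ^ Suc m = (g * c) * (g - 1) + g" by (simp add: c algebra_simps)
    also have "\<dots> = (g * c + 1) * (g - 1) + 1" using assms by (simp add: distrib_right)
    finally show ?case by blast
  qed (auto intro: exI[of _ 0])
  then obtain c where "g ^ m = c * (g - 1) + 1" by blast
  then have "(g - 1) dvd (g ^ m - 1)" by simp
  then show ?thesis by (simp add: repunit_def)
qed

lemma repdigit_bounds:
  assumes "g \<ge> 2" "1 \<le> d" "d \<le> g - 1" "1 \<le> m"
  shows "d * repunit g m < g ^ m" "g ^ (m - 1) \<le> d * repunit g m"
proof -
  have "d * repunit g m \<le> (g - 1) * repunit g m" using assms by (intro mult_right_mono) auto
  also have "\<dots> = g ^ m - 1" using repunit_times[OF assms(1)] by (simp add: mult.commute)
  also have "\<dots> < g ^ m" using assms by simp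
  finally show "d * repunit g m < g ^ m" .
  have "g ^ (m - 1) * (g - 1) \<le> repunit g m * (g - 1)"
  proof -
    have "g ^ m = g ^ (m - 1) * g" using assms by (simp add: power_eq_if)
    then have "g ^ (m - 1) * (g - 1) = g ^ m - g ^ (m - 1)" by (simp add: diff_mult_distrib2)
    also have "\<dots> \<le> g ^ m - 1" using assms by (intro diff_le_mono2) simp
    finally show ?thesis unfolding repunit_times[OF assms(1)] .
  qed
  then have "g ^ (m - 1) \<le> repunit g m" by (rule mult_right_le_imp_le) (use assms in simp)
  also have "\<dots> \<le> d * repunit g m" using assms by simp
  finally show "g ^ (m - 1) \<le> d * repunit g m" .
qed

text \<open>\<open>A\<close> bounds the loss in each of the three successive applications of the lower bound,
  to the exponents \<open>l\<close>, \<open>m\<close> and \<open>n\<close>; the height grows by the exponent just bounded.\<close>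
lemma exponent_chain:
  fixes A lam h l m n :: real
  assumes A: "6.4 * 10 ^ 14 \<le> A" and lam: "2 / 3 \<le> lam" and h: "2.8 \<le> h"
    and l: "l * lam \<le> A * lam * h + 2.2"
    and m: "m * lam \<le> A * lam * (h + l * lam) + 2.2"
  shows "h + l * lam \<le> 1.001 * A * lam * h" "h + l * lam + m * lam \<le> 1.003 * A\<^sup>2 * lam\<^sup>2 * h"
proof -
  have Al: "10 ^ 14 \<le> A * lam"
  proof -
    have "6.4 * 10 ^ 14 * (2 / 3) \<le> A * lam" using A lam by (intro mult_mono) auto
    then show ?thesis by simp
  qed
  have abs: "x + (y * x + 2.2) \<le> 1.001 * (y * x)" if "10 ^ 14 \<le> y" "1 \<le> x" for x y :: real
  proof -
    have "10 ^ 14 * x \<le> y * x" using that by (intro mult_right_mono) auto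
    moreover have "x + (z + 2.2) \<le> 1.001 * z" if "10 ^ 14 * x \<le> z" "1 \<le> x" for x z :: real
      using that by simp
    ultimately show ?thesis using that(2) by blast
  qed
  have "h + l * lam \<le> h + (A * lam * h + 2.2)" using l by simp
  also have "\<dots> \<le> 1.001 * (A * lam * h)" by (rule abs) (use Al h in auto)
  finally show 1: "h + l * lam \<le> 1.001 * A * lam * h" by (simp add: mult.assoc)
  define H where "H = 1.001 * (A * lam * h)"
  have H: "h + l * lam \<le> H" using 1 by (simp add: H_def mult.assoc)
  have H1: "1 \<le> H"
  proof -
    have "1 * 1 \<le> A * lam * h" using Al h by (intro mult_mono) auto
    then show ?thesis by (simp add: H_def)
  qed
  have "A * lam * (h + l * lam) \<le> A * lam * H" using Al by (intro mult_left_mono H) auto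
  then have "h + l * lam + m * lam \<le> H + (A * lam * H + 2.2)" using H m by simp
  also have "\<dots> \<le> 1.001 * (A * lam * H)" by (rule abs[OF Al H1])
  also have "\<dots> \<le> 1.003 * (A\<^sup>2 * lam\<^sup>2 * h)"
    using A lam h by (simp add: H_def power2_eq_square)
  finally show "h + l * lam + m * lam \<le> 1.003 * A\<^sup>2 * lam\<^sup>2 * h" by (simp add: mult.assoc)
qed

lemma ln_sqrt5: "ln (sqrt 5) \<le> 0.81"
proof -
  have "sqrt 5 \<le> 2.2361" using sqrt5_bounds by simp
  also have "\<dots> \<le> (1 + 0.81 / 64) ^ 64" by (simp add: power_divide)
  also have "\<dots> \<le> exp (0.81 / 64) ^ 64" using exp_ge_add_one_self[of "0.81 / 64 :: real"] by (intro power_mono) auto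
  also have "\<dots> = exp 0.81" by (simp flip: exp_of_nat_mult)
  finally have "ln (sqrt 5) \<le> ln (exp 0.81)" by (subst ln_le_cancel_iff) auto
  then show ?thesis by simp
qed

theorem theorem1p1:
  fixes g k d1 d2 d3 l m n :: nat
  assumes "g \<ge> 2"
    and "k \<ge> 1" and "l \<ge> 1" and "m \<ge> 1" and "n \<ge> 1"
    and "1 \<le> d1" and "d1 \<le> g - 1"
    and "1 \<le> d2" and "d2 \<le> g - 1"
    and "1 \<le> d3" and "d3 \<le> g - 1"
    and "l \<le> m" and "m \<le> n"
    and "fib k = (d1 * repunit g l) * (d2 * repunit g m) * (d3 * repunit g n)"
  shows "real n < 1.08 * 10 ^ 48 * (ln (real g)) ^ 9
    \<and> real k < 1.08 * 10 ^ 49 * (ln (real g)) ^ 10"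
proof -
  define lam where "lam = ln (real g)"
  define D where "D = d1 * d2 * d3"
  define s where "s = sqrt 5"
  define r :: real where "r = real g"
  have r2: "r \<ge> 2" using assms(1) by (simp add: r_def)
  have lam: "2 / 3 \<le> lam"
  proof -
    have "ln 2 \<le> lam" using assms(1) by (simp add: lam_def)
    then show ?thesis using ln_2_ge by linarith
  qed
  have rp: "r ^ j = exp (j * lam)" for j using r2 by (simp add: r_def lam_def exp_of_nat_mult)
  have rj: "1 \<le> r ^ j" for j using r2 by (intro one_le_power) simp
  have D1: "1 \<le> D" using assms by (simp add: D_def Suc_le_eq)
  have D3: "real D \<le> r ^ 3"
  proof -
    have "real D \<le> r * r * r" unfolding D_def of_nat_mult using assms by (intro mult_mono) (auto simp: r_def)
    then show ?thesis by (simp add: eval_nat_numeral)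
  qed
  have gm: "real (g - 1) = r - 1" using assms(1) by (simp add: r_def of_nat_diff)
  have gp: "real (g ^ j - 1) = r ^ j - 1" for j using assms(1) by (simp add: r_def of_nat_diff)
  have rep: "real (repunit g j) = (r ^ j - 1) / (r - 1)" for j
  proof -
    have "real (repunit g j) * (r - 1) = r ^ j - 1"
      using arg_cong[OF repunit_times[OF assms(1), of j], of real] by (simp only: of_nat_mult gm gp)
    then show ?thesis using r2 by (simp add: field_simps)
  qed
  have F: "s * fib k = s * D / (r - 1) ^ 3 * ((r ^ l - 1) * (r ^ m - 1) * (r ^ n - 1))"
    unfolding assms(14) of_nat_mult rep D_def using r2 by (simp add: eval_nat_numeral mult_ac)
  define x where "x = golden' ^ k"
  have G: "golden ^ k = s * D / (r - 1) ^ 3 * ((r ^ l - 1) * (r ^ m - 1) * (r ^ n - 1)) + x"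
    using fib_binet[of k] unfolding F[symmetric] by (simp add: s_def x_def)
  have gg: "1 < golden" using golden_bounds by simp
  have Fub: "real (fib k) \<le> r ^ (l + m + n)"
  proof -
    have "fib k \<le> g ^ l * g ^ m * g ^ n" unfolding assms(14)
      using repdigit_bounds(1)[of g d1 l] repdigit_bounds(1)[of g d2 m] repdigit_bounds(1)[of g d3 n] assms
      by (intro mult_mono) auto
    then have "real (fib k) \<le> real (g ^ l * g ^ m * g ^ n)" by (rule of_nat_mono)
    then show ?thesis by (simp add: r_def power_add)
  qed
  have Flb: "r ^ (n - 1) \<le> fib k"
  proof -
    have "g ^ (n - 1) \<le> d3 * repunit g n" using repdigit_bounds(2)[of g d3 n] assms by simp
    also have "\<dots> = 1 * 1 * (d3 * repunit g n)" by simp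
    also have "\<dots> \<le> (d1 * repunit g l) * (d2 * repunit g m) * (d3 * repunit g n)"
    proof -
      have "1 \<le> d1 * repunit g l" "1 \<le> d2 * repunit g m"
        using repdigit_bounds(2)[of g d1 l] repdigit_bounds(2)[of g d2 m] assms
        by (meson le_trans one_le_power le_trans[OF _ assms(1)] one_le_numeral)+
      then show ?thesis by (intro mult_mono) auto
    qed
    finally have "g ^ (n - 1) \<le> fib k" using assms(14) by simp
    then have "real (g ^ (n - 1)) \<le> real (fib k)" by (rule of_nat_mono)
    then show ?thesis by (simp add: r_def)
  qed
  have xabs: "\<bar>x\<bar> = 1 / golden ^ k"
  proof -
    have "\<bar>golden * golden'\<bar> ^ k = 1" by (simp add: golden_mult)
    then have "golden ^ k * \<bar>x\<bar> = 1" using gg by (simp add: x_def abs_mult power_mult_distrib power_abs)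
    then show ?thesis using gg by (simp add: field_simps)
  qed
  have x1: "\<bar>x\<bar> \<le> 1" unfolding xabs using gg by (simp add: one_le_power)
  have sF: "golden ^ k = s * fib k + x" using fib_binet[of k] by (simp add: s_def x_def)
  have s2: "2 \<le> s" "s \<le> 3" using sqrt5_bounds by (auto simp: s_def)
  have gk: "r ^ (n - 1) \<le> golden ^ k"
  proof -
    have "1 * real (fib k) + 1 \<le> s * fib k"
    proof -
      have "1 \<le> real (fib k)" using Flb rj[of "n - 1"] by linarith
      then have "2 * real (fib k) \<le> s * fib k" using s2 by (intro mult_right_mono) auto
      then show ?thesis using \<open>1 \<le> real (fib k)\<close> by linarith
    qed
    then show ?thesis using Flb sF x1 by linarith
  qed
  have xsmall: "\<bar>x\<bar> \<le> 1 / r ^ (n - 1)"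
    unfolding xabs using gk rj[of "n - 1"] by (intro divide_left_mono) (auto intro!: mult_pos_pos less_le_trans[of 0 1])
  \<comment> \<open>The contradiction hypothesis supplies the largeness that the lower bound demands
    of its exponent \<open>N\<close>, in all three applications.\<close>
  have n_bound: "real n < 1.08 * 10 ^ 48 * lam ^ 9"
  proof (rule ccontr)
    assume "\<not> ?thesis"
    then have large: "1.08 * 10 ^ 48 * lam ^ 9 \<le> real n" by simp
    define b where "b = 1.02 * (ln (real n) + 2 * ln lam + 28)"
    note nb = numeric_bounds[OF lam large, folded b_def]
    define A where "A = 6.4 * 10 ^ 8 * b ^ 3"
    define h1 where "h1 = 0.81 + 3 * lam"
    define h2 where "h2 = h1 + l * lam"
    define h3 where "h3 = h2 + m * lam"
    have h1: "2.8 \<le> h1" using lam by (simp add: h1_def)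
    have b2: "10 ^ 4 \<le> b\<^sup>2" using power_mono[OF nb(1), of 2] by simp
    have A: "6.4 * 10 ^ 14 \<le> A" using power_mono[OF nb(1), of 3] by (simp add: A_def)
    have n_gt: "1.01 * A ^ 3 * lam\<^sup>2 * h1 < n" using nb(3) by (simp add: A_def h1_def)
    \<comment> \<open>The largest height that occurs is of order \<open>A ^ 2\<close>, while
      \<open>n\<close> exceeds a multiple of \<open>A ^ 3\<close> and \<open>A\<close> contains
      \<open>b ^ 3\<close>; so the demand on \<open>N\<close> is always met.\<close>
    have room: "10 ^ 7 * h * b\<^sup>2 \<le> n" if "h \<le> 1.003 * A\<^sup>2 * lam\<^sup>2 * h1" for h
    proof -
      have "10 ^ 7 * h * b\<^sup>2 \<le> 10 ^ 7 * (1.003 * A\<^sup>2 * lam\<^sup>2 * h1) * b\<^sup>2"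
        using that by (intro mult_left_mono mult_right_mono) auto
      also have "\<dots> = (1.003 * 10 ^ 7 * b\<^sup>2) * (A\<^sup>2 * lam\<^sup>2 * h1)" by simp
      also have "\<dots> \<le> (1.01 * A) * (A\<^sup>2 * lam\<^sup>2 * h1)"
      proof (rule mult_right_mono)
        have "b\<^sup>2 * 100 \<le> b\<^sup>2 * b" using nb(1) by (intro mult_left_mono) auto
        then have "b\<^sup>2 \<le> b ^ 3" using b2 by (simp add: eval_nat_numeral)
        then show "1.003 * 10 ^ 7 * b\<^sup>2 \<le> 1.01 * A" using b2 by (simp add: A_def)
        show "0 \<le> A\<^sup>2 * lam\<^sup>2 * h1" using h1 by simp
      qed
      also have "\<dots> = 1.01 * A ^ 3 * lam\<^sup>2 * h1" by (simp add: eval_nat_numeral)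
      finally show ?thesis using n_gt by linarith
    qed
    \<comment> \<open>For \<open>r * (r - 1) \<le> r ^ n\<close>, on which \<open>r \<le> X3\<close>
      rests.\<close>
    have n2: "2 \<le> n"
    proof -
      have "10 ^ 7 * 1 * b\<^sup>2 \<le> n"
      proof (rule room)
        have "1 * (2 / 3)\<^sup>2 * 2.8 \<le> A\<^sup>2 * lam\<^sup>2 * h1" using A lam h1 by (intro mult_mono power_mono) auto
        then show "1 \<le> 1.003 * A\<^sup>2 * lam\<^sup>2 * h1" by (simp add: power2_eq_square)
      qed
      then have "2 \<le> real n" using b2 by simp
      then show ?thesis by simp
    qed
    have step: "j * lam \<le> A * lam * h + 2.2"
      if "1 \<le> n1" "1 \<le> n2" "ln (sqrt 5 * real n1) \<le> h" "ln (real n2) \<le> h" "0.8 \<le> h" "10 ^ 7 * h * b\<^sup>2 \<le> n"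
        "n \<le> N" "N \<le> 3 * n" "golden ^ k = s * n1 / n2 * r ^ N * (1 - t)" "\<bar>t\<bar> \<le> 4 / r ^ j" for n1 n2 N j :: nat and h t :: real
    proof -
      interpret lf: linear_form g N k n1 n2 h using assms(1) that by unfold_locales auto
      have ll: "lf.lam = lam" by (simp add: lf.lam_def lam_def)
      have "10 ^ 7 * h * b\<^sup>2 \<le> N" using that by linarith
      moreover have "10 ^ 8 * real N * lf.lam\<^sup>2 * b\<^sup>2 \<le> exp b"
      proof -
        have "10 ^ 8 * real N * lam\<^sup>2 * b\<^sup>2 \<le> 10 ^ 8 * (3 * real n) * lam\<^sup>2 * b\<^sup>2"
          using that(8) by (intro mult_left_mono mult_right_mono) auto
        also have "\<dots> = 3 * 10 ^ 8 * real n * lam\<^sup>2 * b\<^sup>2" by simp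
        also have "\<dots> \<le> exp b" by (rule nb(2))
        finally show ?thesis unfolding ll .
      qed
      moreover have "golden ^ k = lf.eta * real g ^ N * (1 - t)" using that by (simp add: lf.eta_def s_def r_def)
      ultimately have "j * lf.lam \<le> 6.4 * 10 ^ 8 * b ^ 3 * lf.lam * h + 2.2"
        using that by (intro lf.exponent_bound[OF nb(1)]) (auto simp: r_def)
      then show ?thesis by (simp add: ll A_def)
    qed
    define R where "R = (\<lambda>j. (r ^ j - 1) / (r - 1))"
    have R1: "1 \<le> R j" if "1 \<le> j" for j
    proof -
      have "r ^ 1 \<le> r ^ j" using r2 that by (intro power_increasing) auto
      then show ?thesis using r2 by (simp add: R_def)
    qed
    \<comment> \<open>The main terms of the three linear forms: in \<open>X1\<close> all, in
      \<open>X2\<close> two, in \<open>X3\<close> one of the factors \<open>r ^ j - 1\<close> are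
      replaced by pure powers; the others join \<open>eta\<close>.\<close>
    define X1 where "X1 = s * D / (r - 1) ^ 3 * (r ^ l * r ^ m * r ^ n)"
    define X2 where "X2 = s * D / (r - 1) ^ 3 * ((r ^ l - 1) * r ^ m * r ^ n)"
    define X3 where "X3 = s * D / (r - 1) ^ 3 * ((r ^ l - 1) * (r ^ m - 1) * r ^ n)"
    \<comment> \<open>This gains one more power of \<open>r\<close> over \<open>xsmall\<close>, so
      that the conjugate term has relative size at most \<open>1 / r ^ n\<close>.\<close>
    have X3: "r \<le> X3"
    proof -
      have "r * (r - 1) \<le> r ^ 2" using r2 by (simp add: power2_eq_square)
      also have "\<dots> \<le> r ^ n" using r2 n2 by (intro power_increasing) auto
      finally have "r \<le> r ^ n / (r - 1)" using r2 by (simp add: field_simps)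
      then have "1 * 1 * 1 * r \<le> (s * D) * R l * R m * (r ^ n / (r - 1))"
        using R1[OF assms(3)] R1[OF assms(4)] s2 D1 r2 mult_mono[of 1 s 1 "real D"]
        by (intro mult_mono mult_nonneg_nonneg) auto
      also have "\<dots> = X3" using r2 by (simp add: X3_def R_def eval_nat_numeral mult_ac)
      finally show ?thesis by simp
    qed
    have c0: "0 \<le> s * D / (r - 1) ^ 3" using s2 r2 by simp
    have X32: "X3 \<le> X2" unfolding X3_def X2_def using c0 rj[of l] rj[of m] rj[of n]
      by (intro mult_left_mono mult_right_mono) auto
    have X21: "X2 \<le> X1" unfolding X2_def X1_def using c0 rj[of l] rj[of m] rj[of n]
      by (intro mult_left_mono mult_right_mono) auto
    have xX: "\<bar>x / X\<bar> \<le> 1 / r ^ n" if "X3 \<le> X" for X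
    proof -
      have "r \<le> X" using that X3 by simp
      then have "\<bar>x / X\<bar> \<le> 1 / r ^ (n - 1) / r"
        unfolding abs_divide using xsmall r2 rj[of "n - 1"] by (intro frac_le) auto
      also have "\<dots> = 1 / r ^ n" using assms(5) by (simp add: power_eq_if)
      finally show ?thesis .
    qed
    define \<alpha> \<beta> \<gamma> where "\<alpha> = 1 / r ^ l" and "\<beta> = 1 / r ^ m" and "\<gamma> = 1 / r ^ n"
    have abc: "0 \<le> \<gamma>" "\<gamma> \<le> \<beta>" "\<beta> \<le> \<alpha>" "\<alpha> \<le> 1"
    proof -
      have "r ^ l \<le> r ^ m" "r ^ m \<le> r ^ n" using assms r2 by (auto intro!: power_increasing)
      then show "0 \<le> \<gamma>" "\<gamma> \<le> \<beta>" "\<beta> \<le> \<alpha>" "\<alpha> \<le> 1" using rj[of l] rj[of m] rj[of n]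
        by (auto simp: \<alpha>_def \<beta>_def \<gamma>_def intro!: frac_le)
    qed
    have Xn: "X1 \<noteq> 0" "X2 \<noteq> 0" "X3 \<noteq> 0" using X3 X32 X21 r2 by linarith+
    have rn: "r ^ j \<noteq> 0" for j using r2 by simp
    have e: "r ^ l - 1 = r ^ l * (1 - \<alpha>)" "r ^ m - 1 = r ^ m * (1 - \<beta>)" "r ^ n - 1 = r ^ n * (1 - \<gamma>)"
      using rn by (simp_all add: \<alpha>_def \<beta>_def \<gamma>_def right_diff_distrib)
    have Xe: "X * (1 - (1 - P - x / X)) = X * P + x" if "X \<noteq> 0" for X P
      using that by (simp add: algebra_simps)
    have G1: "golden ^ k = X1 * (1 - (1 - (1 - \<alpha>) * (1 - \<beta>) * (1 - \<gamma>) - x / X1))"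
      unfolding Xe[OF Xn(1)] G e by (simp add: X1_def mult_ac)
    have G2: "golden ^ k = X2 * (1 - (1 - (1 - \<beta>) * (1 - \<gamma>) - x / X2))"
      unfolding Xe[OF Xn(2)] G e(2,3) by (simp add: X2_def mult_ac)
    have G3: "golden ^ k = X3 * (1 - (\<gamma> - x / X3))"
      using Xe[OF Xn(3), of "1 - \<gamma>"] unfolding G e(3) by (simp add: X3_def mult_ac)
    have prod2: "0 \<le> 1 - (1 - a) * (1 - c)" "1 - (1 - a) * (1 - c) \<le> a + c" if "0 \<le> a" "a \<le> 1" "0 \<le> c" "c \<le> 1" for a c :: real
      using that mult_le_one[of "1 - a" "1 - c"] mult_nonneg_nonneg[of a c] by (auto simp: algebra_simps)
    have t3: "\<bar>\<gamma> - x / X3\<bar> \<le> 4 / r ^ n"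
    proof -
      have "\<bar>x / X3\<bar> \<le> \<gamma>" using xX[of X3] by (simp add: \<gamma>_def)
      then have "\<bar>\<gamma> - x / X3\<bar> \<le> 4 * \<gamma>" using abc by linarith
      then show ?thesis by (simp add: \<gamma>_def)
    qed
    have t2: "\<bar>1 - (1 - \<beta>) * (1 - \<gamma>) - x / X2\<bar> \<le> 4 / r ^ m"
    proof -
      have "\<bar>x / X2\<bar> \<le> \<gamma>" using xX[OF X32] by (simp add: \<gamma>_def)
      then have "\<bar>1 - (1 - \<beta>) * (1 - \<gamma>) - x / X2\<bar> \<le> 4 * \<beta>" using prod2[of \<beta> \<gamma>] abc by (smt (verit))
      then show ?thesis by (simp add: \<beta>_def)
    qed
    \<comment> \<open>The three factors contribute at most
      \<open>\<alpha> + \<beta> + \<gamma>\<close> and the conjugate term \<open>\<gamma>\<close>,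
      each at most \<open>\<alpha>\<close>; hence the constant 4.\<close>
    have t1: "\<bar>1 - (1 - \<alpha>) * (1 - \<beta>) * (1 - \<gamma>) - x / X1\<bar> \<le> 4 / r ^ l"
    proof -
      define c where "c = 1 - (1 - \<alpha>) * (1 - \<beta>)"
      have c: "0 \<le> c" "c \<le> \<alpha> + \<beta>" unfolding c_def using abc by (intro prod2; linarith)+
      have "c \<le> 1" using abc by (simp add: c_def)
      have ce: "(1 - \<alpha>) * (1 - \<beta>) * (1 - \<gamma>) = (1 - c) * (1 - \<gamma>)" by (simp add: c_def)
      have "\<bar>x / X1\<bar> \<le> \<gamma>" using xX[of X1] X32 X21 by (simp add: \<gamma>_def)
      then have "\<bar>1 - (1 - c) * (1 - \<gamma>) - x / X1\<bar> \<le> 4 * \<alpha>" using prod2[of c \<gamma>] c \<open>c \<le> 1\<close> abc by (smt (verit))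
      then show ?thesis unfolding ce by (simp add: \<alpha>_def)
    qed
    have lnn: "ln (sqrt 5 * real c) \<le> 0.81 + e" if "1 \<le> c" "real c \<le> exp e" for c :: nat and e
    proof -
      have "ln (sqrt 5 * real c) = ln (sqrt 5) + ln (real c)" using that by (simp add: ln_mult)
      also have "ln (real c) \<le> ln (exp e)" using that by (subst ln_le_cancel_iff) auto
      finally show ?thesis using ln_sqrt5 by simp
    qed
    have den: "1 \<le> (g - 1) ^ 3" "real ((g - 1) ^ 3) = (r - 1) ^ 3" using assms(1) gm by (auto simp: of_nat_power)
    have lnden: "ln (real ((g - 1) ^ 3)) \<le> 3 * lam"
    proof -
      have "(r - 1) ^ 3 \<le> r ^ 3" using r2 by (intro power_mono) auto
      then have "ln ((r - 1) ^ 3) \<le> ln (r ^ 3)" using r2 by (subst ln_le_cancel_iff) auto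
      then show ?thesis unfolding den(2) using r2 by (simp add: ln_realpow lam_def r_def)
    qed
    have gl1: "1 \<le> g ^ j - 1" if "1 \<le> j" for j
    proof -
      have "g ^ 1 \<le> g ^ j" using assms(1) that by (intro power_increasing) auto
      then show ?thesis using assms(1) by simp
    qed
    have h12: "h1 \<le> h2" "h2 \<le> h3" using lam by (simp_all add: h2_def h3_def)
    have De: "real D \<le> exp (3 * lam)" using D3 rp[of 3] by simp
    have h2room: "h2 \<le> 1.003 * A\<^sup>2 * lam\<^sup>2 * h1"
      if "h2 \<le> 1.001 * A * lam * h1"
    proof -
      have scale: "1.001 * P \<le> 1.003 * Q" if "P * 1 \<le> Q" "0 \<le> Q" for P Q :: real using that by simp
      have "1 * 1 \<le> A * lam" using A lam mult_mono[of 1 "6.4 * 10 ^ 14 :: real" "2 / 3" lam] mult_mono[of "6.4 * 10 ^ 14" A "2 / 3" lam] by simp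
      then have "(A * lam * h1) * 1 \<le> (A * lam * h1) * (A * lam)" using A lam h1 by (intro mult_left_mono mult_nonneg_nonneg) auto
      moreover have "0 \<le> (A * lam * h1) * (A * lam)" using A lam h1 by (intro mult_nonneg_nonneg) auto
      ultimately have "1.001 * (A * lam * h1) \<le> 1.003 * ((A * lam * h1) * (A * lam))"
        by (rule scale)
      then show ?thesis using that by (simp add: power2_eq_square mult_ac)
    qed
    have "h1 \<le> 1.003 * A\<^sup>2 * lam\<^sup>2 * h1"
    proof -
      have "2\<^sup>2 * (2 / 3)\<^sup>2 \<le> A\<^sup>2 * lam\<^sup>2" using A lam by (intro mult_mono power_mono) auto
      then have "1 \<le> 1.003 * (A\<^sup>2 * lam\<^sup>2)" by (simp add: power_divide)
      then have "1 * h1 \<le> (1.003 * (A\<^sup>2 * lam\<^sup>2)) * h1" using h1 by (intro mult_right_mono) auto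
      then show ?thesis by simp
    qed
    have l_bound: "l * lam \<le> A * lam * h1 + 2.2"
    proof (rule step[where ?n1.0 = D and ?n2.0 = "(g - 1) ^ 3" and N = "l + m + n" and t = "1 - (1 - \<alpha>) * (1 - \<beta>) * (1 - \<gamma>) - x / X1"])
      show "ln (sqrt 5 * real D) \<le> h1" using lnn[OF D1 De] by (simp add: h1_def)
      show "golden ^ k = s * D / real ((g - 1) ^ 3) * r ^ (l + m + n) * (1 - (1 - (1 - \<alpha>) * (1 - \<beta>) * (1 - \<gamma>) - x / X1))"
        unfolding den(2) power_add using G1 by (simp add: X1_def)
      show "10 ^ 7 * h1 * b\<^sup>2 \<le> n" by (rule room) fact
    qed (use D1 den lnden h1 t1 assms in \<open>auto simp: h1_def\<close>)
    have h2_le: "h2 \<le> 1.001 * A * lam * h1"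
    proof -
      have "0 * lam \<le> A * lam * (h1 + l * lam) + 2.2" using A lam h1 by simp
      from exponent_chain(1)[OF A lam h1 l_bound this] show ?thesis by (simp add: h2_def)
    qed
    have m_bound: "m * lam \<le> A * lam * h2 + 2.2"
    proof (rule step[where ?n1.0 = "D * (g ^ l - 1)" and ?n2.0 = "(g - 1) ^ 3" and N = "m + n" and t = "1 - (1 - \<beta>) * (1 - \<gamma>) - x / X2"])
      have "real (D * (g ^ l - 1)) \<le> exp (3 * lam) * exp (l * lam)"
        unfolding of_nat_mult gp using De rp[of l] rj[of l] by (intro mult_mono) auto
      then show "ln (sqrt 5 * real (D * (g ^ l - 1))) \<le> h2"
        using lnn[of "D * (g ^ l - 1)" "3 * lam + l * lam"] D1 gl1[OF assms(3)] by (simp add: h2_def h1_def exp_add)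
      show "golden ^ k = s * real (D * (g ^ l - 1)) / real ((g - 1) ^ 3) * r ^ (m + n) * (1 - (1 - (1 - \<beta>) * (1 - \<gamma>) - x / X2))"
        unfolding den(2) power_add of_nat_mult gp using G2 by (simp add: X2_def mult_ac)
      show "10 ^ 7 * h2 * b\<^sup>2 \<le> n" by (rule room) (rule h2room[OF h2_le])
      show "1 \<le> D * (g ^ l - 1)" using D1 gl1[OF assms(3)] by simp
      show "ln (real ((g - 1) ^ 3)) \<le> h2" using lnden h12 by (simp add: h1_def)
    qed (use den h1 h12 t2 assms in auto)
    have h3_le: "h3 \<le> 1.003 * A\<^sup>2 * lam\<^sup>2 * h1"
      using exponent_chain(2)[OF A lam h1 l_bound] m_bound by (simp add: h3_def h2_def)
    have n_bound: "n * lam \<le> A * lam * h3 + 2.2"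
    proof (rule step[where ?n1.0 = "D * (g ^ l - 1) * (g ^ m - 1)" and ?n2.0 = "(g - 1) ^ 3" and N = n and t = "\<gamma> - x / X3"])
      have "real (D * (g ^ l - 1) * (g ^ m - 1)) \<le> exp (3 * lam) * exp (l * lam) * exp (m * lam)"
        unfolding of_nat_mult gp using De rp[of l] rj[of l] rp[of m] rj[of m] by (intro mult_mono) auto
      then show "ln (sqrt 5 * real (D * (g ^ l - 1) * (g ^ m - 1))) \<le> h3"
        using lnn[of "D * (g ^ l - 1) * (g ^ m - 1)" "3 * lam + l * lam + m * lam"] D1 gl1[OF assms(3)] gl1[OF assms(4)]
        by (simp add: h3_def h2_def h1_def exp_add)
      show "golden ^ k = s * real (D * (g ^ l - 1) * (g ^ m - 1)) / real ((g - 1) ^ 3) * r ^ n * (1 - (\<gamma> - x / X3))"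
        unfolding den(2) of_nat_mult gp using G3 by (simp add: X3_def mult_ac)
      show "10 ^ 7 * h3 * b\<^sup>2 \<le> n" by (rule room) fact
      show "1 \<le> D * (g ^ l - 1) * (g ^ m - 1)" using D1 gl1[OF assms(3)] gl1[OF assms(4)] by simp
      show "ln (real ((g - 1) ^ 3)) \<le> h3" using lnden h12 by (simp add: h1_def)
    qed (use den h1 h12 t3 assms in auto)
    have "A * lam * h3 \<le> A * lam * (1.003 * A\<^sup>2 * lam\<^sup>2 * h1)" using A lam h3_le by (intro mult_left_mono) auto
    then have "real n * lam \<le> lam * (1.003 * A ^ 3 * lam\<^sup>2 * h1) + 2.2" using n_bound by (simp add: eval_nat_numeral mult_ac)
    \<comment> \<open>3.3 is \<open>2.2 / (2 / 3)\<close>, by the lower bound for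
      \<open>lam\<close>; it fits into the gap between 1.003 and 1.01.\<close>
    also have "\<dots> \<le> lam * (1.003 * A ^ 3 * lam\<^sup>2 * h1 + 3.3)" using lam by (simp add: distrib_left)
    finally have "real n \<le> 1.003 * A ^ 3 * lam\<^sup>2 * h1 + 3.3" using lam by (simp add: mult.commute[of _ lam])
    moreover have "3.3 \<le> 0.007 * (A ^ 3 * lam\<^sup>2 * h1)"
    proof -
      have "10 ^ 14 * (2 / 3)\<^sup>2 * 2.8 \<le> A ^ 3 * lam\<^sup>2 * h1"
      proof (intro mult_mono power_mono)
        have "A ^ 1 \<le> A ^ 3" using A by (intro power_increasing) auto
        then show "10 ^ 14 \<le> A ^ 3" using A by simp
      qed (use A lam h1 in auto)
      then show ?thesis by (simp add: power2_eq_square)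
    qed
    ultimately show False using n_gt by simp
  qed
  \<comment> \<open>\<open>golden ^ k \<le> 4 * r ^ (3 * n)\<close> as \<open>l\<close> and
    \<open>m\<close> are at most \<open>n\<close>; dividing by \<open>ln golden \<ge> 0.38\<close>
    gives a factor below 8, within the factor 10 of the claim.\<close>
  moreover have "real k < 1.08 * 10 ^ 49 * lam ^ 10"
  proof -
    have "golden ^ k \<le> 3 * r ^ (l + m + n) + 1"
    proof -
      have "s * fib k \<le> 3 * r ^ (l + m + n)" using s2 Fub by (intro mult_mono) auto
      then show ?thesis using sF x1 by linarith
    qed
    also have "\<dots> \<le> 4 * r ^ (3 * n)"
    proof -
      have "r ^ (l + m + n) \<le> r ^ (3 * n)" using assms r2 by (intro power_increasing) auto
      then show ?thesis using rj[of "3 * n"] by linarith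
    qed
    finally have "ln (golden ^ k) \<le> ln (4 * r ^ (3 * n))" using gg r2 by (subst ln_le_cancel_iff) auto
    moreover have "ln (golden ^ k) = k * ln golden" using gg by (simp add: ln_realpow)
    moreover have "ln (4 * r ^ (3 * n)) = ln 4 + 3 * n * lam" using r2 by (simp add: ln_mult ln_realpow lam_def r_def)
    moreover have "ln (4 :: real) \<le> 4 - 1" by (intro ln_le_minus_one) auto
    moreover have "real k * 0.38 \<le> k * ln golden" using gam_bounds_aux(1) by (intro mult_left_mono) auto
    ultimately have k1: "real k * 0.38 \<le> 3 + 3 * (n * lam)" by simp
    have "n * lam \<le> 1.08 * 10 ^ 48 * lam ^ 9 * lam" using n_bound lam by (intro mult_right_mono) auto
    also have "\<dots> = 1.08 * 10 ^ 48 * lam ^ 10" by (simp add: eval_nat_numeral)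
    finally have k2: "n * lam \<le> 1.08 * 10 ^ 48 * lam ^ 10" .
    have "(2 / 3) ^ 10 \<le> lam ^ 10" using lam by (intro power_mono) auto
    moreover have "1 / 10 ^ 2 \<le> (2 / 3 :: real) ^ 10" by (simp add: power_divide)
    ultimately have k3: "1 / 10 ^ 2 \<le> lam ^ 10" by linarith
    have "a < 1.08 * 10 ^ 49 * c" if "a * 0.38 \<le> 3 + 3 * d" "d \<le> 1.08 * 10 ^ 48 * c" "1 / 10 ^ 2 \<le> c" for a c d :: real
      using that by simp
    from this[OF k1 k2 k3] show ?thesis .
  qed
  ultimately show ?thesis by (simp add: lam_def)
qed

end
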